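(* Let $\nu>0$, let $\lambda$ and $\varsigma\ge0$ be constants, and let $\rho:\mathbb{R}\to\mathbb{R}$ be globally Lipschitz continuous with $|\rho(x)|^2=\lambda^2(\varsigma^2+x^2)$ for all $x\in\mathbb{R}$. Let $\mu$ be Lebesgue measure on $\mathbb{R}$, and let $u$ be the random field solution of $\left(\partial_t-\frac{\nu}{2}\partial_x^2\right)u=\rho(u)\dot W$ on $\mathbb{R}_+^*\times\mathbb{R}$, $u(0,\cdot)=\mu$. Then for all $t>0$ and $x,y\in\mathbb{R}$, $$\mathbb{E}[u(t,x)u(t,y)]=1+(1+\varsigma^2)\left(\exp\left(\frac{\lambda^4t-2\lambda^2|x-y|}{4\nu}\right)\mathrm{erfc}\left(\frac{|x-y|-\lambda^2t}{2\sqrt{\nu t}}\right)-\mathrm{erfc}\left(\frac{|x-y|}{2\sqrt{\nu t}}\right)\right).$$ In particular, when $y=x$, $\mathbb{E}[|u(t,x)|^2]=1+(1+\varsigma^2)\mathcal H(t)$.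
   Context: $\mathbb{R}_+^*=\,]0,+\infty[$. $G_\nu(t,x)=\frac{1}{\sqrt{2\pi\nu t}}\exp\{-\frac{|x|^2}{2\nu t}\}$ for $t>0$, and $G_\nu(t,\cdot)\equiv0$ for $t\le 0$. $\mathrm{erfc}(x)=1-\frac{2}{\sqrt\pi}\int_0^xe^{-y^2}\mathrm{d}y$; $\Phi(x)=\int_{-\infty}^x\frac{e^{-y^2/2}}{\sqrt{2\pi}}\mathrm{d}y$; $\mathcal H(t)=2e^{\frac{\lambda^4t}{4\nu}}\Phi\big(\lambda^2\sqrt{\tfrac{t}{2\nu}}\big)-1$. $\dot W$ is a space-time white noise on $\mathbb{R}_+\times\mathbb{R}$ defined on a probability space $(\Omega,\mathcal F,P)$, with $(\mathcal F_t)$ its natural filtration augmented by the $P$-null sets and made right-continuous. Stochastic integrals are in the sense of Walsh. $\|\cdot\|_2$ is the $L^2(\Omega)$-norm, and $(f\star g)(t,x)=\int_0^t\mathrm{d}s\int_{\mathbb{R}}f(s,y)g(t-s,x-y)\,\mathrm{d}y$. Put $J_0(t,x)=\int_{\mathbb{R}}G_\nu(t,x-y)\mu(\mathrm{d}y)$ and $I(t,x)=\iint_{[0,t]\times\mathbb{R}}G_\nu(t-s,x-y)\rho(u(s,y))\dot W(\mathrm{d}s,\mathrm{d}y)$. A random field solution is $u=(u(t,x):(t,x)\in\mathbb{R}_+^*\times\mathbb{R})$ such that: (a) $u(t,x)$ is $\mathcal F_t$-measurable for all $(t,x)$; (b) $u$ is jointly measurable with respect to $\mathcal B(\mathbb{R}_+^*\times\mathbb{R})\times\mathcal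 F$; (c) $(G_\nu^2\star\|\rho(u)\|_2^2)(t,x)<+\infty$ for all $(t,x)\in\mathbb{R}_+^*\times\mathbb{R}$, and $(t,x)\mapsto I(t,x)$ is continuous from $\mathbb{R}_+^*\times\mathbb{R}$ into $L^2(\Omega)$; (d) for all $(t,x)\in\mathbb{R}_+^*\times\mathbb{R}$, $u(t,x)=J_0(t,x)+I(t,x)$ almost surely. Under the stated hypotheses it exists and is unique up to versions. *)

theory Defs
  imports "HOL-Probability.Probability"
begin

section \<open>Special functions\<close>

definition heat_kernel :: "real \<Rightarrow> real \<Rightarrow> real \<Rightarrow> real" where
  "heat_kernel \<nu> t x =
     (if t > 0 then 1 / sqrt (2 * pi * \<nu> * t) * exp (- (\<bar>x\<bar>\<^sup>2 / (2 * \<nu> * t))) else 0)"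

(* The interval integral is oriented, so x < 0 is covered. *)
definition erfc :: "real \<Rightarrow> real" where
  "erfc x = 1 - 2 / sqrt pi * (LBINT y=0..x. exp (- (y\<^sup>2)))"

definition Phi :: "real \<Rightarrow> real" where
  "Phi x = (LBINT y:{..x}. exp (- (y\<^sup>2 / 2)) / sqrt (2 * pi))"

definition H_fun :: "real \<Rightarrow> real \<Rightarrow> real \<Rightarrow> real" where
  "H_fun \<nu> lam t =
     2 * exp (lam ^ 4 * t / (4 * \<nu>)) * Phi (lam\<^sup>2 * sqrt (t / (2 * \<nu>))) - 1"

section \<open>Space-time white noise and its filtration\<close>

definition noise_sets :: "(real \<times> real) set set" where
  "noise_sets = {B \<in> sets borel. B \<subseteq> {0..} \<times> UNIV \<and> emeasure lborel B < \<infinity>}"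

(* Degenerate Gaussians (variance 0) are included: they occur as linear combinations. *)
definition centered_gaussian :: "'w measure \<Rightarrow> ('w \<Rightarrow> real) \<Rightarrow> bool" where
  "centered_gaussian M X \<longleftrightarrow> X \<in> borel_measurable M \<and>
     (\<exists>\<sigma>\<ge>0. distr M borel X =
        (if \<sigma> = 0 then return borel 0 else density lborel (\<lambda>x. ennreal (normal_density 0 \<sigma> x))))"

(* A centered Gaussian family indexed by the Borel subsets of finite Lebesgue measure of the
   closed half plane, with covariance E[W(A) W(B)] = |A Int B|. *)
definition space_time_white_noise ::
  "'w measure \<Rightarrow> ((real \<times> real) set \<Rightarrow> 'w \<Rightarrow> real) \<Rightarrow> bool" where
  "space_time_white_noise M W \<longleftrightarrow>
     (\<forall>\<A> c. finite \<A> \<and> \<A> \<subseteq> noise_sets \<longrightarrow>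
        centered_gaussian M (\<lambda>\<omega>. \<Sum>A\<in>\<A>. c A * W A \<omega>)) \<and>
     (\<forall>A\<in>noise_sets. \<forall>B\<in>noise_sets.
        (LINT \<omega>|M. W A \<omega> * W B \<omega>) = measure lborel (A \<inter> B))"

definition noise_events ::
  "'w measure \<Rightarrow> ((real \<times> real) set \<Rightarrow> 'w \<Rightarrow> real) \<Rightarrow> real \<Rightarrow> 'w set set" where
  "noise_events M W t = sigma_sets (space M)
     ({W B -` S \<inter> space M | B S. B \<in> noise_sets \<and> B \<subseteq> {0..t} \<times> UNIV \<and> S \<in> sets borel}
      \<union> null_sets M)"

(* The right-continuous augmented filtration, as measurable spaces; the measure carried by
   each of them is irrelevant. *)
definition noise_filtration ::
  "'w measure \<Rightarrow> ((real \<times> real) set \<Rightarrow> 'w \<Rightarrow> real) \<Rightarrow> real \<Rightarrow> 'w measure" where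
  "noise_filtration M W t = sigma (space M) (\<Inter>s\<in>{t<..}. noise_events M W s)"

section \<open>Walsh integral\<close>

definition half_plane :: "(real \<times> real) set" where
  "half_plane = {0<..} \<times> UNIV"

definition process_measure :: "'w measure \<Rightarrow> ((real \<times> real) \<times> 'w) measure" where
  "process_measure M = restrict_space lborel half_plane \<Otimes>\<^sub>M M"

(* (Y, a, b, A) stands for the elementary process Y(\<omega>) 1_{]a,b]}(s) 1_A(y); a simple process is
   a finite sum of elementary ones, given as a list. *)
type_synonym 'w elementary = "('w \<Rightarrow> real) \<times> real \<times> real \<times> real set"

definition elementary_process ::
  "'w measure \<Rightarrow> ((real \<times> real) set \<Rightarrow> 'w \<Rightarrow> real) \<Rightarrow> 'w elementary \<Rightarrow> bool" where
  "elementary_process M W = (\<lambda>(Y, a, b, A).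
     0 \<le> a \<and> a < b \<and> A \<in> sets borel \<and> emeasure lborel A < \<infinity> \<and>
     Y \<in> borel_measurable (noise_filtration M W a) \<and> (\<exists>C. \<forall>\<omega>\<in>space M. \<bar>Y \<omega>\<bar> \<le> C))"

definition simple_value :: "'w elementary list \<Rightarrow> real \<Rightarrow> real \<Rightarrow> 'w \<Rightarrow> real" where
  "simple_value es s y \<omega> =
     (\<Sum>(Y, a, b, A)\<leftarrow>es. Y \<omega> * indicator {a<..b} s * indicator A y)"

definition simple_integral ::
  "((real \<times> real) set \<Rightarrow> 'w \<Rightarrow> real) \<Rightarrow> 'w elementary list \<Rightarrow> 'w \<Rightarrow> real" where
  "simple_integral W es \<omega> = (\<Sum>(Y, a, b, A)\<leftarrow>es. Y \<omega> * W ({a<..b} \<times> A) \<omega>)"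

definition L2_norm_sq :: "'w measure \<Rightarrow> ('w \<Rightarrow> real) \<Rightarrow> ennreal" where
  "L2_norm_sq M X = (\<integral>\<^sup>+\<omega>. ennreal ((X \<omega>)\<^sup>2) \<partial>M)"

(* X is a version of the Walsh integral of Z over the half plane: Z is a limit of simple processes
   in L^2(ds dy dP), and X is the limit of their integrals in L^2(P). Such limits Z are exactly the
   square integrable processes equal ds dy dP-almost everywhere to a predictable one. *)
definition has_walsh_integral ::
  "'w measure \<Rightarrow> ((real \<times> real) set \<Rightarrow> 'w \<Rightarrow> real) \<Rightarrow>
   (real \<Rightarrow> real \<Rightarrow> 'w \<Rightarrow> real) \<Rightarrow> ('w \<Rightarrow> real) \<Rightarrow> bool" where
  "has_walsh_integral M W Z X \<longleftrightarrow>
     (\<lambda>((s, y), \<omega>). Z s y \<omega>) \<in> borel_measurable (process_measure M) \<and>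
     X \<in> borel_measurable M \<and>
     (\<exists>S :: nat \<Rightarrow> 'w elementary list.
        (\<forall>n. \<forall>e\<in>set (S n). elementary_process M W e) \<and>
        (\<lambda>n. L2_norm_sq (process_measure M) (\<lambda>((s, y), \<omega>). simple_value (S n) s y \<omega> - Z s y \<omega>))
           \<longlonglongrightarrow> 0 \<and>
        (\<lambda>n. L2_norm_sq M (\<lambda>\<omega>. simple_integral W (S n) \<omega> - X \<omega>)) \<longlonglongrightarrow> 0)"

section \<open>Random field solutions\<close>

definition st_conv ::
  "(real \<Rightarrow> real \<Rightarrow> ennreal) \<Rightarrow> (real \<Rightarrow> real \<Rightarrow> ennreal) \<Rightarrow> real \<Rightarrow> real \<Rightarrow> ennreal" where
  "st_conv f g t x =
     (\<integral>\<^sup>+s\<in>{0..t}. (\<integral>\<^sup>+y. f s y * g (t - s) (x - y) \<partial>lborel) \<partial>lborel)"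

definition J0 :: "real \<Rightarrow> real measure \<Rightarrow> real \<Rightarrow> real \<Rightarrow> real" where
  "J0 \<nu> \<mu> t x = (LINT y|\<mu>. heat_kernel \<nu> t (x - y))"

(* Only the values u t x with t > 0 matter. I t x is a version of the stochastic convolution,
   which is determined almost surely. *)
definition random_field_solution ::
  "'w measure \<Rightarrow> ((real \<times> real) set \<Rightarrow> 'w \<Rightarrow> real) \<Rightarrow> real \<Rightarrow> (real \<Rightarrow> real) \<Rightarrow> real measure \<Rightarrow>
   (real \<Rightarrow> real \<Rightarrow> 'w \<Rightarrow> real) \<Rightarrow> bool" where
  "random_field_solution M W \<nu> \<rho> \<mu> u \<longleftrightarrow>
     (\<forall>t>0. \<forall>x. u t x \<in> borel_measurable (noise_filtration M W t)) \<and>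
     (\<lambda>((t, x), \<omega>). u t x \<omega>) \<in> borel_measurable (restrict_space borel half_plane \<Otimes>\<^sub>M M) \<and>
     (\<forall>t>0. \<forall>x. st_conv (\<lambda>s y. ennreal ((heat_kernel \<nu> s y)\<^sup>2))
                       (\<lambda>s y. L2_norm_sq M (\<lambda>\<omega>. \<rho> (u s y \<omega>))) t x < \<infinity>) \<and>
     (\<exists>I :: real \<Rightarrow> real \<Rightarrow> 'w \<Rightarrow> real.
        (\<forall>t>0. \<forall>x. has_walsh_integral M W
           (\<lambda>s y \<omega>. indicator {0..t} s * heat_kernel \<nu> (t - s) (x - y) * \<rho> (u s y \<omega>)) (I t x)) \<and>
        (\<forall>t>0. \<forall>x. ((\<lambda>(t', x'). L2_norm_sq M (\<lambda>\<omega>. I t' x' \<omega> - I t x \<omega>)) \<longlongrightarrow> 0)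
           (at (t, x) within half_plane)) \<and>
        (\<forall>t>0. \<forall>x. AE \<omega> in M. u t x \<omega> = J0 \<nu> \<mu> t x + I t x \<omega>))"

end

theory Submission
  imports Defs "HOL-Real_Asymp.Real_Asymp"
begin

text \<open>
  The initial datum makes \<open>J0\<close> constant equal to 1, so that \<open>u = 1 + I\<close> with \<open>I\<close> a stochastic
  convolution.  Only two properties of the Walsh integral matter: it has mean zero and it is an
  isometry (\<open>walsh_isometry\<close>).  They turn the correlation into
  \<open>E[u(t,x) u(t,y)] = 1 + \<integral>\<integral> G(t-s,x-z) G(t-s,y-z) lam\<^sup>2 v(s,z) dz ds\<close>, where
  \<open>v = vs\<^sup>2 + E[u\<^sup>2]\<close> (\<open>solution_product_moment\<close>).  For \<open>y = x\<close> this is a linear Volterra equation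
  for \<open>v\<close> alone.  A guess for \<open>v\<close> that does not depend on the space variable solves it, and the
  equation has only one finite nonnegative solution (\<open>volterra_solution_unique\<close>); in particular
  spatial homogeneity of \<open>v\<close> is a conclusion.  Inserting \<open>v\<close> for general \<open>y\<close>, the space integral is
  a heat kernel at distance \<open>x - y\<close> and a single convolution in time is left.

  That convolution has a closed form.  Put \<open>b = lam\<^sup>2 / (2 sqrt \<nu>)\<close>, \<open>\<delta> = |x - y| / (2 sqrt \<nu>)\<close>,
  \<open>K\<^sub>\<delta>(s) = b (\<pi> s)\<^sup>-\<^sup>1\<^sup>/\<^sup>2 exp (- \<delta>\<^sup>2 / s)\<close> and \<open>e(s) = exp (b\<^sup>2 s)\<close>, all supported in \<open>s > 0\<close>.  With \<open>E\<close> for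
  \<open>v / (1 + vs\<^sup>2)\<close> and \<open>R\<^sub>\<delta>\<close> for the claimed value of \<open>K\<^sub>\<delta> \<star> E\<close>, the fundamental theorem of calculus
  gives \<open>E = e + e \<star> K\<^sub>0\<close> and \<open>R\<^sub>\<delta> = e \<star> (K\<^sub>\<delta> + K\<^sub>\<delta> \<star> K\<^sub>0)\<close>, because \<open>K\<^sub>\<delta> \<star> K\<^sub>0\<close> is
  \<open>b\<^sup>2 erfc (\<delta> / sqrt t)\<close>.  Commutativity and associativity of \<open>\<star>\<close> then yield \<open>K\<^sub>\<delta> \<star> E = R\<^sub>\<delta>\<close>
  (\<open>sing_kernel_conv_growth\<close>).

  The isometry rests on the independence of the noise after time \<open>t\<close> from the right-continuous
  augmented filtration at \<open>t\<close> (\<open>noise_filtration_indep_var\<close>).  Both are built from one Gaussian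
  family, in which sets with disjoint time ranges are uncorrelated, so that characteristic functions
  factor.  Independence of sigma-algebras is extracted from this with the uniqueness theorem for
  characteristic functions of real random variables alone, applied to one generator of the past
  after the other (\<open>fourier_noise_gens\<close>).  For two elementary processes the isometry follows by
  cutting the earlier rectangle at the time at which the later one starts.
\<close>

section \<open>The complementary error function\<close>
lemma nn_integral_FTC_einterval:
  fixes f F :: "real \<Rightarrow> real" and a b :: ereal
  assumes "a < b"
    and "\<And>x. a < ereal x \<Longrightarrow> ereal x < b \<Longrightarrow> (F has_real_derivative f x) (at x)"
    and "\<And>x. a < ereal x \<Longrightarrow> ereal x < b \<Longrightarrow> isCont f x"
    and "\<And>x. a < ereal x \<Longrightarrow> ereal x < b \<Longrightarrow> 0 \<le> f x"
    and "((F \<circ> real_of_ereal) \<longlongrightarrow> A) (at_right a)"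
    and "((F \<circ> real_of_ereal) \<longlongrightarrow> B) (at_left b)"
  shows "(\<integral>\<^sup>+x. ennreal (f x) * indicator (einterval a b) x \<partial>lborel) = ennreal (B - A)"
    and "A \<le> B"
proof -
  note ftc = interval_integral_FTC_nonneg[OF assms(1,2,3) AE_I2 assms(5,6)]
  have int: "set_integrable lborel (einterval a b) f" and eq: "(LBINT x=a..b. f x) = B - A"
    by (rule ftc; use assms(4) in auto)+
  have eq': "(\<integral>x. indicator (einterval a b) x *\<^sub>R f x \<partial>lborel) = B - A"
    using eq assms(1) by (simp add: interval_lebesgue_integral_def set_lebesgue_integral_def less_imp_le)
  have nn: "0 \<le> indicator (einterval a b) x *\<^sub>R f x" for x
    using assms(4) by (auto simp: indicator_def einterval_def)
  have "(\<integral>\<^sup>+x. ennreal (f x) * indicator (einterval a b) x \<partial>lborel)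
      = (\<integral>\<^sup>+x. ennreal (indicator (einterval a b) x *\<^sub>R f x) \<partial>lborel)"
    by (intro nn_integral_cong) (auto simp: indicator_def)
  also have "\<dots> = ennreal (B - A)"
    using nn_integral_eq_integral[OF int[unfolded set_integrable_def]] nn eq' by simp
  finally show "(\<integral>\<^sup>+x. ennreal (f x) * indicator (einterval a b) x \<partial>lborel) = ennreal (B - A)" .
  have "0 \<le> (\<integral>x. indicator (einterval a b) x *\<^sub>R f x \<partial>lborel)"
    by (rule integral_nonneg_AE) (use nn in auto)
  with eq' show "A \<le> B" by simp
qed

text \<open>
  The interval integral in the definition of \<open>erfc\<close> starts at 0, on either side of which \<open>x\<close> may
  lie; the derivative is therefore computed within an interval that contains both in its interior.
\<close>
lemma erfc_deriv: "(erfc has_real_derivative (- (2 / sqrt pi) * exp (- x\<^sup>2))) (at x)"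
proof -
  define l u where "l = min x 0 - 1" and "u = max x 0 + 1"
  have *: "((\<lambda>v. LBINT y=ereal 0..ereal v. exp (- (y\<^sup>2))) has_vector_derivative exp (- x\<^sup>2)) (at x within {l..u})"
    by (rule interval_integral_FTC2) (auto simp: l_def u_def intro!: continuous_intros)
  have "x \<in> interior {l..u}"
    by (auto simp: l_def u_def)
  from at_within_interior[OF this] *
  have "((\<lambda>v. LBINT y=ereal 0..ereal v. exp (- (y\<^sup>2))) has_real_derivative exp (- x\<^sup>2)) (at x)"
    by (simp add: has_real_derivative_iff_has_vector_derivative)
  then have "((\<lambda>v. 1 - 2 / sqrt pi * (LBINT y=ereal 0..ereal v. exp (- (y\<^sup>2)))) has_real_derivative
      0 - 2 / sqrt pi * exp (- x\<^sup>2)) (at x)"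
    by (intro DERIV_diff DERIV_const DERIV_cmult)
  then show ?thesis
    unfolding erfc_def[abs_def] zero_ereal_def by simp
qed

lemmas erfc_deriv' [derivative_intros] = DERIV_chain2[OF erfc_deriv]

lemma isCont_erfc [simp]: "isCont erfc x"
  using erfc_deriv DERIV_isCont by blast

lemma borel_measurable_erfc [measurable]: "erfc \<in> borel_measurable borel"
  by (intro borel_measurable_continuous_onI continuous_at_imp_continuous_on) auto

lemma tendsto_erfc [tendsto_intros]:
  "(f \<longlongrightarrow> a) F \<Longrightarrow> ((\<lambda>x. erfc (f x)) \<longlongrightarrow> erfc a) F"
  using isCont_tendsto_compose[OF isCont_erfc] .

lemma erfc_0 [simp]: "erfc 0 = 1"
  by (simp add: erfc_def zero_ereal_def)

lemma erfc_at_top: "(erfc \<longlongrightarrow> 0) at_top"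
proof -
  note g = gaussian_moment_0
  have int: "set_integrable lborel {0::real..} (\<lambda>x. exp (- x\<^sup>2))"
    using g by (simp add: set_integrable_def has_bochner_integral_iff)
  have val: "set_lebesgue_integral lborel {0::real..} (\<lambda>x. exp (- x\<^sup>2)) = sqrt pi / 2"
    using g by (simp add: set_lebesgue_integral_def has_bochner_integral_iff)
  have "((\<lambda>b. set_lebesgue_integral lborel {0..b} (\<lambda>x. exp (- x\<^sup>2))) \<longlongrightarrow> sqrt pi / 2) at_top"
    using tendsto_set_lebesgue_integral_at_top[OF _ int] val by simp
  then have "((\<lambda>b. 1 - 2 / sqrt pi * set_lebesgue_integral lborel {0..b} (\<lambda>x. exp (- x\<^sup>2)))
      \<longlongrightarrow> 1 - 2 / sqrt pi * (sqrt pi / 2)) at_top"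
    by (intro tendsto_intros)
  moreover have "\<forall>\<^sub>F b in at_top. 1 - 2 / sqrt pi * set_lebesgue_integral lborel {0..b} (\<lambda>x. exp (- x\<^sup>2)) = erfc b"
    using eventually_ge_at_top[of 0]
    by eventually_elim (simp add: erfc_def zero_ereal_def interval_integral_Icc)
  ultimately show ?thesis
    by (simp add: filterlim_cong)
qed

lemma erfc_nonneg: "0 \<le> erfc x"
proof -
  have *: "(((\<lambda>y. - erfc y) \<circ> real_of_ereal) \<longlongrightarrow> - erfc x) (at_right (ereal x))"
    by (simp add: ereal_tendsto_simps1) (auto intro!: tendsto_intros)
  have **: "(((\<lambda>y. - erfc y) \<circ> real_of_ereal) \<longlongrightarrow> - 0) (at_left \<infinity>)"
    unfolding ereal_tendsto_simps1 by (intro tendsto_minus erfc_at_top)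
  have "((\<lambda>y. - erfc y) has_real_derivative 2 / sqrt pi * exp (- y\<^sup>2)) (at y)" for y
    using DERIV_minus[OF erfc_deriv] by simp
  from nn_integral_FTC_einterval(2)[OF _ this _ _ * **]
  show ?thesis
    by (auto intro!: continuous_intros)
qed

text \<open>The right-hand side is an antiderivative of the normal density that vanishes at \<open>-\<infinity>\<close>.\<close>
lemma Phi_eq_erfc: "Phi x = erfc (- x / sqrt 2) / 2"
proof -
  let ?F = "\<lambda>y. erfc (- y / sqrt 2) / 2" and ?f = "\<lambda>y::real. exp (- (y\<^sup>2 / 2)) / sqrt (2 * pi)"
  have F: "(?F has_real_derivative ?f y) (at y)" for y
    by (auto intro!: derivative_eq_intros simp: field_simps power_divide real_sqrt_mult)
  have lim1: "((?F \<circ> real_of_ereal) \<longlongrightarrow> 0) (at_right (- \<infinity>))"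
  proof -
    have "filterlim (\<lambda>y. - y / sqrt 2) at_top at_bot"
      by real_asymp
    from filterlim_compose[OF erfc_at_top this]
    have "(?F \<longlongrightarrow> 0 / 2) at_bot" by (intro tendsto_intros) auto
    then show ?thesis unfolding ereal_tendsto_simps1 by simp
  qed
  have lim2: "((?F \<circ> real_of_ereal) \<longlongrightarrow> ?F x) (at_left (ereal x))"
    by (simp add: ereal_tendsto_simps1) (auto intro!: tendsto_intros)
  have "(LBINT y=-\<infinity>..ereal x. ?f y) = ?F x - 0"
    by (rule interval_integral_FTC_nonneg(2)[OF _ F _ _ lim1 lim2]) (auto intro!: continuous_intros)
  also have "(LBINT y=-\<infinity>..ereal x. ?f y) = (LBINT y:{..<x}. ?f y)"
    by (simp add: interval_lebesgue_integral_def einterval_def lessThan_def)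
  also have "\<dots> = Phi x"
    unfolding Phi_def set_lebesgue_integral_def
    by (rule integral_cong_AE) (auto intro!: eventually_mono[OF AE_lborel_singleton[of x]] simp: indicator_def)
  finally show ?thesis by simp
qed

section \<open>Convolution in time\<close>

text \<open>
  Convolution over the whole line of functions with values in \<^typ>\<open>ennreal\<close>: for factors that vanish
  on negative times it is the usual integral from 0 to \<open>t\<close>, and integrability never has to be
  discussed when convolutions are regrouped.
\<close>
definition time_conv :: "(real \<Rightarrow> ennreal) \<Rightarrow> (real \<Rightarrow> ennreal) \<Rightarrow> real \<Rightarrow> ennreal"  (infixl "\<star>" 70)
  where "(f \<star> g) t = (\<integral>\<^sup>+s. f s * g (t - s) \<partial>lborel)"

lemma time_conv_eq_0: "(\<And>s. f s * g (t - s) = 0) \<Longrightarrow> (f \<star> g) t = 0"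
  by (simp only: time_conv_def) simp

lemma measurable_time_conv [measurable]:
  assumes [measurable]: "f \<in> borel_measurable borel" "g \<in> borel_measurable borel"
  shows "f \<star> g \<in> borel_measurable borel"
  unfolding time_conv_def by measurable

lemma time_conv_commute:
  assumes [measurable]: "f \<in> borel_measurable borel" "g \<in> borel_measurable borel"
  shows "f \<star> g = g \<star> f"
proof
  fix t
  have "(f \<star> g) t = (\<integral>\<^sup>+s. f (t + (- 1) * s) * g (t - (t + (- 1) * s)) \<partial>lborel)"
    unfolding time_conv_def by (subst nn_integral_real_affine[of _ "- 1" t]) auto
  then show "(f \<star> g) t = (g \<star> f) t"
    by (simp add: time_conv_def mult.commute)
qed

lemma time_conv_assoc:
  assumes [measurable]: "f \<in> borel_measurable borel" "g \<in> borel_measurable borel" "h \<in> borel_measurable borel"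
  shows "f \<star> g \<star> h = f \<star> (g \<star> h)"
proof
  fix t
  have "(f \<star> g \<star> h) t = (\<integral>\<^sup>+s. (\<integral>\<^sup>+r. f r * (g (s - r) * h (t - s)) \<partial>lborel) \<partial>lborel)"
    unfolding time_conv_def by (simp add: nn_integral_multc[symmetric] mult.assoc)
  also have "\<dots> = (\<integral>\<^sup>+r. (\<integral>\<^sup>+s. f r * (g (s - r) * h (t - s)) \<partial>lborel) \<partial>lborel)"
    by (rule lborel_pair.Fubini') measurable
  also have "\<dots> = (\<integral>\<^sup>+r. f r * (\<integral>\<^sup>+s. g (s - r) * h (t - s) \<partial>lborel) \<partial>lborel)"
    by (simp add: nn_integral_cmult)
  also have "\<dots> = (\<integral>\<^sup>+r. f r * (\<integral>\<^sup>+v. g v * h (t - r - v) \<partial>lborel) \<partial>lborel)"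
  proof (intro nn_integral_cong)
    fix r
    have "(\<integral>\<^sup>+s. g (s - r) * h (t - s) \<partial>lborel) = (\<integral>\<^sup>+v. g (r + 1 * v - r) * h (t - (r + 1 * v)) \<partial>lborel)"
      by (subst nn_integral_real_affine[of _ 1 r]) auto
    then show "f r * (\<integral>\<^sup>+s. g (s - r) * h (t - s) \<partial>lborel) = f r * (\<integral>\<^sup>+v. g v * h (t - r - v) \<partial>lborel)"
      by (simp add: algebra_simps)
  qed
  finally show "(f \<star> g \<star> h) t = (f \<star> (g \<star> h)) t"
    by (simp add: time_conv_def)
qed

lemma time_conv_add_right:
  assumes [measurable]: "f \<in> borel_measurable borel" "g \<in> borel_measurable borel" "h \<in> borel_measurable borel"
  shows "f \<star> (\<lambda>s. g s + h s) = (\<lambda>t. (f \<star> g) t + (f \<star> h) t)"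
  by (rule ext) (simp add: time_conv_def nn_integral_add[symmetric] distrib_left)

lemma time_conv_mono:
  "(\<And>s. f s \<le> f' s) \<Longrightarrow> (\<And>s. g s \<le> g' s) \<Longrightarrow> (f \<star> g) t \<le> (f' \<star> g') t"
  unfolding time_conv_def by (intro nn_integral_mono mult_mono) auto

lemma time_conv_cmult_left:
  assumes [measurable]: "f \<in> borel_measurable borel" "g \<in> borel_measurable borel"
  shows "(\<lambda>s. c * f s) \<star> g = (\<lambda>t. c * (f \<star> g) t)"
  by (rule ext) (simp add: time_conv_def nn_integral_cmult[symmetric] mult.assoc)

section \<open>The closed form of the singular convolution\<close>

text \<open>
  The kernel that is left of \<open>lam\<^sup>2 * G(s, x - z) * G(s, y - z)\<close> after integration over \<open>z\<close>, where
  \<open>b = lam\<^sup>2 / (2 * sqrt \<nu>)\<close> and \<open>\<delta> = \<bar>x - y\<bar> / (2 * sqrt \<nu>)\<close>; see \<open>heat_kernel_product\<close> below.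
\<close>
definition sing_kernel :: "real \<Rightarrow> real \<Rightarrow> real \<Rightarrow> ennreal" where
  "sing_kernel b \<delta> s = (if s > 0 then ennreal (b / sqrt (pi * s) * exp (- (\<delta>\<^sup>2 / s))) else 0)"

definition exp_kernel :: "real \<Rightarrow> real \<Rightarrow> ennreal" where
  "exp_kernel b s = (if s > 0 then ennreal (exp (b\<^sup>2 * s)) else 0)"

text \<open>The solution of \<open>E = 1 + K\<^sub>0 \<star> E\<close>; it is the growth factor of \<open>vs\<^sup>2 + E[u\<^sup>2]\<close>.\<close>
definition growth :: "real \<Rightarrow> real \<Rightarrow> real" where
  "growth b t = exp (b\<^sup>2 * t) * erfc (- b * sqrt t)"

text \<open>
  The bracket in the correlation formula, in the scaled variables: \<open>E[u(t,x) u(t,y)]\<close> exceeds 1 by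
  \<open>1 + vs\<^sup>2\<close> times this quantity.
\<close>
definition corr_excess :: "real \<Rightarrow> real \<Rightarrow> real \<Rightarrow> real" where
  "corr_excess b \<delta> t = exp (b\<^sup>2 * t - 2 * b * \<delta>) * erfc (\<delta> / sqrt t - b * sqrt t) - erfc (\<delta> / sqrt t)"

lemma measurable_sing_kernel [measurable]: "sing_kernel b \<delta> \<in> borel_measurable borel"
  unfolding sing_kernel_def[abs_def] by measurable

lemma measurable_exp_kernel [measurable]: "exp_kernel b \<in> borel_measurable borel"
  unfolding exp_kernel_def[abs_def] by measurable

lemma einterval_real: "einterval (ereal a) (ereal b) = {a<..<b}"
  by (auto simp: einterval_def)

lemma nn_integral_FTC_Ioo:
  fixes f F :: "real \<Rightarrow> real" and a b :: real
  assumes "a < b"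
    and "\<And>x. a < x \<Longrightarrow> x < b \<Longrightarrow> (F has_real_derivative f x) (at x)"
    and "\<And>x. a < x \<Longrightarrow> x < b \<Longrightarrow> isCont f x"
    and "\<And>x. a < x \<Longrightarrow> x < b \<Longrightarrow> 0 \<le> f x"
    and "(F \<longlongrightarrow> A) (at_right a)"
    and "(F \<longlongrightarrow> B) (at_left b)"
  shows "(\<integral>\<^sup>+x. ennreal (f x) * indicator {a<..<b} x \<partial>lborel) = ennreal (B - A)" "A \<le> B"
  using nn_integral_FTC_einterval[of "ereal a" "ereal b" F f A B] assms
  by (auto simp: ereal_tendsto_simps1 einterval_real)

text \<open>
  With \<open>w = sqrt (1 / r - 1 / t)\<close> the integrand is, up to a constant, \<open>exp (- c\<^sup>2 * w\<^sup>2) dw\<close>, since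
  \<open>1 / r = w\<^sup>2 + 1 / t\<close>.  Hence an antiderivative is a multiple of \<open>erfc (c * w)\<close>.
\<close>
lemma first_passage_integral:
  assumes "0 < c" "0 < t"
  shows "(\<integral>\<^sup>+r. ennreal (1 / (r * sqrt r * sqrt (t - r)) * exp (- (c\<^sup>2 / r))) * indicator {0<..<t} r \<partial>lborel)
       = ennreal (sqrt pi / (c * sqrt t) * exp (- (c\<^sup>2 / t)))"
proof -
  let ?w = "\<lambda>r. sqrt (1 / r - 1 / t)"
  let ?F = "\<lambda>r. sqrt pi / (c * sqrt t) * exp (- (c\<^sup>2 / t)) * erfc (c * ?w r)"
  have deriv: "(?F has_real_derivative 1 / (r * sqrt r * sqrt (t - r)) * exp (- (c\<^sup>2 / r))) (at r)"
    if r: "0 < r" "r < t" for r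
  proof -
    have pos: "0 < 1 / r - 1 / t" using r assms by (simp add: field_simps)
    have w: "?w r = sqrt (t - r) / (sqrt r * sqrt t)"
      using r assms by (simp add: field_simps flip: real_sqrt_mult real_sqrt_divide)
    have e: "exp (- (c\<^sup>2 / t)) * exp (- (c * ?w r)\<^sup>2) = exp (- (c\<^sup>2 / r))"
      using pos by (simp add: power_mult_distrib algebra_simps flip: exp_add)
    have "((\<lambda>r. 1 / r - 1 / t) has_real_derivative - (1 / (r * r))) (at r)"
      using r by (auto intro!: derivative_eq_intros simp: power2_eq_square)
    from DERIV_chain2[OF DERIV_real_sqrt[OF pos] this]
    have dw: "(?w has_real_derivative - (1 / (r * r)) * (inverse (?w r) / 2)) (at r)"
      by (simp add: mult.commute)
    have "(?F has_real_derivative sqrt pi / (c * sqrt t) * exp (- (c\<^sup>2 / t)) *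
        (- (2 / sqrt pi) * exp (- (c * ?w r)\<^sup>2) * (c * (- (1 / (r * r)) * (inverse (?w r) / 2))))) (at r)"
      by (intro DERIV_cmult DERIV_chain2[OF erfc_deriv] dw)
    also have "sqrt pi / (c * sqrt t) * exp (- (c\<^sup>2 / t)) *
        (- (2 / sqrt pi) * exp (- (c * ?w r)\<^sup>2) * (c * (- (1 / (r * r)) * (inverse (?w r) / 2))))
      = (exp (- (c\<^sup>2 / t)) * exp (- (c * ?w r)\<^sup>2)) * (1 / (sqrt t * r * r * ?w r))"
      using assms r by (simp add: field_simps)
    also have "\<dots> = exp (- (c\<^sup>2 / r)) * (1 / (sqrt t * r * r * ?w r))"
      by (simp only: e)
    also have "1 / (sqrt t * r * r * ?w r) = 1 / (r * sqrt r * sqrt (t - r))"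
    proof -
      have "sqrt t * r * r * ?w r = r * (r / sqrt r) * sqrt (t - r)"
        using assms r unfolding w by simp
      also have "r / sqrt r = sqrt r" using r by (simp add: real_div_sqrt)
      finally show ?thesis by simp
    qed
    finally show ?thesis by (simp add: mult.commute)
  qed
  have lim0: "(?F \<longlongrightarrow> sqrt pi / (c * sqrt t) * exp (- (c\<^sup>2 / t)) * 0) (at_right 0)"
  proof (intro tendsto_intros filterlim_compose[OF erfc_at_top])
    show "LIM r at_right 0. c * ?w r :> at_top"
      using assms by real_asymp
  qed
  have limt: "(?F \<longlongrightarrow> ?F t) (at_left t)"
    using assms by (intro tendsto_intros) auto
  have cont: "isCont (\<lambda>r. 1 / (r * sqrt r * sqrt (t - r)) * exp (- (c\<^sup>2 / r))) r" if "0 < r" "r < t" for r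
    using that by (auto intro!: continuous_intros)
  show ?thesis
    using nn_integral_FTC_Ioo(1)[OF assms(2) deriv cont _ lim0 limt] assms
    by simp
qed

text \<open>
  This representation and the next one make both sides of \<open>sing_kernel_conv\<close> integrals over
  \<open>c > \<delta>\<close>, so that it is enough to compare the integrands.
\<close>
lemma exp_eq_nn_integral:
  assumes "0 < r" "0 \<le> \<delta>"
  shows "ennreal (exp (- (\<delta>\<^sup>2 / r))) = (\<integral>\<^sup>+c. ennreal (2 * c / r * exp (- (c\<^sup>2 / r))) * indicator {\<delta><..} c \<partial>lborel)"
proof -
  let ?F = "\<lambda>c. - exp (- (c\<^sup>2 / r))"
  have l: "((?F \<circ> real_of_ereal) \<longlongrightarrow> ?F \<delta>) (at_right (ereal \<delta>))"
    unfolding ereal_tendsto_simps1 by (intro tendsto_intros) (use assms in auto)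
  have u: "((?F \<circ> real_of_ereal) \<longlongrightarrow> 0) (at_left \<infinity>)"
    unfolding ereal_tendsto_simps1 using assms by real_asymp
  have "(?F has_real_derivative 2 * c / r * exp (- (c\<^sup>2 / r))) (at c)" for c
    using assms by (auto intro!: derivative_eq_intros)
  from nn_integral_FTC_einterval(1)[OF _ this _ _ l u] assms
  show ?thesis by (auto intro!: continuous_intros simp: einterval_def greaterThan_def)
qed

lemma erfc_eq_nn_integral:
  assumes "0 < t" "0 \<le> \<delta>"
  shows "ennreal (erfc (\<delta> / sqrt t)) = (\<integral>\<^sup>+c. ennreal (2 / sqrt (pi * t) * exp (- (c\<^sup>2 / t))) * indicator {\<delta><..} c \<partial>lborel)"
proof -
  let ?F = "\<lambda>c. - erfc (c / sqrt t)"
  have l: "((?F \<circ> real_of_ereal) \<longlongrightarrow> ?F \<delta>) (at_right (ereal \<delta>))"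
    unfolding ereal_tendsto_simps1 by (intro tendsto_intros) (use assms in auto)
  have "filterlim (\<lambda>c. c / sqrt t) at_top at_top"
    using assms by real_asymp
  from filterlim_compose[OF erfc_at_top this]
  have u: "((?F \<circ> real_of_ereal) \<longlongrightarrow> - 0) (at_left \<infinity>)"
    unfolding ereal_tendsto_simps1 by (rule tendsto_minus)
  have "(?F has_real_derivative 2 / sqrt (pi * t) * exp (- (c\<^sup>2 / t))) (at c)" for c
  proof -
    have "((\<lambda>c. c / sqrt t) has_real_derivative 1 / sqrt t) (at c)"
      by (intro DERIV_cdivide DERIV_ident)
    from DERIV_minus[OF DERIV_chain2[OF erfc_deriv this]] assms show ?thesis
      by (simp add: power_divide real_sqrt_mult)
  qed
  from nn_integral_FTC_einterval(1)[OF _ this _ _ l u] assms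
  show ?thesis by (auto intro!: continuous_intros simp: einterval_def greaterThan_def)
qed

text \<open>
  Writing \<open>exp (- \<delta>\<^sup>2 / r)\<close> as an integral over \<open>c > \<delta>\<close> produces the additional factor \<open>1 / r\<close>, with
  which the integral over \<open>r\<close> is elementary (\<open>first_passage_integral\<close>).  For \<open>\<delta> = 0\<close> the value is
  \<open>b\<^sup>2\<close>: convolving twice with the singular kernel is an ordinary integration, up to this factor.
\<close>
lemma sing_kernel_conv:
  assumes "0 \<le> b" "0 \<le> \<delta>"
  shows "(sing_kernel b \<delta> \<star> sing_kernel b 0) t = (if t > 0 then ennreal (b\<^sup>2 * erfc (\<delta> / sqrt t)) else 0)"
proof (cases "t > 0")
  case False
  then have "sing_kernel b \<delta> s * sing_kernel b 0 (t - s) = 0" for s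
    by (auto simp: sing_kernel_def)
  then have "(sing_kernel b \<delta> \<star> sing_kernel b 0) t = 0"
    by (rule time_conv_eq_0)
  with False show ?thesis by simp
next
  case t: True
  let ?g = "\<lambda>c r. ennreal (1 / (r * sqrt r * sqrt (t - r)) * exp (- (c\<^sup>2 / r))) * indicator {0<..<t} r"
  let ?h = "\<lambda>r c. ennreal (2 * b\<^sup>2 * c / pi) * indicator {\<delta><..} c * ?g c r"
  have ker: "sing_kernel b \<delta> r * sing_kernel b 0 (t - r) = (\<integral>\<^sup>+c. ?h r c \<partial>lborel)" for r
  proof (cases "0 < r \<and> r < t")
    case True
    have *: "sing_kernel b \<delta> r * sing_kernel b 0 (t - r) = ennreal (b\<^sup>2 / (pi * sqrt r * sqrt (t - r))) * ennreal (exp (- (\<delta>\<^sup>2 / r)))"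
    proof -
      have "sqrt (pi * r) * sqrt (pi * (t - r)) = (sqrt pi * sqrt pi) * sqrt r * sqrt (t - r)"
        by (simp only: real_sqrt_mult mult_ac)
      then have "sqrt (pi * r) * sqrt (pi * (t - r)) = pi * sqrt r * sqrt (t - r)"
        by simp
      with True assms show ?thesis
        by (simp add: sing_kernel_def power2_eq_square mult_ac flip: ennreal_mult')
    qed
    show ?thesis
      unfolding * exp_eq_nn_integral[OF conjunct1[OF True] assms(2)]
      apply (subst nn_integral_cmult[symmetric], measurable)
      apply (intro nn_integral_cong)
      using True assms by (simp add: indicator_def real_sqrt_mult mult_ac flip: ennreal_mult')
  qed (auto simp: sing_kernel_def)
  have "(sing_kernel b \<delta> \<star> sing_kernel b 0) t = (\<integral>\<^sup>+r. (\<integral>\<^sup>+c. ?h r c \<partial>lborel) \<partial>lborel)"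
    by (simp only: time_conv_def ker)
  also have "\<dots> = (\<integral>\<^sup>+c. (\<integral>\<^sup>+r. ?h r c \<partial>lborel) \<partial>lborel)"
    by (rule lborel_pair.Fubini') measurable
  also have "\<dots> = (\<integral>\<^sup>+c. ennreal (b\<^sup>2) * (ennreal (2 / sqrt (pi * t) * exp (- (c\<^sup>2 / t))) * indicator {\<delta><..} c) \<partial>lborel)"
  proof (intro nn_integral_cong)
    fix c
    show "(\<integral>\<^sup>+r. ?h r c \<partial>lborel) = ennreal (b\<^sup>2) * (ennreal (2 / sqrt (pi * t) * exp (- (c\<^sup>2 / t))) * indicator {\<delta><..} c)"
    proof (cases "\<delta> < c")
      case True
      then have c: "0 < c" using assms by simp
      have "(\<integral>\<^sup>+r. ?h r c \<partial>lborel) = ennreal (2 * b\<^sup>2 * c / pi) * indicator {\<delta><..} c * (\<integral>\<^sup>+r. ?g c r \<partial>lborel)"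
        by (rule nn_integral_cmult) measurable
      also have "\<dots> = ennreal (2 * b\<^sup>2 * c / pi) * ennreal (sqrt pi / (c * sqrt t) * exp (- (c\<^sup>2 / t)))"
        using True by (simp only: first_passage_integral[OF c t]) simp
      also have "\<dots> = ennreal (b\<^sup>2) * (ennreal (2 / sqrt (pi * t) * exp (- (c\<^sup>2 / t))) * indicator {\<delta><..} c)"
        using True c t by (simp add: real_sqrt_mult field_simps flip: ennreal_mult')
      finally show ?thesis .
    qed simp
  qed
  also have "\<dots> = ennreal (b\<^sup>2) * ennreal (erfc (\<delta> / sqrt t))"
    by (subst nn_integral_cmult) (simp_all add: erfc_eq_nn_integral[OF t assms(2)])
  finally show ?thesis
    using t by (simp add: ennreal_mult')
qed

text \<open>
  \<open>exp (b\<^sup>2 * t) * erfc (- b * sqrt s)\<close> is an antiderivative in \<open>s\<close> of the integrand of the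
  convolution; its value at \<open>s = 0\<close> is the first summand.
\<close>
lemma growth_eq:
  assumes "0 \<le> b"
  shows "(if t > 0 then ennreal (growth b t) else 0) = exp_kernel b t + (exp_kernel b \<star> sing_kernel b 0) t"
proof (cases "t > 0")
  case False
  then have "exp_kernel b s * sing_kernel b 0 (t - s) = 0" for s
    by (auto simp: sing_kernel_def exp_kernel_def)
  then have "(exp_kernel b \<star> sing_kernel b 0) t = 0"
    by (rule time_conv_eq_0)
  with False show ?thesis by (simp add: exp_kernel_def)
next
  case t: True
  let ?F = "\<lambda>s. exp (b\<^sup>2 * t) * erfc (- b * sqrt s)"
  let ?f = "\<lambda>s. b / sqrt (pi * s) * exp (b\<^sup>2 * (t - s))"
  have d: "(?F has_real_derivative ?f s) (at s)" if "0 < s" for s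
    using that by (auto intro!: derivative_eq_intros simp: real_sqrt_mult power_mult_distrib algebra_simps simp flip: exp_add) (simp add: field_simps)
  have l: "(?F \<longlongrightarrow> ?F 0) (at_right 0)" and u: "(?F \<longlongrightarrow> ?F t) (at_left t)"
    by (intro tendsto_intros)+
  have cont: "isCont ?f s" if "0 < s" for s
    using that by (auto intro!: continuous_intros)
  have "(sing_kernel b 0 \<star> exp_kernel b) t = (\<integral>\<^sup>+s. ennreal (?f s) * indicator {0<..<t} s \<partial>lborel)"
    unfolding time_conv_def using assms
    by (intro nn_integral_cong) (auto simp: sing_kernel_def exp_kernel_def simp flip: ennreal_mult')
  also have "\<dots> = ennreal (?F t - ?F 0)"
    using t assms by (intro nn_integral_FTC_Ioo(1)[OF _ d cont _ l u]) auto
  finally have *: "(exp_kernel b \<star> sing_kernel b 0) t = ennreal (growth b t - exp (b\<^sup>2 * t))"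
    by (subst time_conv_commute) (auto simp: growth_def)
  have "exp (b\<^sup>2 * t) \<le> growth b t"
    using nn_integral_FTC_Ioo(2)[OF t d cont _ l u] assms by (auto simp: growth_def)
  then show ?thesis
    using t by (simp add: * exp_kernel_def flip: ennreal_plus)
qed

text \<open>
  The excess \<open>R\<close> solves the linear equation \<open>R' = b\<^sup>2 * R + q\<close> with \<open>q = K\<^sub>\<delta> + K\<^sub>\<delta> \<star> K\<^sub>0\<close> and
  \<open>R(0+) = 0\<close>, because the two Gaussian terms that come from the inner derivative of \<open>\<delta> / sqrt s\<close>
  cancel.  The convolution with \<open>exp (b\<^sup>2 * s)\<close> is the variation of constants formula.
\<close>
lemma corr_excess_eq:
  assumes "0 \<le> b" "0 \<le> \<delta>" "t > 0"
  shows "ennreal (corr_excess b \<delta> t) =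
    (exp_kernel b \<star> (\<lambda>s. sing_kernel b \<delta> s + (sing_kernel b \<delta> \<star> sing_kernel b 0) s)) t"
    and "0 \<le> corr_excess b \<delta> t"
proof -
  let ?q = "\<lambda>s. b / sqrt (pi * s) * exp (- (\<delta>\<^sup>2 / s)) + b\<^sup>2 * erfc (\<delta> / sqrt s)"
  let ?F = "\<lambda>s. exp (b\<^sup>2 * (t - s)) * corr_excess b \<delta> s"
  let ?f = "\<lambda>s. ?q s * exp (b\<^sup>2 * (t - s))"
  have q: "0 \<le> ?q s" if "0 < s" for s
    using that assms by (intro add_nonneg_nonneg mult_nonneg_nonneg erfc_nonneg) auto
  have d: "(?F has_real_derivative ?f s) (at s)" if s: "0 < s" for s
  proof -
    let ?a = "\<delta> / sqrt s" and ?c = "b * sqrt s"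
    let ?X = "exp (b\<^sup>2 * s - 2 * b * \<delta>)"
    have ring: "X * B * E + X * (- p * g * (- d - c)) - (- p * h * (- d))
        = B * (X * E) + (X * g) * (p * (d + c)) - h * (p * d)" for X B E p g d c h :: real
      by (simp add: algebra_simps)
    \<comment> \<open>the prefactor is chosen so that completing the square leaves the Gaussian of \<open>erfc (\<delta> / sqrt s)\<close>\<close>
    have e: "?X * exp (- (?a - ?c)\<^sup>2) = exp (- (\<delta>\<^sup>2 / s))"
      using s by (simp add: power2_diff power_mult_distrib power_divide algebra_simps flip: exp_add)
    have "(corr_excess b \<delta> has_real_derivative
        ?X * b\<^sup>2 * erfc (?a - ?c) + ?X * (- (2 / sqrt pi) * exp (- (?a - ?c)\<^sup>2) * (- (\<delta> / (2 * s * sqrt s)) - b / (2 * sqrt s)))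
         - (- (2 / sqrt pi) * exp (- (?a)\<^sup>2) * (- (\<delta> / (2 * s * sqrt s))))) (at s)"
      unfolding corr_excess_def[abs_def]
      apply (rule derivative_eq_intros refl | use s in force)+
      using s by (simp add: field_simps)
    also have "?X * b\<^sup>2 * erfc (?a - ?c) + ?X * (- (2 / sqrt pi) * exp (- (?a - ?c)\<^sup>2) * (- (\<delta> / (2 * s * sqrt s)) - b / (2 * sqrt s)))
         - (- (2 / sqrt pi) * exp (- (?a)\<^sup>2) * (- (\<delta> / (2 * s * sqrt s))))
      = b\<^sup>2 * (?X * erfc (?a - ?c)) + (?X * exp (- (?a - ?c)\<^sup>2)) * (2 / sqrt pi * (\<delta> / (2 * s * sqrt s) + b / (2 * sqrt s)))
         - exp (- (?a)\<^sup>2) * (2 / sqrt pi * (\<delta> / (2 * s * sqrt s)))"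
      by (rule ring)
    also have "\<dots> = b\<^sup>2 * corr_excess b \<delta> s + ?q s"
      unfolding e using s
      by (simp add: corr_excess_def power_divide real_sqrt_mult algebra_simps)
    finally have R: "(corr_excess b \<delta> has_real_derivative b\<^sup>2 * corr_excess b \<delta> s + ?q s) (at s)" .
    show ?thesis
      by (rule derivative_eq_intros R refl | simp)+ (simp add: algebra_simps)
  qed
  have u: "(?F \<longlongrightarrow> ?F t) (at_left t)"
    unfolding corr_excess_def using assms by (intro tendsto_intros) auto
  have l: "(?F \<longlongrightarrow> 0) (at_right 0)"
  proof -
    have "(corr_excess b \<delta> \<longlongrightarrow> 0) (at_right 0)"
    proof (cases "\<delta> = 0")
      case True
      have "(corr_excess b \<delta> \<longlongrightarrow> exp (b\<^sup>2 * 0 - 2 * b * 0) * erfc (0 - b * sqrt 0) - erfc 0) (at_right 0)"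
        unfolding corr_excess_def[abs_def] True by (simp, intro tendsto_eq_intros) (auto intro!: tendsto_eq_intros)
      then show ?thesis by simp
    next
      case False
      then have "0 < \<delta>" using assms by simp
      then have 1: "filterlim (\<lambda>s. \<delta> / sqrt s - b * sqrt s) at_top (at_right 0)"
        and 2: "filterlim (\<lambda>s. \<delta> / sqrt s) at_top (at_right 0)"
        by real_asymp+
      have "(corr_excess b \<delta> \<longlongrightarrow> exp (b\<^sup>2 * 0 - 2 * b * \<delta>) * 0 - 0) (at_right 0)"
        unfolding corr_excess_def[abs_def]
        by (intro tendsto_intros filterlim_compose[OF erfc_at_top 1] filterlim_compose[OF erfc_at_top 2])
      then show ?thesis by simp
    qed
    then have "(?F \<longlongrightarrow> exp (b\<^sup>2 * (t - 0)) * 0) (at_right 0)"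
      by (intro tendsto_intros)
    then show ?thesis by simp
  qed
  have cont: "isCont ?f s" if "0 < s" for s
    using that by (auto intro!: continuous_intros isCont_o2[OF _ isCont_erfc])
  have 1: "(\<integral>\<^sup>+s. ennreal (?f s) * indicator {0<..<t} s \<partial>lborel) = ennreal (?F t - 0)"
    and 2: "0 \<le> ?F t"
    using nn_integral_FTC_Ioo[OF assms(3) d cont _ l u] q by auto
  from 2 show "0 \<le> corr_excess b \<delta> t" by simp
  let ?Q = "\<lambda>s. sing_kernel b \<delta> s + (sing_kernel b \<delta> \<star> sing_kernel b 0) s"
  have "(?Q \<star> exp_kernel b) t = (\<integral>\<^sup>+s. ennreal (?f s) * indicator {0<..<t} s \<partial>lborel)"
    unfolding time_conv_def[of ?Q]
  proof (intro nn_integral_cong)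
    fix s
    show "?Q s * exp_kernel b (t - s) = ennreal (?f s) * indicator {0<..<t} s"
    proof (cases "0 < s \<and> s < t")
      case True
      have "?Q s = ennreal (?q s)"
        using True assms by (simp add: sing_kernel_conv erfc_nonneg sing_kernel_def)
      with True q[of s] show ?thesis by (simp add: exp_kernel_def flip: ennreal_mult')
    qed (auto simp: exp_kernel_def sing_kernel_conv[OF assms(1,2)] sing_kernel_def)
  qed
  with 1 show "ennreal (corr_excess b \<delta> t) = (exp_kernel b \<star> ?Q) t"
    by (subst time_conv_commute) auto
qed

lemma sing_kernel_conv_growth:
  assumes "0 \<le> b" "0 \<le> \<delta>" "t > 0"
  shows "(sing_kernel b \<delta> \<star> (\<lambda>s. if s > 0 then ennreal (growth b s) else 0)) t = ennreal (corr_excess b \<delta> t)"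
proof -
  let ?K = "sing_kernel b \<delta>" and ?N = "sing_kernel b 0" and ?e = "exp_kernel b"
  have 1: "?K \<star> ?e = ?e \<star> ?K"
    by (rule time_conv_commute) measurable
  have 2: "?K \<star> (?e \<star> ?N) = ?e \<star> (?K \<star> ?N)"
    by (simp add: time_conv_assoc[symmetric] 1)
  have "?K \<star> (\<lambda>s. if s > 0 then ennreal (growth b s) else 0) = ?K \<star> (\<lambda>s. ?e s + (?e \<star> ?N) s)"
    by (simp only: growth_eq[OF assms(1)])
  also have "\<dots> = (\<lambda>s. (?e \<star> ?K) s + (?e \<star> (?K \<star> ?N)) s)"
    by (subst time_conv_add_right) (simp_all only: 1 2, measurable)
  also have "\<dots> = ?e \<star> (\<lambda>s. ?K s + (?K \<star> ?N) s)"
    by (rule time_conv_add_right[symmetric]) measurable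
  finally show ?thesis
    by (simp only: corr_excess_eq(1)[OF assms])
qed

lemma growth_eq_corr_excess: "0 < t \<Longrightarrow> growth b t = 1 + corr_excess b 0 t"
  by (simp add: growth_def corr_excess_def)

section \<open>The heat kernel\<close>
lemma heat_kernel_nonneg: "0 < \<nu> \<Longrightarrow> 0 \<le> heat_kernel \<nu> t x"
  by (simp add: heat_kernel_def)

lemma heat_kernel_eq_normal_density:
  assumes "0 < \<nu>" "0 < t"
  shows "heat_kernel \<nu> t x = normal_density 0 (sqrt (\<nu> * t)) x"
  using assms by (simp add: heat_kernel_def normal_density_def mult_ac)

lemma measurable_heat_kernel [measurable]:
  assumes [measurable]: "f \<in> borel_measurable N" "g \<in> borel_measurable N"
  shows "(\<lambda>w. heat_kernel \<nu> (f w) (g w)) \<in> borel_measurable N"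
  unfolding heat_kernel_def by measurable

lemma heat_kernel_minus: "heat_kernel \<nu> t (x - y) = heat_kernel \<nu> t (y - x)"
  by (simp add: heat_kernel_def power2_commute[of x y])

lemma nn_integral_heat_kernel:
  assumes "0 < \<nu>" "0 < t"
  shows "(\<integral>\<^sup>+y. ennreal (heat_kernel \<nu> t (x - y)) \<partial>lborel) = 1"
proof -
  have "(\<integral>\<^sup>+y. ennreal (heat_kernel \<nu> t (x - y)) \<partial>lborel) = (\<integral>\<^sup>+y. ennreal (normal_density x (sqrt (\<nu> * t)) y) \<partial>lborel)"
    using assms by (intro nn_integral_cong) (simp add: heat_kernel_minus[of _ _ x] heat_kernel_eq_normal_density normal_density_def)
  also have "\<dots> = ennreal 1"
    using assms nn_integral_eq_integral[OF integrable_normal_density[of "sqrt (\<nu> * t)" x]]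
    by (simp add: integral_normal_density)
  finally show ?thesis by simp
qed

lemma heat_kernel_semigroup:
  assumes "0 < \<nu>" "0 < s" "0 < t"
  shows "(\<integral>\<^sup>+z. ennreal (heat_kernel \<nu> s (x - z)) * ennreal (heat_kernel \<nu> t (z - y)) \<partial>lborel)
    = ennreal (heat_kernel \<nu> (s + t) (x - y))"
proof -
  have "(\<integral>\<^sup>+z. ennreal (heat_kernel \<nu> s (x - z)) * ennreal (heat_kernel \<nu> t (z - y)) \<partial>lborel)
     = (\<integral>\<^sup>+w. ennreal (heat_kernel \<nu> s (x - (y + 1 * w))) * ennreal (heat_kernel \<nu> t (y + 1 * w - y)) \<partial>lborel)"
    by (subst nn_integral_real_affine[of _ 1 y]) auto
  also have "\<dots> = (\<integral>\<^sup>+w. ennreal (normal_density 0 (sqrt (\<nu> * s)) ((x - y) - w) * normal_density 0 (sqrt (\<nu> * t)) w) \<partial>lborel)"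
    using assms by (intro nn_integral_cong) (simp add: heat_kernel_eq_normal_density ennreal_mult' algebra_simps)
  also have "\<dots> = ennreal (normal_density 0 (sqrt ((sqrt (\<nu> * s))\<^sup>2 + (sqrt (\<nu> * t))\<^sup>2)) (x - y))"
    using assms by (subst fun_cong[OF conv_normal_density_zero_mean]) auto
  also have "\<dots> = ennreal (heat_kernel \<nu> (s + t) (x - y))"
    using assms by (simp add: heat_kernel_eq_normal_density algebra_simps)
  finally show ?thesis .
qed

text \<open>
  The square of a Gaussian density is a Gaussian density of half the variance, times the singular
  factor that makes the equation for the second moment a Volterra equation.
\<close>
lemma heat_kernel_square:
  assumes "0 < \<nu>"
  shows "ennreal (lam\<^sup>2) * ennreal ((heat_kernel \<nu> t x)\<^sup>2)
    = sing_kernel (lam\<^sup>2 / (2 * sqrt \<nu>)) 0 t * ennreal (heat_kernel (\<nu> / 2) t x)"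
proof (cases "t > 0")
  case True
  have e: "exp (- (x\<^sup>2 / (2 * \<nu> * t))) * exp (- (x\<^sup>2 / (2 * \<nu> * t))) = exp (- (x\<^sup>2 / (\<nu> * t)))"
    by (simp add: field_simps flip: exp_add)
  have "(heat_kernel \<nu> t x)\<^sup>2 = 1 / (2 * pi * \<nu> * t) * exp (- (x\<^sup>2 / (\<nu> * t)))"
    using True assms by (simp add: heat_kernel_def power2_eq_square[of "_ / _"] flip: e)
  moreover have "lam\<^sup>2 / (2 * sqrt \<nu>) / sqrt (pi * t) * heat_kernel (\<nu> / 2) t x
      = lam\<^sup>2 * (1 / (2 * pi * \<nu> * t) * exp (- (x\<^sup>2 / (\<nu> * t))))"
  proof -
    have "(2 * sqrt \<nu>) * sqrt (pi * t) * sqrt (pi * \<nu> * t) = 2 * sqrt ((pi * \<nu> * t) * (pi * \<nu> * t))"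
      unfolding real_sqrt_mult by (simp only: mult_ac)
    also have "\<dots> = 2 * pi * \<nu> * t"
      using True assms by simp
    finally have "(2 * sqrt \<nu>) * sqrt (pi * t) * sqrt (pi * \<nu> * t) = 2 * pi * \<nu> * t" .
    with True show ?thesis by (simp add: heat_kernel_def)
  qed
  ultimately show ?thesis
    using True assms by (simp add: sing_kernel_def flip: ennreal_mult') 
qed (simp add: sing_kernel_def heat_kernel_def)

lemma heat_kernel_product:
  assumes "0 < \<nu>"
  shows "ennreal (lam\<^sup>2) * (\<integral>\<^sup>+z. ennreal (heat_kernel \<nu> t (x - z) * heat_kernel \<nu> t (y - z)) \<partial>lborel)
    = sing_kernel (lam\<^sup>2 / (2 * sqrt \<nu>)) (\<bar>x - y\<bar> / (2 * sqrt \<nu>)) t"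
proof (cases "t > 0")
  case True
  have "(\<integral>\<^sup>+z. ennreal (heat_kernel \<nu> t (x - z) * heat_kernel \<nu> t (y - z)) \<partial>lborel)
      = ennreal (heat_kernel \<nu> (t + t) (x - y))"
    using heat_kernel_semigroup[OF assms True True, of x y] assms
    by (simp add: heat_kernel_minus[of _ _ y] heat_kernel_nonneg ennreal_mult')
  moreover have "lam\<^sup>2 * heat_kernel \<nu> (t + t) (x - y)
      = lam\<^sup>2 / (2 * sqrt \<nu>) / sqrt (pi * t) * exp (- ((\<bar>x - y\<bar> / (2 * sqrt \<nu>))\<^sup>2 / t))"
  proof -
    have "sqrt (2 * pi * \<nu> * (t + t)) = sqrt ((2 * 2) * \<nu> * (pi * t))"
      by (simp add: algebra_simps)
    also have "\<dots> = 2 * sqrt \<nu> * sqrt (pi * t)"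
      unfolding real_sqrt_mult[of "_ * _ :: real"] real_sqrt_mult[of 2 2] by (simp add: real_sqrt_mult)
    finally show ?thesis
      using True assms by (simp add: heat_kernel_def power_divide power_mult_distrib field_simps)
  qed
  ultimately show ?thesis
    using True assms by (simp add: sing_kernel_def flip: ennreal_mult')
qed (simp add: sing_kernel_def heat_kernel_def)

section \<open>Uniqueness for the Volterra equation of the second moment\<close>
lemma nn_integral_time_conv:
  assumes [measurable]: "f \<in> borel_measurable borel" "g \<in> borel_measurable borel"
  shows "(\<integral>\<^sup>+t. (f \<star> g) t \<partial>lborel) = (\<integral>\<^sup>+t. f t \<partial>lborel) * (\<integral>\<^sup>+t. g t \<partial>lborel)"
proof -
  have "(\<integral>\<^sup>+t. (f \<star> g) t \<partial>lborel) = (\<integral>\<^sup>+s. (\<integral>\<^sup>+t. f s * g (t - s) \<partial>lborel) \<partial>lborel)"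
    unfolding time_conv_def by (rule lborel_pair.Fubini') measurable
  also have "\<dots> = (\<integral>\<^sup>+s. f s * (\<integral>\<^sup>+t. g t \<partial>lborel) \<partial>lborel)"
  proof (intro nn_integral_cong)
    fix s
    have "(\<integral>\<^sup>+t. g (t - s) \<partial>lborel) = (\<integral>\<^sup>+t. g t \<partial>lborel)"
      using nn_integral_real_affine[of "\<lambda>t. g (t - s)" 1 s] by simp
    then show "(\<integral>\<^sup>+t. f s * g (t - s) \<partial>lborel) = f s * (\<integral>\<^sup>+t. g t \<partial>lborel)"
      by (simp add: nn_integral_cmult)
  qed
  finally show ?thesis by (simp add: nn_integral_multc)
qed

lemma nn_integral_exp_neg:
  assumes "0 < \<beta>"
  shows "(\<integral>\<^sup>+v. ennreal (exp (- \<beta> * v)) * indicator {0<..} v \<partial>lborel) = ennreal (1 / \<beta>)"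
proof -
  let ?F = "\<lambda>v. - exp (- \<beta> * v) / \<beta>"
  have l: "((?F \<circ> real_of_ereal) \<longlongrightarrow> ?F 0) (at_right (ereal 0))"
    unfolding ereal_tendsto_simps1 by (intro tendsto_intros) (use assms in auto)
  have u: "((?F \<circ> real_of_ereal) \<longlongrightarrow> 0) (at_left \<infinity>)"
    unfolding ereal_tendsto_simps1 using assms by real_asymp
  have "(?F has_real_derivative exp (- \<beta> * v)) (at v)" for v
    using assms by (auto intro!: derivative_eq_intros)
  from nn_integral_FTC_einterval(1)[OF _ this _ _ l u] assms
  show ?thesis by (auto intro!: continuous_intros simp: einterval_def greaterThan_def)
qed

text \<open>
  A Gronwall argument.  Two steps of the inequality give \<open>\<phi>(s) \<le> b\<^sup>2 * \<integral> \<phi>\<close> with the integral taken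
  up to \<open>s\<close>, and the weight \<open>exp (- \<beta> * s)\<close> with large \<open>\<beta>\<close> turns this into \<open>n \<le> n / 2\<close> for the
  weighted integral \<open>n\<close> of \<open>\<phi>\<close>.  That \<open>n\<close> is finite follows from the value of the convolution at
  \<open>t\<close>, as the kernel is bounded below there.
\<close>
lemma sing_volterra_zero:
  fixes \<phi> :: "real \<Rightarrow> ennreal"
  assumes [measurable]: "\<phi> \<in> borel_measurable borel" and "0 \<le> b"
    and supp: "\<And>s. s \<le> 0 \<or> t \<le> s \<Longrightarrow> \<phi> s = 0"
    and le: "\<And>s. \<phi> s \<le> (\<phi> \<star> sing_kernel b 0) s"
    and fin: "(\<phi> \<star> sing_kernel b 0) t < \<infinity>"
  shows "(\<phi> \<star> sing_kernel b 0) t = 0"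
proof (cases "b = 0 \<or> t \<le> 0")
  case True
  then have "\<phi> s * sing_kernel b 0 (t - s) = 0" for s
    using supp[of s] by (auto simp: sing_kernel_def)
  then show ?thesis by (rule time_conv_eq_0)
next
  case False
  with \<open>0 \<le> b\<close> have b: "0 < b" and t: "0 < t" by auto
  let ?N = "sing_kernel b 0"
  \<comment> \<open>large enough for \<open>b\<^sup>2\<close> times the integral of \<open>exp (- \<beta> * s)\<close> to be at most one half\<close>
  define \<beta> where "\<beta> = 2 * b\<^sup>2 + 1"
  have \<beta>: "0 < \<beta>" "b\<^sup>2 / \<beta> \<le> 1 / 2"
  proof -
    show "0 < \<beta>" unfolding \<beta>_def using zero_le_power2[of b] by linarith
    then show "b\<^sup>2 / \<beta> \<le> 1 / 2" by (simp add: divide_le_eq \<beta>_def)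
  qed
  define e where "e s = ennreal (exp (- \<beta> * s))" for s
  have [measurable]: "e \<in> borel_measurable borel"
    unfolding e_def[abs_def] by measurable
  have e_split: "e s = e r * e (s - r)" for s r
    by (simp add: e_def algebra_simps flip: ennreal_mult' exp_add)
  define n where "n = (\<integral>\<^sup>+s. e s * \<phi> s \<partial>lborel)"
  have le2: "\<phi> s \<le> (\<phi> \<star> (?N \<star> ?N)) s" for s
  proof -
    have "\<phi> s \<le> (\<phi> \<star> ?N) s" by (rule le)
    also have "\<dots> \<le> (\<phi> \<star> ?N \<star> ?N) s" by (intro time_conv_mono le) auto
    finally show ?thesis by (simp add: time_conv_assoc)
  qed
  have "n \<le> (\<integral>\<^sup>+s. ((\<lambda>r. e r * \<phi> r) \<star> (\<lambda>r. e r * (?N \<star> ?N) r)) s \<partial>lborel)"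
    unfolding n_def
  proof (intro nn_integral_mono)
    fix s
    have "e s * \<phi> s \<le> e s * (\<phi> \<star> (?N \<star> ?N)) s"
      by (intro mult_left_mono le2) auto
    also have "\<dots> = (\<integral>\<^sup>+r. e s * (\<phi> r * (?N \<star> ?N) (s - r)) \<partial>lborel)"
      unfolding time_conv_def[of \<phi>] by (rule nn_integral_cmult[symmetric]) measurable
    also have "\<dots> = ((\<lambda>r. e r * \<phi> r) \<star> (\<lambda>r. e r * (?N \<star> ?N) r)) s"
      unfolding time_conv_def[of "\<lambda>r. e r * \<phi> r"]
      by (intro nn_integral_cong) (subst e_split[of s], simp add: mult_ac)
    finally show "e s * \<phi> s \<le> ((\<lambda>r. e r * \<phi> r) \<star> (\<lambda>r. e r * (?N \<star> ?N) r)) s" .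
  qed
  also have "\<dots> = n * (\<integral>\<^sup>+r. e r * (?N \<star> ?N) r \<partial>lborel)"
    unfolding n_def by (rule nn_integral_time_conv) measurable
  also have "(\<integral>\<^sup>+r. e r * (?N \<star> ?N) r \<partial>lborel) = (\<integral>\<^sup>+r. ennreal (b\<^sup>2) * (ennreal (exp (- \<beta> * r)) * indicator {0<..} r) \<partial>lborel)"
    using b by (intro nn_integral_cong) (auto simp: sing_kernel_conv e_def mult_ac)
  also have "\<dots> = ennreal (b\<^sup>2) * ennreal (1 / \<beta>)"
    by (subst nn_integral_cmult) (simp_all only: nn_integral_exp_neg[OF \<beta>(1)], measurable)
  also have "\<dots> = ennreal (b\<^sup>2 / \<beta>)"
    using \<beta> by (simp flip: ennreal_mult')
  finally have n_le: "n \<le> n * ennreal (b\<^sup>2 / \<beta>)" .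
  have "n \<le> (\<integral>\<^sup>+s. ennreal (sqrt (pi * t) / b) * (\<phi> s * ?N (t - s)) \<partial>lborel)"
    unfolding n_def
  proof (intro nn_integral_mono)
    fix s
    show "e s * \<phi> s \<le> ennreal (sqrt (pi * t) / b) * (\<phi> s * ?N (t - s))"
    proof (cases "0 < s \<and> s < t")
      case True
      have "e s \<le> ennreal 1"
        unfolding e_def using True \<beta> by (intro ennreal_leI) auto
      also have "\<dots> \<le> ennreal (sqrt (pi * t) / b * (b / sqrt (pi * (t - s))))"
      proof (intro ennreal_leI)
        have "sqrt (pi * (t - s)) \<le> sqrt (pi * t)" using True by simp
        moreover have "0 < sqrt (pi * (t - s))" using True by simp
        ultimately have "1 \<le> sqrt (pi * t) / sqrt (pi * (t - s))" by (subst le_divide_eq_1_pos)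
        with b show "1 \<le> sqrt (pi * t) / b * (b / sqrt (pi * (t - s)))" by simp
      qed
      also have "\<dots> = ennreal (sqrt (pi * t) / b) * ?N (t - s)"
        using True b t by (simp add: sing_kernel_def flip: ennreal_mult')
      finally have "e s * \<phi> s \<le> ennreal (sqrt (pi * t) / b) * ?N (t - s) * \<phi> s"
        by (rule mult_right_mono) auto
      then show ?thesis by (simp add: mult_ac)
    qed (use supp[of s] in auto)
  qed
  also have "\<dots> = ennreal (sqrt (pi * t) / b) * (\<phi> \<star> ?N) t"
    unfolding time_conv_def by (rule nn_integral_cmult) measurable
  also have "\<dots> < \<infinity>"
    using fin by (simp add: ennreal_mult_less_top)
  finally have "n < \<infinity>" .
  then obtain m where m: "n = ennreal m" "0 \<le> m" by (cases n) auto
  from n_le have "m \<le> m * (b\<^sup>2 / \<beta>)"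
    using m \<beta> by (simp flip: ennreal_mult)
  also have "\<dots> \<le> m * (1 / 2)"
    using m \<beta> by (intro mult_left_mono) auto
  finally have "n = 0" using m by simp
  then have "AE s in lborel. e s * \<phi> s = 0"
    unfolding n_def by (subst (asm) nn_integral_0_iff_AE) auto
  then have "AE s in lborel. \<phi> s * ?N (t - s) = 0"
    by eventually_elim (auto simp: e_def)
  then show ?thesis
    unfolding time_conv_def by (subst nn_integral_0_iff_AE) auto
qed

text \<open>
  The integral operator with kernel \<open>lam\<^sup>2 * G(t - s, x - z)\<^sup>2\<close>, in the factorized form of
  \<open>heat_kernel_square\<close> with \<open>\<kappa> = \<nu> / 2\<close>.
\<close>
definition heat_volterra :: "real \<Rightarrow> real \<Rightarrow> (real \<Rightarrow> real \<Rightarrow> ennreal) \<Rightarrow> real \<Rightarrow> real \<Rightarrow> ennreal" where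
  "heat_volterra \<kappa> b h t x =
     (\<integral>\<^sup>+s. (\<integral>\<^sup>+z. ennreal (heat_kernel \<kappa> (t - s) (x - z)) * h s z \<partial>lborel) * sing_kernel b 0 (t - s) \<partial>lborel)"

text \<open>
  Fix \<open>(t, x)\<close> and let \<open>\<phi>(s)\<close> be the average of \<open>h(s, -)\<close> against the heat kernel \<open>G(t - s, x - z)\<close>.
  By the semigroup property, averaging the inequality for \<open>h\<close> leaves the one for \<open>\<phi>\<close> in
  \<open>sing_volterra_zero\<close>, in which the space variable has disappeared.
\<close>
lemma heat_volterra_uniqueness:
  fixes h :: "real \<Rightarrow> real \<Rightarrow> ennreal"
  assumes [measurable]: "(\<lambda>(s, z). h s z) \<in> borel_measurable (lborel \<Otimes>\<^sub>M lborel)"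
    and "0 < \<kappa>" "0 \<le> b"
    and supp: "\<And>s z. s \<le> 0 \<Longrightarrow> h s z = 0"
    and le: "\<And>s z. 0 < s \<Longrightarrow> h s z \<le> heat_volterra \<kappa> b h s z"
    and fin: "heat_volterra \<kappa> b h t x < \<infinity>"
    and t: "0 < t"
  shows "h t x = 0"
proof -
  let ?N = "sing_kernel b 0" and ?p = "\<lambda>t x. ennreal (heat_kernel \<kappa> t x)"
  define \<phi> where "\<phi> s = (\<integral>\<^sup>+z. ?p (t - s) (x - z) * h s z \<partial>lborel)" for s
  have [measurable]: "\<phi> \<in> borel_measurable borel"
    unfolding \<phi>_def[abs_def] by measurable
  have V: "heat_volterra \<kappa> b h t x = (\<phi> \<star> ?N) t"
    by (simp add: heat_volterra_def time_conv_def \<phi>_def)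
  have "(\<phi> \<star> ?N) t = 0"
  proof (rule sing_volterra_zero)
    show "\<phi> s = 0" if "s \<le> 0 \<or> t \<le> s" for s
      using that supp by (auto simp: \<phi>_def heat_kernel_def)
    show "\<phi> s \<le> (\<phi> \<star> ?N) s" for s
    proof (cases "0 < s \<and> s < t")
      case True
      have "\<phi> s \<le> (\<integral>\<^sup>+z. ?p (t - s) (x - z) * heat_volterra \<kappa> b h s z \<partial>lborel)"
        unfolding \<phi>_def using True by (intro nn_integral_mono mult_left_mono le) auto
      also have "\<dots> = (\<integral>\<^sup>+z. (\<integral>\<^sup>+r. (\<integral>\<^sup>+w. ?N (s - r) * h r w * (?p (t - s) (x - z) * ?p (s - r) (z - w)) \<partial>lborel) \<partial>lborel) \<partial>lborel)"
        unfolding heat_volterra_def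
        by (simp add: nn_integral_cmult[symmetric] nn_integral_multc[symmetric] mult_ac)
      also have "\<dots> = (\<integral>\<^sup>+r. (\<integral>\<^sup>+z. (\<integral>\<^sup>+w. ?N (s - r) * h r w * (?p (t - s) (x - z) * ?p (s - r) (z - w)) \<partial>lborel) \<partial>lborel) \<partial>lborel)"
        by (rule lborel_pair.Fubini') measurable
      also have "\<dots> = (\<integral>\<^sup>+r. \<phi> r * ?N (s - r) \<partial>lborel)"
      proof (intro nn_integral_cong)
        fix r
        show "(\<integral>\<^sup>+z. (\<integral>\<^sup>+w. ?N (s - r) * h r w * (?p (t - s) (x - z) * ?p (s - r) (z - w)) \<partial>lborel) \<partial>lborel) = \<phi> r * ?N (s - r)"
        proof (cases "r < s")
          case r: True
          have "(\<integral>\<^sup>+z. (\<integral>\<^sup>+w. ?N (s - r) * h r w * (?p (t - s) (x - z) * ?p (s - r) (z - w)) \<partial>lborel) \<partial>lborel)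
            = (\<integral>\<^sup>+w. (\<integral>\<^sup>+z. ?N (s - r) * h r w * (?p (t - s) (x - z) * ?p (s - r) (z - w)) \<partial>lborel) \<partial>lborel)"
            by (rule lborel_pair.Fubini') measurable
          also have "\<dots> = (\<integral>\<^sup>+w. ?N (s - r) * h r w * (\<integral>\<^sup>+z. ?p (t - s) (x - z) * ?p (s - r) (z - w) \<partial>lborel) \<partial>lborel)"
            by (intro nn_integral_cong nn_integral_cmult) measurable
          also have "\<dots> = (\<integral>\<^sup>+w. ?N (s - r) * h r w * ?p (t - r) (x - w) \<partial>lborel)"
            using heat_kernel_semigroup[of \<kappa> "t - s" "s - r" x] True r assms by simp
          also have "\<dots> = \<phi> r * ?N (s - r)"
            unfolding \<phi>_def by (subst nn_integral_multc[symmetric]) (auto simp: mult_ac)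
          finally show ?thesis .
        qed (simp add: sing_kernel_def)
      qed
      finally show ?thesis by (simp add: time_conv_def)
    next
      case False
      then have "\<phi> s = 0" using supp by (auto simp: \<phi>_def heat_kernel_def)
      then show ?thesis by simp
    qed
  qed (use fin V assms in auto)
  with le[OF t, of x] V show ?thesis by simp
qed

lemma heat_volterra_mono:
  "(\<And>s z. h s z \<le> h' s z) \<Longrightarrow> heat_volterra \<kappa> b h t x \<le> heat_volterra \<kappa> b h' t x"
  unfolding heat_volterra_def by (intro nn_integral_mono mult_right_mono mult_left_mono) auto

lemma heat_volterra_add:
  assumes [measurable]: "(\<lambda>(s, z). h s z) \<in> borel_measurable (lborel \<Otimes>\<^sub>M lborel)"
    "(\<lambda>(s, z). h' s z) \<in> borel_measurable (lborel \<Otimes>\<^sub>M lborel)"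
  shows "heat_volterra \<kappa> b (\<lambda>s z. h s z + h' s z) t x = heat_volterra \<kappa> b h t x + heat_volterra \<kappa> b h' t x"
  unfolding heat_volterra_def
  by (simp add: distrib_left distrib_right nn_integral_add)

lemma heat_volterra_space_constant:
  assumes [measurable]: "f \<in> borel_measurable borel" and "0 < \<kappa>"
  shows "heat_volterra \<kappa> b (\<lambda>s z. f s) t x = (sing_kernel b 0 \<star> f) t"
proof -
  have "heat_volterra \<kappa> b (\<lambda>s z. f s) t x = (f \<star> sing_kernel b 0) t"
    unfolding heat_volterra_def time_conv_def
  proof (intro nn_integral_cong)
    fix s
    show "(\<integral>\<^sup>+z. ennreal (heat_kernel \<kappa> (t - s) (x - z)) * f s \<partial>lborel) * sing_kernel b 0 (t - s) = f s * sing_kernel b 0 (t - s)"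
    proof (cases "s < t")
      case True
      then show ?thesis
        using assms by (simp add: nn_integral_multc nn_integral_heat_kernel)
    qed (simp add: sing_kernel_def)
  qed
  then show ?thesis by (simp add: time_conv_commute)
qed

lemma ennreal_le_add_dist: "a \<le> b + max (a - b) (b - a :: ennreal)"
proof (cases "a \<le> b")
  case True then show ?thesis by (simp add: add_increasing2)
next
  case False
  then have "b \<le> a" by simp
  then have "a = b + (a - b)" by (simp add: add_diff_self_ennreal)
  also have "\<dots> \<le> b + max (a - b) (b - a)" by (intro add_left_mono) simp
  finally show ?thesis .
qed

lemma ennreal_minus_leI: "a \<le> b + c \<Longrightarrow> b < top \<Longrightarrow> a - b \<le> (c :: ennreal)"
  using ennreal_minus_mono[of a "b + c" b b] by (simp add: ennreal_add_diff_cancel_left)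

text \<open>
  The distance \<open>h\<close> of two solutions satisfies \<open>h \<le> K h\<close>, and \<open>K h\<close> is finite because both
  solutions are; so \<open>heat_volterra_uniqueness\<close> applies.  One of the solutions is taken to be the
  explicit one that is constant in space.
\<close>
lemma volterra_solution_unique:
  fixes v :: "real \<Rightarrow> real \<Rightarrow> ennreal"
  assumes v [measurable]: "(\<lambda>(s, z). v s z) \<in> borel_measurable (lborel \<Otimes>\<^sub>M lborel)"
    and "0 < \<kappa>" "0 \<le> b" "0 \<le> c"
    and supp: "\<And>s z. s \<le> 0 \<Longrightarrow> v s z = 0"
    and fin: "\<And>s z. 0 < s \<Longrightarrow> v s z < top"
    and eq: "\<And>s z. 0 < s \<Longrightarrow> v s z = ennreal c + heat_volterra \<kappa> b v s z"
  shows "v s z = (if 0 < s then ennreal (c * growth b s) else 0)"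
proof -
  define V where "V s = ennreal c * (if 0 < s then ennreal (growth b s) else 0)" for s
  have g [measurable]: "growth b \<in> borel_measurable borel"
    unfolding growth_def[abs_def] by measurable
  have [measurable]: "V \<in> borel_measurable borel"
    unfolding V_def[abs_def] by measurable
  have Vfin: "V s < top" for s
    by (simp add: V_def ennreal_mult_less_top)
  let ?K = "heat_volterra \<kappa> b"
  have KV: "?K (\<lambda>s z. V s) t x = ennreal (c * corr_excess b 0 t)" if "0 < t" for t x
  proof -
    have "?K (\<lambda>s z. V s) t x = (sing_kernel b 0 \<star> V) t"
      by (rule heat_volterra_space_constant) (use assms in auto)
    also have "\<dots> = (V \<star> sing_kernel b 0) t"
      by (subst time_conv_commute) auto
    also have "\<dots> = ennreal c * ((\<lambda>s. if 0 < s then ennreal (growth b s) else 0) \<star> sing_kernel b 0) t"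
      unfolding V_def by (subst time_conv_cmult_left) auto
    also have "\<dots> = ennreal c * (sing_kernel b 0 \<star> (\<lambda>s. if 0 < s then ennreal (growth b s) else 0)) t"
      by (subst time_conv_commute) auto
    also have "\<dots> = ennreal (c * corr_excess b 0 t)"
      using assms that by (simp add: sing_kernel_conv_growth ennreal_mult')
    finally show ?thesis .
  qed
  have Veq: "V t = ennreal c + ?K (\<lambda>s z. V s) t x" if "0 < t" for t x
    unfolding KV[OF that] using that assms corr_excess_eq(2)[of b 0 t]
    by (simp add: V_def growth_eq_corr_excess distrib_left flip: ennreal_plus ennreal_mult')
  define h where "h s z = max (v s z - V s) (V s - v s z)" for s z
  have hm [measurable]: "(\<lambda>(s, z). h s z) \<in> borel_measurable (lborel \<Otimes>\<^sub>M lborel)"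
    unfolding h_def by measurable
  have VM [measurable]: "(\<lambda>(s, z). V s) \<in> borel_measurable (lborel \<Otimes>\<^sub>M (lborel :: real measure))"
    by measurable
  have v_le: "v s z \<le> V s + h s z" and V_le: "V s \<le> v s z + h s z" for s z
    using ennreal_le_add_dist[of "v s z" "V s"] ennreal_le_add_dist[of "V s" "v s z"]
    by (simp_all add: h_def max.commute)
  have h0: "h s z = 0" if s: "0 < s" for s z
  proof (rule heat_volterra_uniqueness[OF hm \<open>0 < \<kappa>\<close> \<open>0 \<le> b\<close>])
    show "h s z = 0" if "s \<le> 0" for s z
      using that supp by (simp add: h_def V_def)
    show "h s z \<le> ?K h s z" if s: "0 < s" for s z
    proof -
      have "?K v s z \<le> ?K (\<lambda>s z. V s + h s z) s z"
        by (intro heat_volterra_mono v_le)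
      also have "\<dots> = ?K (\<lambda>s z. V s) s z + ?K h s z"
        by (rule heat_volterra_add[OF VM hm])
      finally have 1: "v s z \<le> V s + ?K h s z"
        unfolding eq[OF s] Veq[OF s, of z] by (simp add: add.assoc add_left_mono)
      have "?K (\<lambda>s z. V s) s z \<le> ?K (\<lambda>s z. v s z + h s z) s z"
        by (intro heat_volterra_mono V_le)
      also have "\<dots> = ?K v s z + ?K h s z"
        by (rule heat_volterra_add[OF v hm])
      finally have 2: "V s \<le> v s z + ?K h s z"
        unfolding eq[OF s] Veq[OF s, of z] by (simp add: add.assoc add_left_mono)
      show ?thesis
        using ennreal_minus_leI[OF 1 Vfin] ennreal_minus_leI[OF 2 fin[OF s]] by (simp add: h_def[of s z])
    qed
    have "h s z \<le> v s z + V s" for s z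
    proof -
      have "v s z - V s \<le> v s z + V s" "V s - v s z \<le> v s z + V s"
        by (rule order_trans[OF diff_le_self_ennreal]; simp)+
      then show ?thesis by (simp add: h_def)
    qed
    then have "?K h s z \<le> ?K (\<lambda>s z. v s z + V s) s z"
      by (intro heat_volterra_mono)
    also have "\<dots> = ?K v s z + ?K (\<lambda>s z. V s) s z"
      by (rule heat_volterra_add[OF v VM])
    also have "\<dots> \<le> v s z + V s"
      unfolding eq[OF s] Veq[OF s, of z] by (intro add_mono) auto
    also have "\<dots> < \<infinity>"
      using fin[OF s] Vfin by simp
    finally show "?K h s z < \<infinity>" .
  qed fact
  show ?thesis
  proof (cases "0 < s")
    case True
    then have "v s z = V s"
      using v_le[of s z] V_le[of s z] h0[OF True] by simp
    with True assms show ?thesis by (simp add: V_def ennreal_mult')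
  qed (use supp in auto)
qed

section \<open>Fourier transforms of weighted distributions\<close>

text \<open>
  Since \<open>D\<close> is bounded and has mean zero (take \<open>\<theta> = 0\<close>), \<open>1 + D / c\<close> is a probability density for large \<open>c\<close>.  The
  hypothesis says that \<open>X\<close> has the same characteristic function under this density as under the
  original measure, hence the same distribution.
\<close>
lemma (in prob_space) fourier_vanish_real:
  fixes D :: "'a \<Rightarrow> real"
  assumes [measurable]: "D \<in> borel_measurable M" "X \<in> borel_measurable M"
    and bound: "\<And>\<omega>. \<omega> \<in> space M \<Longrightarrow> \<bar>D \<omega>\<bar> \<le> C"
    and four: "\<And>\<theta>. (CLINT \<omega>|M. of_real (D \<omega>) * iexp (\<theta> * X \<omega>)) = 0"
    and S [measurable]: "S \<in> sets borel"
  shows "(LINT \<omega>|M. D \<omega> * indicator S (X \<omega>)) = 0"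
proof -
  define c where "c = \<bar>C\<bar> + 1"
  have c: "0 < c" "\<And>\<omega>. \<omega> \<in> space M \<Longrightarrow> \<bar>D \<omega>\<bar> \<le> c"
    using bound by (force simp: c_def)+
  define g where "g \<omega> = 1 + D \<omega> / c" for \<omega>
  have [measurable]: "g \<in> borel_measurable M"
    unfolding g_def[abs_def] by measurable
  have g0: "0 \<le> g \<omega>" "g \<omega> \<le> 2" if "\<omega> \<in> space M" for \<omega>
    using c(1) c(2)[OF that] by (auto simp: g_def field_simps abs_le_iff)
  have intD: "integrable M D"
    by (rule integrable_const_bound[of _ c]) (use c in auto)
  have "complex_of_real (LINT \<omega>|M. D \<omega>) = 0"
    using four[of 0] by (simp del: integral_complex_of_real add: integral_complex_of_real[symmetric])
  then have "(LINT \<omega>|M. D \<omega>) = 0" by simp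
  then have "(LINT \<omega>|M. g \<omega>) = 1"
    using intD by (simp add: g_def prob_space)
  moreover have "integrable M g"
    by (rule integrable_const_bound[of _ 2]) (use g0 in auto)
  ultimately have "(\<integral>\<^sup>+\<omega>. ennreal (g \<omega>) \<partial>M) = 1"
    using g0 by (subst nn_integral_eq_integral) auto
  then have prob: "prob_space (density M g)"
    by (intro prob_spaceI) (simp add: emeasure_density cong: nn_integral_cong)
  interpret N: prob_space "density M g" by fact
  have "char (distr (density M g) borel X) = char (distr M borel X)"
  proof
    fix \<theta>
    have "char (distr (density M g) borel X) \<theta> = (CLINT \<omega>|density M g. iexp (\<theta> * X \<omega>))"
      unfolding char_def by (subst integral_distr) auto
    also have "\<dots> = (CLINT \<omega>|M. g \<omega> *\<^sub>R iexp (\<theta> * X \<omega>))"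
      using g0 by (intro integral_density) auto
    also have "\<dots> = (CLINT \<omega>|M. iexp (\<theta> * X \<omega>) + (1 / c) *\<^sub>R (of_real (D \<omega>) * iexp (\<theta> * X \<omega>)))"
      by (intro Bochner_Integration.integral_cong) (auto simp: g_def scaleR_conv_of_real field_simps)
    also have "\<dots> = (CLINT \<omega>|M. iexp (\<theta> * X \<omega>)) + (1 / c) *\<^sub>R (CLINT \<omega>|M. of_real (D \<omega>) * iexp (\<theta> * X \<omega>))"
    proof (subst Bochner_Integration.integral_add)
      show "integrable M (\<lambda>\<omega>. (1 / c) *\<^sub>R (of_real (D \<omega>) * iexp (\<theta> * X \<omega>)))"
        by (intro integrable_scaleR_right integrable_const_bound[of _ c])
           (use c in \<open>auto simp: norm_mult\<close>)
    qed (auto intro!: integrable_const_bound[of _ 1])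
    also have "\<dots> = char (distr M borel X) \<theta>"
      unfolding four char_def by (subst integral_distr) auto
    finally show "char (distr (density M g) borel X) \<theta> = char (distr M borel X) \<theta>" .
  qed
  then have eq: "distr (density M g) borel X = distr M borel X"
    by (intro Levy_uniqueness N.real_distribution_distr real_distribution_distr) auto
  have "(LINT \<omega>|M. g \<omega> * indicator S (X \<omega>)) = (LINT \<omega>|density M g. indicator S (X \<omega>))"
    using g0 by (subst integral_density) auto
  also have "\<dots> = (LINT x|distr (density M g) borel X. indicator S x)"
    by (subst integral_distr) auto
  also have "\<dots> = (LINT \<omega>|M. indicator S (X \<omega>))"
    unfolding eq by (subst integral_distr) auto
  finally have *: "(LINT \<omega>|M. g \<omega> * indicator S (X \<omega>)) = (LINT \<omega>|M. indicator S (X \<omega>))" .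
  have i1: "integrable M (\<lambda>\<omega>. indicator S (X \<omega>) :: real)"
    by (rule integrable_const_bound[of _ 1]) auto
  have i2: "integrable M (\<lambda>\<omega>. D \<omega> * indicator S (X \<omega>))"
    by (rule integrable_const_bound[of _ c]) (use c in \<open>auto simp: indicator_def\<close>)
  have "(LINT \<omega>|M. g \<omega> * indicator S (X \<omega>)) = (LINT \<omega>|M. indicator S (X \<omega>) + (D \<omega> * indicator S (X \<omega>)) / c)"
    by (intro Bochner_Integration.integral_cong) (auto simp: g_def field_simps)
  also have "\<dots> = (LINT \<omega>|M. indicator S (X \<omega>)) + (LINT \<omega>|M. D \<omega> * indicator S (X \<omega>)) / c"
    using i1 i2 by simp
  finally show ?thesis
    using * c by simp
qed

text \<open>
  The hypothesis for \<open>-\<theta>\<close>, conjugated, is the hypothesis for the conjugate of \<open>D\<close>; so it holds for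
  the real and the imaginary part of \<open>D\<close>.
\<close>
lemma (in prob_space) fourier_vanish:
  fixes D :: "'a \<Rightarrow> complex"
  assumes [measurable]: "D \<in> borel_measurable M" "X \<in> borel_measurable M"
    and bound: "\<And>\<omega>. \<omega> \<in> space M \<Longrightarrow> cmod (D \<omega>) \<le> C"
    and four: "\<And>\<theta>. (CLINT \<omega>|M. D \<omega> * iexp (\<theta> * X \<omega>)) = 0"
    and S [measurable]: "S \<in> sets borel"
  shows "(CLINT \<omega>|M. D \<omega> * indicator S (X \<omega>)) = 0"
proof -
  have int: "integrable M (\<lambda>\<omega>. D \<omega> * iexp (\<theta> * X \<omega>))" for \<theta>
    by (rule integrable_const_bound[of _ C]) (use bound in \<open>auto simp: norm_mult\<close>)
  have [measurable]: "(\<lambda>\<omega>. cnj (D \<omega>)) \<in> borel_measurable M"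
    by (intro measurable_compose[OF assms(1)] borel_measurable_continuous_onI continuous_intros)
  have int': "integrable M (\<lambda>\<omega>. cnj (D \<omega>) * iexp (\<theta> * X \<omega>))" for \<theta>
    by (rule integrable_const_bound[of _ C]) (use bound in \<open>auto simp: norm_mult\<close>)
  have four': "(CLINT \<omega>|M. cnj (D \<omega>) * iexp (\<theta> * X \<omega>)) = 0" for \<theta>
  proof -
    have "(CLINT \<omega>|M. cnj (D \<omega>) * iexp (\<theta> * X \<omega>)) = (CLINT \<omega>|M. cnj (D \<omega> * iexp (- \<theta> * X \<omega>)))"
      by (intro Bochner_Integration.integral_cong) (auto simp: exp_cnj)
    also have "\<dots> = 0"
      using arg_cong[OF four[of "- \<theta>"], of cnj] by (simp only: Bochner_Integration.integral_cnj complex_cnj_zero)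
    finally show ?thesis .
  qed
  have re: "(LINT \<omega>|M. Re (D \<omega>) * indicator S (X \<omega>)) = 0"
  proof (rule fourier_vanish_real)
    show "\<bar>Re (D \<omega>)\<bar> \<le> C" if "\<omega> \<in> space M" for \<omega>
      using bound[OF that] abs_Re_le_cmod[of "D \<omega>"] by simp
    fix \<theta>
    have "(CLINT \<omega>|M. of_real (Re (D \<omega>)) * iexp (\<theta> * X \<omega>))
        = (CLINT \<omega>|M. (D \<omega> * iexp (\<theta> * X \<omega>) + cnj (D \<omega>) * iexp (\<theta> * X \<omega>)) / 2)"
      by (intro Bochner_Integration.integral_cong) (auto simp: complex_add_cnj simp flip: distrib_right)
    also have "\<dots> = 0"
      using int[of \<theta>] int'[of \<theta>] four[of \<theta>] four'[of \<theta>] by simp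
    finally show "(CLINT \<omega>|M. of_real (Re (D \<omega>)) * iexp (\<theta> * X \<omega>)) = 0" .
  qed auto
  have im: "(LINT \<omega>|M. Im (D \<omega>) * indicator S (X \<omega>)) = 0"
  proof (rule fourier_vanish_real)
    show "\<bar>Im (D \<omega>)\<bar> \<le> C" if "\<omega> \<in> space M" for \<omega>
      using bound[OF that] abs_Im_le_cmod[of "D \<omega>"] by simp
    fix \<theta>
    have "(CLINT \<omega>|M. of_real (Im (D \<omega>)) * iexp (\<theta> * X \<omega>))
        = (CLINT \<omega>|M. (D \<omega> * iexp (\<theta> * X \<omega>) - cnj (D \<omega>) * iexp (\<theta> * X \<omega>)) / (2 * \<i>))"
    proof (intro Bochner_Integration.integral_cong refl)
      have "z * w - cnj z * w = 2 * \<i> * (of_real (Im z) * w)" for z w :: complex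
        by (simp add: complex_eq_iff algebra_simps)
      then show "of_real (Im (D \<omega>)) * iexp (\<theta> * X \<omega>) = (D \<omega> * iexp (\<theta> * X \<omega>) - cnj (D \<omega>) * iexp (\<theta> * X \<omega>)) / (2 * \<i>)" for \<omega>
        by simp
    qed
    also have "\<dots> = 0"
      using int[of \<theta>] int'[of \<theta>] four[of \<theta>] four'[of \<theta>] by simp
    finally show "(CLINT \<omega>|M. of_real (Im (D \<omega>)) * iexp (\<theta> * X \<omega>)) = 0" .
  qed auto
  obtain \<omega>0 where "\<omega>0 \<in> space M"
    using not_empty by blast
  then have "0 \<le> C"
    using bound norm_ge_zero order_trans by blast
  have intS: "integrable M (\<lambda>\<omega>. D \<omega> * indicator S (X \<omega>))"
    by (rule integrable_const_bound[of _ C]) (use bound \<open>0 \<le> C\<close> in \<open>auto simp: norm_mult indicator_def\<close>)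
  have "Re (D \<omega> * indicator S (X \<omega>)) = Re (D \<omega>) * indicator S (X \<omega>)"
    "Im (D \<omega> * indicator S (X \<omega>)) = Im (D \<omega>) * indicator S (X \<omega>)" for \<omega>
    by (auto simp: indicator_def)
  with integral_Re[OF intS] integral_Im[OF intS] re im show ?thesis
    by (intro complex_eqI) (simp_all only: zero_complex.simps)
qed

lemma (in prob_space) centered_gaussian_moments:
  assumes "centered_gaussian M X"
  shows "X \<in> borel_measurable M" "integrable M (\<lambda>\<omega>. (X \<omega>)\<^sup>2)" "integrable M X"
    and "expectation X = 0"
    and "(CLINT \<omega>|M. iexp (X \<omega>)) = of_real (exp (- expectation (\<lambda>\<omega>. (X \<omega>)\<^sup>2) / 2))"
proof -
  from assms show X [measurable]: "X \<in> borel_measurable M"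
    by (simp add: centered_gaussian_def)
  from assms obtain \<sigma> where \<sigma>: "\<sigma> \<ge> 0" "distr M borel X =
        (if \<sigma> = 0 then return borel 0 else density lborel (\<lambda>x. ennreal (normal_density 0 \<sigma> x)))"
    by (auto simp: centered_gaussian_def)
  have "integrable M (\<lambda>\<omega>. (X \<omega>)\<^sup>2) \<and> integrable M X \<and> expectation X = 0 \<and>
     (CLINT \<omega>|M. iexp (X \<omega>)) = of_real (exp (- expectation (\<lambda>\<omega>. (X \<omega>)\<^sup>2) / 2))"
  proof (cases "\<sigma> = 0")
    case True
    have "AE x in return borel (0::real). x = 0"
      by (subst AE_return) auto
    moreover have "distr M borel X = return borel 0"
      using \<sigma> True by simp
    ultimately have "AE x in distr M borel X. x = 0"
      by (simp only:)
    then have ae: "AE \<omega> in M. X \<omega> = 0"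
      by (subst (asm) AE_distr_iff) auto
    have "integrable M X"
      by (subst integrable_cong_AE[where g="\<lambda>_. 0"]) (use ae in auto)
    moreover have "integrable M (\<lambda>\<omega>. (X \<omega>)\<^sup>2)"
      by (subst integrable_cong_AE[where g="\<lambda>_. 0"]) (use ae in auto)
    moreover have "expectation X = expectation (\<lambda>_. 0)" "expectation (\<lambda>\<omega>. (X \<omega>)\<^sup>2) = expectation (\<lambda>_. 0)"
      "(CLINT \<omega>|M. iexp (X \<omega>)) = (CLINT \<omega>|M. 1)"
      by (intro integral_cong_AE; use ae in auto)+
    ultimately show ?thesis by (simp add: prob_space)
  next
    case False
    with \<sigma> have s: "0 < \<sigma>" by simp
    have D: "distributed M lborel X (normal_density 0 \<sigma>)"
      using \<sigma> False X by (auto simp: distributed_def normal_density_nonneg cong: distr_cong)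
    have Z: "distributed M lborel (\<lambda>\<omega>. X \<omega> / \<sigma>) std_normal_density"
      using D normal_standard_normal_convert[OF s, of X 0] by simp
    have mean: "expectation X = 0"
      by (rule normal_distributed_expectation[OF s D])
    have var: "expectation (\<lambda>\<omega>. (X \<omega>)\<^sup>2) = \<sigma>\<^sup>2"
      using normal_distributed_variance[OF s D] mean by simp
    have i1: "integrable M X"
      using distributed_integrable[OF D, of "\<lambda>x. x"] integrable_normal_moment_nz_1[OF s, of 0]
      by (simp add: normal_density_nonneg)
    have i2: "integrable M (\<lambda>\<omega>. (X \<omega>)\<^sup>2)"
      using distributed_integrable[OF D, of "\<lambda>x. x\<^sup>2"] integrable_normal_moment[OF s, of 0 2]
      by (simp add: normal_density_nonneg)
    have dZ: "distr M borel (\<lambda>\<omega>. X \<omega> / \<sigma>) = std_normal_distribution"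
      using Z by (simp add: distributed_def cong: distr_cong)
    have "(CLINT \<omega>|M. iexp (X \<omega>)) = char std_normal_distribution \<sigma>"
      unfolding char_def using s by (simp add: integral_distr flip: dZ)
    then show ?thesis
      using mean var i1 i2 by (simp add: char_std_normal_distribution)
  qed
  then show "integrable M (\<lambda>\<omega>. (X \<omega>)\<^sup>2)" "integrable M X" "expectation X = 0"
    "(CLINT \<omega>|M. iexp (X \<omega>)) = of_real (exp (- expectation (\<lambda>\<omega>. (X \<omega>)\<^sup>2) / 2))"
    by blast+
qed

section \<open>The Gaussian space of the white noise\<close>
locale white_noise = prob_space M for M :: "'w measure" +
  fixes W :: "(real \<times> real) set \<Rightarrow> 'w \<Rightarrow> real"
  assumes noise: "space_time_white_noise M W"
begin

text \<open>The linear span of the noise of the sets that are contained in \<open>T\<close>.\<close>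
definition noise_span :: "(real \<times> real) set \<Rightarrow> ('w \<Rightarrow> real) set" where
  "noise_span T = {X. \<exists>\<A> c. finite \<A> \<and> \<A> \<subseteq> noise_sets \<and> (\<forall>A\<in>\<A>. A \<subseteq> T) \<and> X = (\<lambda>\<omega>. \<Sum>A\<in>\<A>. c A * W A \<omega>)}"

lemma noise_spanI:
  assumes "finite \<A>" "\<A> \<subseteq> noise_sets" "\<And>A. A \<in> \<A> \<Longrightarrow> A \<subseteq> T" "\<And>\<omega>. X \<omega> = (\<Sum>A\<in>\<A>. c A * W A \<omega>)"
  shows "X \<in> noise_span T"
  unfolding noise_span_def mem_Collect_eq
  by (rule exI[of _ \<A>], rule exI[of _ c]) (simp add: assms fun_eq_iff)

lemma noise_spanE:
  assumes "X \<in> noise_span T"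
  obtains \<A> c where "finite \<A>" "\<A> \<subseteq> noise_sets" "\<forall>A\<in>\<A>. A \<subseteq> T" "X = (\<lambda>\<omega>. \<Sum>A\<in>\<A>. c A * W A \<omega>)"
proof -
  from assms have "\<exists>\<A> c. finite \<A> \<and> \<A> \<subseteq> noise_sets \<and> (\<forall>A\<in>\<A>. A \<subseteq> T) \<and> X = (\<lambda>\<omega>. \<Sum>A\<in>\<A>. c A * W A \<omega>)"
    by (simp only: noise_span_def mem_Collect_eq)
  then show thesis
    by (elim exE conjE) (rule that)
qed

lemma noise_span_scale_base:
  assumes "A \<in> noise_sets" "A \<subseteq> T"
  shows "(\<lambda>\<omega>. c * W A \<omega>) \<in> noise_span T"
  by (rule noise_spanI[of "{A}" _ _ "\<lambda>_. c"]) (use assms in auto)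

lemma noise_span_base:
  assumes "A \<in> noise_sets" "A \<subseteq> T"
  shows "W A \<in> noise_span T"
  using noise_span_scale_base[OF assms, of 1] by simp

lemma noise_span_add:
  assumes "X \<in> noise_span T" "Y \<in> noise_span T"
  shows "(\<lambda>\<omega>. X \<omega> + Y \<omega>) \<in> noise_span T"
proof -
  obtain \<A> c where X: "finite \<A>" "\<A> \<subseteq> noise_sets" "\<forall>A\<in>\<A>. A \<subseteq> T" "X = (\<lambda>\<omega>. \<Sum>A\<in>\<A>. c A * W A \<omega>)"
    using assms(1) by (rule noise_spanE)
  obtain \<B> d where Y: "finite \<B>" "\<B> \<subseteq> noise_sets" "\<forall>A\<in>\<B>. A \<subseteq> T" "Y = (\<lambda>\<omega>. \<Sum>A\<in>\<B>. d A * W A \<omega>)"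
    using assms(2) by (rule noise_spanE)
  define e where "e A = (if A \<in> \<A> then c A else 0) + (if A \<in> \<B> then d A else 0)" for A
  have "X \<omega> + Y \<omega> = (\<Sum>A\<in>\<A>\<union>\<B>. e A * W A \<omega>)" for \<omega>
  proof -
    have "X \<omega> = (\<Sum>A\<in>\<A>\<union>\<B>. (if A \<in> \<A> then c A else 0) * W A \<omega>)"
      unfolding X(4) using X(1) Y(1) by (intro sum.mono_neutral_cong_left) auto
    moreover have "Y \<omega> = (\<Sum>A\<in>\<A>\<union>\<B>. (if A \<in> \<B> then d A else 0) * W A \<omega>)"
      unfolding Y(4) using X(1) Y(1) by (intro sum.mono_neutral_cong_left) auto
    ultimately show ?thesis
      by (simp add: e_def distrib_right sum.distrib)
  qed
  note sum = this
  show ?thesis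
    by (rule noise_spanI[of "\<A> \<union> \<B>" _ _ e]) (use X(1-3) Y(1-3) sum in auto)
qed

lemma noise_span_scale:
  assumes "X \<in> noise_span T"
  shows "(\<lambda>\<omega>. k * X \<omega>) \<in> noise_span T"
proof -
  obtain \<A> c where X: "finite \<A>" "\<A> \<subseteq> noise_sets" "\<forall>A\<in>\<A>. A \<subseteq> T" "X = (\<lambda>\<omega>. \<Sum>A\<in>\<A>. c A * W A \<omega>)"
    using assms by (rule noise_spanE)
  show ?thesis
    by (rule noise_spanI[of \<A> _ _ "\<lambda>A. k * c A"]) (use X in \<open>auto simp: sum_distrib_left mult.assoc\<close>)
qed

lemma noise_span_mono:
  assumes "T \<subseteq> T'" "X \<in> noise_span T"
  shows "X \<in> noise_span T'"
proof -
  obtain \<A> c where X: "finite \<A>" "\<A> \<subseteq> noise_sets" "\<forall>A\<in>\<A>. A \<subseteq> T" "X = (\<lambda>\<omega>. \<Sum>A\<in>\<A>. c A * W A \<omega>)"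
    using assms(2) by (rule noise_spanE)
  show ?thesis
    by (rule noise_spanI[OF X(1,2) _ fun_cong[OF X(4)]]) (use X(3) assms(1) in auto)
qed

lemma noise_span_gaussian:
  assumes "X \<in> noise_span T"
  shows "centered_gaussian M X"
proof -
  obtain \<A> c where X: "finite \<A>" "\<A> \<subseteq> noise_sets" "X = (\<lambda>\<omega>. \<Sum>A\<in>\<A>. c A * W A \<omega>)"
    using assms by (rule noise_spanE)
  then show ?thesis
    using conjunct1[OF noise[unfolded space_time_white_noise_def], rule_format, of \<A> c] by simp
qed

lemmas noise_span_moments = centered_gaussian_moments[OF noise_span_gaussian]

lemma measurable_W: "A \<in> noise_sets \<Longrightarrow> W A \<in> borel_measurable M"
  using noise_span_moments(1)[OF noise_span_base[of A UNIV]] by simp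

lemma integrable_W_sq: "A \<in> noise_sets \<Longrightarrow> integrable M (\<lambda>\<omega>. (W A \<omega>)\<^sup>2)"
  using noise_span_moments(2)[OF noise_span_base[of A UNIV]] by simp

lemma noise_cov:
  "A \<in> noise_sets \<Longrightarrow> B \<in> noise_sets \<Longrightarrow> expectation (\<lambda>\<omega>. W A \<omega> * W B \<omega>) = measure lborel (A \<inter> B)"
  using conjunct2[OF noise[unfolded space_time_white_noise_def]] by blast

end

lemma integrable_mult_sq:
  fixes f g :: "'a \<Rightarrow> real"
  assumes [measurable]: "f \<in> borel_measurable M" "g \<in> borel_measurable M"
    and "integrable M (\<lambda>x. (f x)\<^sup>2)" "integrable M (\<lambda>x. (g x)\<^sup>2)"
  shows "integrable M (\<lambda>x. f x * g x)"
proof (rule Bochner_Integration.integrable_bound)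
  show "integrable M (\<lambda>x. (f x)\<^sup>2 + (g x)\<^sup>2)"
    using assms by simp
  have "\<bar>a * b\<bar> \<le> \<bar>a\<^sup>2 + b\<^sup>2\<bar>" for a b :: real
  proof -
    have "2 * (\<bar>a\<bar> * \<bar>b\<bar>) \<le> a\<^sup>2 + b\<^sup>2"
      using sum_squares_bound[of "\<bar>a\<bar>" "\<bar>b\<bar>"] by (simp add: mult.assoc)
    moreover have "0 \<le> \<bar>a\<bar> * \<bar>b\<bar>" by simp
    ultimately show ?thesis unfolding abs_mult by linarith
  qed
  then show "AE x in M. norm (f x * g x) \<le> norm ((f x)\<^sup>2 + (g x)\<^sup>2)"
    by simp
qed measurable

context white_noise
begin

lemma noise_span_integrable_mult:
  "X \<in> noise_span T \<Longrightarrow> Y \<in> noise_span T' \<Longrightarrow> integrable M (\<lambda>\<omega>. X \<omega> * Y \<omega>)"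
  by (intro integrable_mult_sq noise_span_moments)

lemma noise_span_orthogonal:
  assumes X: "X \<in> noise_span T" and Y: "Y \<in> noise_span T'" and "T \<inter> T' = {}"
  shows "expectation (\<lambda>\<omega>. X \<omega> * Y \<omega>) = 0"
proof -
  obtain \<A> c where X: "finite \<A>" "\<A> \<subseteq> noise_sets" "\<forall>A\<in>\<A>. A \<subseteq> T" "X = (\<lambda>\<omega>. \<Sum>A\<in>\<A>. c A * W A \<omega>)"
    using assms(1) by (rule noise_spanE)
  obtain \<B> d where Y: "finite \<B>" "\<B> \<subseteq> noise_sets" "\<forall>A\<in>\<B>. A \<subseteq> T'" "Y = (\<lambda>\<omega>. \<Sum>A\<in>\<B>. d A * W A \<omega>)"
    using assms(2) by (rule noise_spanE)
  have int: "integrable M (\<lambda>\<omega>. W A \<omega> * W B \<omega>)" if "A \<in> \<A>" "B \<in> \<B>" for A B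
    using that X Y by (intro noise_span_integrable_mult[of _ UNIV _ UNIV] noise_span_base) auto
  have cov: "expectation (\<lambda>\<omega>. W A \<omega> * W B \<omega>) = 0" if "A \<in> \<A>" "B \<in> \<B>" for A B
  proof -
    have "A \<inter> B = {}" using that X Y assms(3) by blast
    with that X Y show ?thesis by (subst noise_cov) auto
  qed
  have "expectation (\<lambda>\<omega>. X \<omega> * Y \<omega>) = expectation (\<lambda>\<omega>. \<Sum>A\<in>\<A>. \<Sum>B\<in>\<B>. (c A * d B) * (W A \<omega> * W B \<omega>))"
    unfolding X(4) Y(4) by (intro Bochner_Integration.integral_cong) (auto simp: sum_product mult_ac)
  also have "\<dots> = (\<Sum>A\<in>\<A>. \<Sum>B\<in>\<B>. (c A * d B) * expectation (\<lambda>\<omega>. W A \<omega> * W B \<omega>))"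
    using int by (simp add: Bochner_Integration.integral_sum)
  also have "\<dots> = 0"
    using cov by simp
  finally show ?thesis .
qed

lemma noise_span_char_add:
  assumes X: "X \<in> noise_span T" and Y: "Y \<in> noise_span T'" and "T \<inter> T' = {}"
  shows "(CLINT \<omega>|M. iexp (X \<omega> + Y \<omega>)) = (CLINT \<omega>|M. iexp (X \<omega>)) * (CLINT \<omega>|M. iexp (Y \<omega>))"
proof -
  have XY: "(\<lambda>\<omega>. X \<omega> + Y \<omega>) \<in> noise_span UNIV"
    using X Y by (intro noise_span_add noise_span_mono[of _ UNIV]) auto
  have "expectation (\<lambda>\<omega>. (X \<omega> + Y \<omega>)\<^sup>2) = expectation (\<lambda>\<omega>. (X \<omega>)\<^sup>2 + (Y \<omega>)\<^sup>2 + 2 * (X \<omega> * Y \<omega>))"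
    by (simp add: power2_sum mult.assoc)
  also have "\<dots> = expectation (\<lambda>\<omega>. (X \<omega>)\<^sup>2) + expectation (\<lambda>\<omega>. (Y \<omega>)\<^sup>2)"
    using noise_span_moments(2)[OF X] noise_span_moments(2)[OF Y] noise_span_integrable_mult[OF X Y]
      noise_span_orthogonal[OF assms] by simp
  finally have "expectation (\<lambda>\<omega>. (X \<omega> + Y \<omega>)\<^sup>2) = expectation (\<lambda>\<omega>. (X \<omega>)\<^sup>2) + expectation (\<lambda>\<omega>. (Y \<omega>)\<^sup>2)" .
  then show ?thesis
    unfolding noise_span_moments(5)[OF XY] noise_span_moments(5)[OF X] noise_span_moments(5)[OF Y]
    by (simp only: of_real_mult[symmetric] exp_add[symmetric] minus_add_distrib add_divide_distrib)
qed

section \<open>Independence of past and future\<close>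

text \<open>
  The generators of the sigma-algebra of \<open>T\<close>, null sets included; for \<open>T = {0..t} \<times> UNIV\<close> they generate
  \<^const>\<open>noise_events\<close>.
\<close>
definition noise_gens :: "(real \<times> real) set \<Rightarrow> 'w set set" where
  "noise_gens T = {W B -` S \<inter> space M | B S. B \<in> noise_sets \<and> B \<subseteq> T \<and> S \<in> sets borel} \<union> null_sets M"

lemma noise_gens_events: "noise_gens T \<subseteq> events"
  by (auto simp: noise_gens_def intro!: measurable_sets measurable_W)

text \<open>
  Induction on the number of generators, for all \<open>L\<close> at once.  Without generators this is the
  factorization of characteristic functions.  For one more generator \<open>{W B \<in> S}\<close> the induction
  hypothesis, with \<open>L\<close> replaced by \<open>L + \<theta> * W B\<close>, says that a Fourier transform vanishes identically
  in \<open>\<theta>\<close>, and \<open>fourier_vanish\<close> replaces the exponential by the indicator of \<open>S\<close>.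
\<close>
lemma fourier_noise_gens:
  assumes V: "V \<in> noise_span T" and T: "T \<inter> T' = {}"
    and "finite \<G>" "\<G> \<subseteq> noise_gens T'" and L: "L \<in> noise_span T'"
  shows "(CLINT \<omega>|M. (iexp (V \<omega>) - (CLINT \<omega>|M. iexp (V \<omega>))) * indicator (space M \<inter> \<Inter>\<G>) \<omega> * iexp (L \<omega>)) = 0"
  using assms(3,4) L
proof (induction \<G> arbitrary: L)
  case empty
  note [measurable] = noise_span_moments(1)[OF V] noise_span_moments(1)[OF empty(2)]
  let ?m = "CLINT \<omega>|M. iexp (V \<omega>)"
  have "(CLINT \<omega>|M. (iexp (V \<omega>) - ?m) * indicator (space M \<inter> \<Inter>{}) \<omega> * iexp (L \<omega>))
     = (CLINT \<omega>|M. iexp (V \<omega> + L \<omega>) - ?m * iexp (L \<omega>))"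
    by (intro Bochner_Integration.integral_cong) (auto simp: algebra_simps exp_add)
  also have "\<dots> = (CLINT \<omega>|M. iexp (V \<omega> + L \<omega>)) - ?m * (CLINT \<omega>|M. iexp (L \<omega>))"
  proof -
    have "integrable M (\<lambda>\<omega>. iexp (V \<omega> + L \<omega>))" "integrable M (\<lambda>\<omega>. iexp (L \<omega>))"
      by (rule integrable_const_bound[of _ 1]; simp del: of_real_add)+
    then show ?thesis
      by (subst Bochner_Integration.integral_diff) (simp_all del: of_real_add)
  qed
  also have "\<dots> = 0"
    by (simp only: noise_span_char_add[OF V empty(2) T]) simp
  finally show ?case .
next
  case (insert G \<G>)
  note [measurable] = noise_span_moments(1)[OF V] noise_span_moments(1)[OF insert.prems(2)]
  have "\<And>G. G \<in> \<G> \<Longrightarrow> G \<in> events"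
    using insert.prems noise_gens_events by auto
  then have [measurable]: "space M \<inter> \<Inter>\<G> \<in> events"
    using \<open>finite \<G>\<close> by (cases "\<G> = {}") (auto intro!: sets.Int sets.finite_INT[where A="\<lambda>x. x", simplified])
  let ?m = "CLINT \<omega>|M. iexp (V \<omega>)"
  define D where "D \<omega> = (iexp (V \<omega>) - ?m) * indicator (space M \<inter> \<Inter>\<G>) \<omega> * iexp (L \<omega>)" for \<omega>
  have [measurable]: "D \<in> borel_measurable M"
    unfolding D_def[abs_def] by measurable
  have D_eq: "(CLINT \<omega>|M. (iexp (V \<omega>) - ?m) * indicator (space M \<inter> \<Inter>(insert G \<G>)) \<omega> * iexp (L \<omega>))
     = (CLINT \<omega>|M. D \<omega> * indicator G \<omega>)"
    by (intro Bochner_Integration.integral_cong) (auto simp: D_def indicator_def)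
  from insert.prems consider (noise) B S where "B \<in> noise_sets" "B \<subseteq> T'" "S \<in> sets borel" "G = W B -` S \<inter> space M"
    | (null) "G \<in> null_sets M"
    by (auto simp: noise_gens_def)
  then show ?case
  proof cases
    case noise
    note [measurable] = measurable_W[OF noise(1)]
    have "(CLINT \<omega>|M. D \<omega> * indicator S (W B \<omega>)) = 0"
    proof (rule fourier_vanish)
      show "cmod (D \<omega>) \<le> 1 + cmod ?m" for \<omega>
      proof -
        have "cmod (D \<omega>) \<le> cmod (iexp (V \<omega>) - ?m)"
          by (auto simp: D_def norm_mult indicator_def)
        also have "\<dots> \<le> 1 + cmod ?m"
          using norm_triangle_ineq4[of "iexp (V \<omega>)" ?m] by simp
        finally show ?thesis .
      qed
      fix \<theta>
      have "(\<lambda>\<omega>. L \<omega> + \<theta> * W B \<omega>) \<in> noise_span T'"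
        using insert.prems noise by (intro noise_span_add noise_span_scale_base)
      from insert.IH[OF _ this] insert.prems
      show "(CLINT \<omega>|M. D \<omega> * iexp (\<theta> * W B \<omega>)) = 0"
        by (simp add: D_def exp_add distrib_left mult.assoc)
    qed (use noise in auto)
    also have "(CLINT \<omega>|M. D \<omega> * indicator S (W B \<omega>)) = (CLINT \<omega>|M. D \<omega> * indicator G \<omega>)"
      using noise by (intro Bochner_Integration.integral_cong) (auto simp: indicator_def)
    finally show ?thesis by (simp only: D_eq)
  next
    case null
    then have "AE \<omega> in M. \<omega> \<notin> G" by (rule AE_not_in)
    then have "(CLINT \<omega>|M. D \<omega> * indicator G \<omega>) = (CLINT \<omega>|M. 0)"
      using null by (intro integral_cong_AE) (auto simp: null_sets_def)
    then show ?thesis by (simp only: D_eq) simp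
  qed
qed

text \<open>
  The finite intersections of generators form a pi-system, to which the preceding lemma applies with
  \<open>L = 0\<close>; one more use of uniqueness replaces the exponential of \<open>V\<close> by an indicator as well.
\<close>
lemma indep_noise_gens:
  assumes V: "V \<in> noise_span T" and T: "T \<inter> T' = {}"
  shows "indep_set (sigma_sets (space M) (noise_gens T')) (sigma_sets (space M) {V -` S \<inter> space M |S. S \<in> sets borel})"
proof -
  note [measurable] = noise_span_moments(1)[OF V]
  let ?P = "{space M \<inter> \<Inter>\<G> |\<G>. finite \<G> \<and> \<G> \<subseteq> noise_gens T'}"
  let ?V = "{V -` S \<inter> space M |S. S \<in> sets borel}"
  have P_events: "?P \<subseteq> events"
  proof safe
    fix \<G> assume "finite \<G>" "\<G> \<subseteq> noise_gens T'"
    then show "space M \<inter> \<Inter>\<G> \<in> events"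
      using noise_gens_events[of T']
      by (cases "\<G> = {}") (auto intro!: sets.Int sets.finite_INT[where A="\<lambda>x. x", simplified])
  qed
  have "indep_set ?P ?V"
  proof (rule indep_setI[OF P_events])
    show "?V \<subseteq> events" by auto
    fix G E assume "G \<in> ?P" "E \<in> ?V"
    then obtain \<G> S where G: "G = space M \<inter> \<Inter>\<G>" "finite \<G>" "\<G> \<subseteq> noise_gens T'"
      and E: "E = V -` S \<inter> space M" and [measurable]: "S \<in> sets borel"
      by auto
    have [measurable]: "G \<in> events" using \<open>G \<in> ?P\<close> P_events by blast
    have "(LINT \<omega>|M. (indicator G \<omega> - prob G) * indicator S (V \<omega>)) = 0"
    proof (rule fourier_vanish_real)
      show "\<bar>indicator G \<omega> - prob G\<bar> \<le> 1" for \<omega>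
        by (auto simp: indicator_def)
      fix \<theta>
      define m where "m = (CLINT \<omega>|M. iexp (\<theta> * V \<omega>))"
      have V': "(\<lambda>\<omega>. \<theta> * V \<omega>) \<in> noise_span T"
        by (rule noise_span_scale[OF V])
      have L: "(\<lambda>\<omega>. 0) \<in> noise_span T'"
        by (rule noise_spanI[of "{}"]) auto
      have iG: "integrable M (\<lambda>\<omega>. indicator G \<omega> :: complex)"
        by (rule integrable_const_bound[of _ 1]) (auto simp: indicator_def)
      have iVG: "integrable M (\<lambda>\<omega>. indicator G \<omega> * iexp (\<theta> * V \<omega>))"
        by (rule integrable_const_bound[of _ 1]) (auto simp: indicator_def norm_mult)
      have iV: "integrable M (\<lambda>\<omega>. iexp (\<theta> * V \<omega>))"
        by (rule integrable_const_bound[of _ 1]) auto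
      have Gm: "(CLINT \<omega>|M. indicator G \<omega>) = complex_of_real (prob G)"
      proof -
        have "(CLINT \<omega>|M. indicator G \<omega>) = (CLINT \<omega>|M. complex_of_real (indicator G \<omega>))"
          by (intro Bochner_Integration.integral_cong) (auto simp: indicator_def)
        also have "\<dots> = complex_of_real (LINT \<omega>|M. indicator G \<omega>)"
          by (rule integral_complex_of_real)
        also have "(LINT \<omega>|M. indicator G \<omega>) = prob G"
          by simp
        finally show ?thesis .
      qed
      have "0 = (CLINT \<omega>|M. (iexp (\<theta> * V \<omega>) - m) * indicator G \<omega> * iexp 0)"
        unfolding m_def G(1) by (rule fourier_noise_gens[OF V' T G(2,3) L, symmetric])
      also have "\<dots> = (CLINT \<omega>|M. indicator G \<omega> * iexp (\<theta> * V \<omega>) - m * indicator G \<omega>)"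
        by (intro Bochner_Integration.integral_cong) (auto simp: algebra_simps)
      also have "\<dots> = (CLINT \<omega>|M. indicator G \<omega> * iexp (\<theta> * V \<omega>)) - m * of_real (prob G)"
        using iG iVG by (subst Bochner_Integration.integral_diff) (auto simp: Gm)
      finally have *: "(CLINT \<omega>|M. indicator G \<omega> * iexp (\<theta> * V \<omega>)) = of_real (prob G) * m"
        by simp
      have "(CLINT \<omega>|M. of_real (indicator G \<omega> - prob G) * iexp (\<theta> * V \<omega>))
        = (CLINT \<omega>|M. indicator G \<omega> * iexp (\<theta> * V \<omega>) - of_real (prob G) * iexp (\<theta> * V \<omega>))"
        by (intro Bochner_Integration.integral_cong) (auto simp: indicator_def left_diff_distrib)
      also have "\<dots> = (CLINT \<omega>|M. indicator G \<omega> * iexp (\<theta> * V \<omega>)) - of_real (prob G) * m"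
        unfolding m_def using iV iVG by (subst Bochner_Integration.integral_diff) auto
      finally show "(CLINT \<omega>|M. of_real (indicator G \<omega> - prob G) * iexp (\<theta> * V \<omega>)) = 0"
        unfolding * by simp
    qed auto
    also have "(LINT \<omega>|M. (indicator G \<omega> - prob G) * indicator S (V \<omega>)) = (LINT \<omega>|M. indicator (G \<inter> E) \<omega> - prob G * indicator E \<omega>)"
      using E by (intro Bochner_Integration.integral_cong) (auto simp: indicator_def)
    also have "\<dots> = prob (G \<inter> E) - prob G * prob E"
      using E by (subst Bochner_Integration.integral_diff) (auto simp: less_top[symmetric])
    finally show "prob (G \<inter> E) = prob G * prob E" by simp
  qed
  moreover have "Int_stable ?P"
  proof (rule Int_stableI, safe)
    fix \<G> \<H> assume "finite \<G>" "\<G> \<subseteq> noise_gens T'" "finite \<H>" "\<H> \<subseteq> noise_gens T'"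
    then show "\<exists>\<F>. space M \<inter> \<Inter>\<G> \<inter> (space M \<inter> \<Inter>\<H>) = space M \<inter> \<Inter>\<F> \<and> finite \<F> \<and> \<F> \<subseteq> noise_gens T'"
      by (intro exI[of _ "\<G> \<union> \<H>"]) auto
  qed
  moreover have "Int_stable ?V"
  proof (rule Int_stableI, safe)
    fix S S' :: "real set" assume "S \<in> sets borel" "S' \<in> sets borel"
    then show "\<exists>R. V -` S \<inter> space M \<inter> (V -` S' \<inter> space M) = V -` R \<inter> space M \<and> R \<in> sets borel"
      by (intro exI[of _ "S \<inter> S'"]) auto
  qed
  ultimately have *: "indep_set (sigma_sets (space M) ?P) (sigma_sets (space M) ?V)"
    by (rule indep_set_sigma_sets)
  have sub: "sigma_sets (space M) (noise_gens T') \<subseteq> sigma_sets (space M) ?P"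
  proof (rule sigma_sets_mono, rule subsetI)
    fix G assume G: "G \<in> noise_gens T'"
    then have "G \<subseteq> space M" using noise_gens_events sets.sets_into_space by blast
    then have "G = space M \<inter> \<Inter>{G}" by auto
    with G have "G \<in> ?P" by (intro CollectI exI[of _ "{G}"]) auto
    then show "G \<in> sigma_sets (space M) ?P" ..
  qed
  show ?thesis
    using * sub unfolding indep_sets2_eq by blast
qed

lemma noise_events_eq: "noise_events M W t = sigma_sets (space M) (noise_gens ({0..t} \<times> UNIV))"
  by (simp add: noise_events_def noise_gens_def)

lemma noise_events_subset: "noise_events M W t \<subseteq> events"
  unfolding noise_events_eq by (intro sets.sigma_sets_subset noise_gens_events)

lemma space_noise_filtration [simp]: "space (noise_filtration M W t) = space M"
  by (simp add: noise_filtration_def space_measure_of_conv)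

text \<open>An intersection of sigma-algebras is one, so \<^const>\<open>sigma\<close> adds no sets to it.\<close>
lemma sets_noise_filtration: "sets (noise_filtration M W t) = (\<Inter>s\<in>{t<..}. noise_events M W s)"
proof -
  have sub: "(\<Inter>s\<in>{t<..}. noise_events M W s) \<subseteq> Pow (space M)"
  proof -
    have "noise_events M W (t + 1) \<subseteq> Pow (space M)"
      using noise_events_subset sets.space_closed by blast
    then show ?thesis by (intro INF_lower2[of "t + 1"]) auto
  qed
  have "sigma_sets (space M) (\<Inter>s\<in>{t<..}. noise_events M W s) \<subseteq> noise_events M W s" if "t < s" for s
  proof -
    have "sigma_sets (space M) (\<Inter>s\<in>{t<..}. noise_events M W s) \<subseteq> sigma_sets (space M) (noise_events M W s)"
      using that by (intro sigma_sets_mono') auto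
    also have "\<dots> = noise_events M W s"
      unfolding noise_events_eq using noise_gens_events sets.space_closed
      by (intro sigma_sets_sigma_sets_eq) blast
    finally show ?thesis .
  qed
  then have "sigma_sets (space M) (\<Inter>s\<in>{t<..}. noise_events M W s) = (\<Inter>s\<in>{t<..}. noise_events M W s)"
    by (intro equalityI INF_greatest sigma_sets_superset_generator) auto
  then show ?thesis
    using sub by (simp add: noise_filtration_def)
qed

lemma noise_filtration_measurable:
  fixes Y :: "'w \<Rightarrow> real"
  assumes "Y \<in> borel_measurable (noise_filtration M W t)"
  shows "Y \<in> borel_measurable M"
proof (rule measurableI)
  fix S :: "real set" assume "S \<in> sets borel"
  from measurable_sets[OF assms this] have "Y -` S \<inter> space M \<in> noise_events M W (t + 1)"
    by (auto simp: sets_noise_filtration)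
  then show "Y -` S \<inter> space M \<in> events"
    using noise_events_subset by blast
qed auto

lemma noise_filtration_mono:
  fixes Y :: "'w \<Rightarrow> real"
  assumes "Y \<in> borel_measurable (noise_filtration M W t)" "t \<le> t'"
  shows "Y \<in> borel_measurable (noise_filtration M W t')"
proof (rule measurableI)
  fix S :: "real set" assume "S \<in> sets borel"
  from measurable_sets[OF assms(1) this] show "Y -` S \<inter> space (noise_filtration M W t') \<in> sets (noise_filtration M W t')"
    using assms(2) by (auto simp: sets_noise_filtration)
qed auto

lemma W_noise_filtration:
  assumes "B \<in> noise_sets" "B \<subseteq> {0..t} \<times> UNIV"
  shows "W B \<in> borel_measurable (noise_filtration M W t)"
proof (rule measurableI)
  fix S :: "real set" assume S: "S \<in> sets borel"
  have "W B -` S \<inter> space M \<in> noise_events M W s" if "t < s" for s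
  proof -
    have "B \<subseteq> {0..s} \<times> UNIV" using assms that by fastforce
    then have "W B -` S \<inter> space M \<in> noise_gens ({0..s} \<times> UNIV)"
      using assms S by (auto simp: noise_gens_def)
    then show ?thesis unfolding noise_events_eq by (rule sigma_sets.Basic)
  qed
  then show "W B -` S \<inter> space (noise_filtration M W t) \<in> sets (noise_filtration M W t)"
    by (auto simp: sets_noise_filtration)
qed auto

text \<open>
  By the covariance formula the squared \<open>L\<^sup>2\<close>-distance is the measure of the strip that is cut off,
  which shrinks to the empty set since \<open>A\<close> lies after time \<open>t\<close>.
\<close>
lemma W_truncate_tendsto:
  assumes A: "A \<in> noise_sets" "A \<subseteq> {t<..} \<times> UNIV"
  shows "(\<lambda>n. expectation (\<lambda>\<omega>. \<bar>W (A \<inter> {t + 1 / Suc n<..} \<times> UNIV) \<omega> - W A \<omega>\<bar>)) \<longlonglongrightarrow> 0"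
proof -
  define A' where "A' n = A \<inter> {t + 1 / Suc n<..} \<times> UNIV" for n
  have fin: "emeasure lborel A < \<infinity>" and [measurable]: "A \<in> sets borel"
    using A by (auto simp: noise_sets_def)
  have [measurable]: "A' n \<in> sets borel" for n
    unfolding A'_def by (intro sets.Int borel_Times) auto
  have A': "A' n \<in> noise_sets" for n
  proof -
    have "emeasure lborel (A' n) \<le> emeasure lborel A"
      by (rule emeasure_mono) (auto simp: A'_def)
    then have "emeasure lborel (A' n) < \<infinity>" using fin by (rule le_less_trans)
    moreover have "A' n \<subseteq> A" by (auto simp: A'_def)
    ultimately show ?thesis using A by (auto simp: noise_sets_def)
  qed
  have meas: "(\<lambda>n. measure lborel (A' n)) \<longlonglongrightarrow> measure lborel A"
  proof -
    have "(\<lambda>n. measure lborel (A' n)) \<longlonglongrightarrow> measure lborel (\<Union>n. A' n)"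
    proof (rule Lim_measure_incseq)
      show "range A' \<subseteq> sets lborel" by auto
      show "incseq A'"
      proof (intro incseq_SucI)
        fix n
        have "1 / (1 + real (Suc n)) \<le> 1 / (1 + real n)" by (intro divide_left_mono) auto
        then show "A' n \<le> A' (Suc n)" by (auto simp: A'_def)
      qed
      have "emeasure lborel (\<Union>n. A' n) \<le> emeasure lborel A"
        by (rule emeasure_mono) (auto simp: A'_def)
      with fin show "emeasure lborel (\<Union>n. A' n) \<noteq> \<infinity>" by auto
    qed
    also have "(\<Union>n. A' n) = A"
    proof (intro equalityI subsetI)
      fix p assume p: "p \<in> A"
      then have "0 < fst p - t" using A by force
      then obtain n where "inverse (real (Suc n)) < fst p - t"
        using reals_Archimedean by blast
      with p show "p \<in> (\<Union>n. A' n)"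
        by (cases p) (auto simp: A'_def inverse_eq_divide intro!: exI[of _ n])
    qed (auto simp: A'_def)
    finally show ?thesis .
  qed
  note [measurable] = measurable_W[OF A(1)] measurable_W[OF A']
  have sq: "expectation (\<lambda>\<omega>. (W (A' n) \<omega> - W A \<omega>)\<^sup>2) = measure lborel A - measure lborel (A' n)" for n
  proof -
    have "expectation (\<lambda>\<omega>. (W (A' n) \<omega> - W A \<omega>)\<^sup>2)
      = expectation (\<lambda>\<omega>. W (A' n) \<omega> * W (A' n) \<omega> + W A \<omega> * W A \<omega> - 2 * (W (A' n) \<omega> * W A \<omega>))"
      by (simp add: power2_eq_square algebra_simps)
    also have "\<dots> = measure lborel (A' n) + measure lborel A - 2 * measure lborel (A' n \<inter> A)"
      using A' A noise_span_integrable_mult[OF noise_span_base[of _ UNIV] noise_span_base[of _ UNIV]]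
      by (simp add: noise_cov)
    also have "A' n \<inter> A = A' n" by (auto simp: A'_def)
    finally show ?thesis by simp
  qed
  have int: "integrable M (\<lambda>\<omega>. W (A' n) \<omega> - W A \<omega>)" "integrable M (\<lambda>\<omega>. (W (A' n) \<omega> - W A \<omega>)\<^sup>2)" for n
  proof -
    have "(\<lambda>\<omega>. W (A' n) \<omega> + (-1) * W A \<omega>) \<in> noise_span UNIV"
      using A A' by (intro noise_span_add noise_span_scale_base noise_span_base) auto
    from noise_span_moments(2,3)[OF this]
    show "integrable M (\<lambda>\<omega>. W (A' n) \<omega> - W A \<omega>)" "integrable M (\<lambda>\<omega>. (W (A' n) \<omega> - W A \<omega>)\<^sup>2)"
      by simp_all
  qed
  have le: "(expectation (\<lambda>\<omega>. \<bar>W (A' n) \<omega> - W A \<omega>\<bar>))\<^sup>2 \<le> measure lborel A - measure lborel (A' n)" for n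
  proof -
    have "0 \<le> variance (\<lambda>\<omega>. \<bar>W (A' n) \<omega> - W A \<omega>\<bar>)"
      by (intro integral_nonneg_AE) auto
    also have "\<dots> = expectation (\<lambda>\<omega>. (W (A' n) \<omega> - W A \<omega>)\<^sup>2) - (expectation (\<lambda>\<omega>. \<bar>W (A' n) \<omega> - W A \<omega>\<bar>))\<^sup>2"
      using int by (subst variance_eq) auto
    finally show ?thesis using sq by simp
  qed
  have "(\<lambda>n. (expectation (\<lambda>\<omega>. \<bar>W (A' n) \<omega> - W A \<omega>\<bar>))\<^sup>2) \<longlonglongrightarrow> 0"
  proof (rule tendsto_sandwich[OF _ _ tendsto_const])
    show "(\<lambda>n. measure lborel A - measure lborel (A' n)) \<longlonglongrightarrow> 0"
      using tendsto_diff[OF tendsto_const meas, of "measure lborel A"] by simp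
  qed (use le in auto)
  from tendsto_real_sqrt[OF this]
  have "(\<lambda>n. expectation (\<lambda>\<omega>. \<bar>W (A' n) \<omega> - W A \<omega>\<bar>)) \<longlonglongrightarrow> 0"
    by (simp add: integral_nonneg_AE)
  then show ?thesis by (simp add: A'_def)
qed

end

lemma iexp_lipschitz: "cmod (iexp a - iexp b) \<le> \<bar>a - b\<bar>"
proof -
  have "iexp a = iexp b * iexp (a - b)"
    by (simp add: algebra_simps flip: exp_add)
  then have "iexp a - iexp b = iexp b * (iexp (a - b) - 1)"
    by (simp add: right_diff_distrib)
  then have "cmod (iexp a - iexp b) = cmod (iexp (a - b) - 1)"
    by (simp add: norm_mult)
  also have "\<dots> \<le> \<bar>a - b\<bar>"
    using iexp_approx1[of "a - b" 0] by simp
  finally show ?thesis .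
qed

lemma (in prob_space) indep_varI_sub_algebra:
  fixes X Y :: "'a \<Rightarrow> real"
  assumes Y: "Y \<in> borel_measurable N" and N: "space N = space M" "sets N \<subseteq> events"
    and X [measurable]: "X \<in> borel_measurable M"
    and ind: "indep_set (sets N) (sigma_sets (space M) {X -` S \<inter> space M |S. S \<in> sets borel})"
  shows "indep_var borel Y borel X"
proof -
  have "Y \<in> borel_measurable M"
    using measurable_sets[OF Y] N by (intro measurableI) auto
  moreover have "sigma_sets (space M) {Y -` S \<inter> space M |S. S \<in> sets borel} \<subseteq> sets N"
    unfolding N(1)[symmetric] by (rule sets.sigma_sets_subset) (use measurable_sets[OF Y] in auto)
  ultimately show ?thesis
    using ind X unfolding indep_var_eq indep_sets2_eq by blast
qed

context white_noise
begin

text \<open>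
  An event of the filtration at \<open>t\<close> is known to be independent only of the noise after some time
  \<open>s > t\<close>.  This approximation carries the independence over to the noise after \<open>t\<close>.
\<close>
lemma noise_span_truncate:
  assumes "X \<in> noise_span ({t<..} \<times> UNIV)"
  obtains Xn where "\<forall>n::nat. Xn n \<in> noise_span ({t + 1 / Suc n<..} \<times> UNIV)"
    and "(\<lambda>n. expectation (\<lambda>\<omega>. \<bar>Xn n \<omega> - X \<omega>\<bar>)) \<longlonglongrightarrow> 0"
proof -
  let ?T = "\<lambda>n::nat. {t + 1 / Suc n<..} \<times> (UNIV :: real set)"
  obtain \<A> c where A: "finite \<A>" "\<A> \<subseteq> noise_sets" "\<forall>A\<in>\<A>. A \<subseteq> {t<..} \<times> UNIV" and X: "X = (\<lambda>\<omega>. \<Sum>A\<in>\<A>. c A * W A \<omega>)"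
    using assms by (rule noise_spanE)
  have "\<exists>Xn. (\<forall>n. Xn n \<in> noise_span (?T n)) \<and> (\<lambda>n. expectation (\<lambda>\<omega>. \<bar>Xn n \<omega> - (\<Sum>A\<in>\<A>. c A * W A \<omega>)\<bar>)) \<longlonglongrightarrow> 0"
    using A
  proof (induction \<A> rule: finite_induct)
    case empty
    have "(\<lambda>\<omega>. 0) \<in> noise_span (?T n)" for n
      by (rule noise_spanI[of "{}"]) auto
    then show ?case
      by (intro exI[of _ "\<lambda>n \<omega>. 0"]) auto
  next
    case (insert A \<A>)
    then obtain Xn where Xn: "\<And>n. Xn n \<in> noise_span (?T n)"
      and lim: "(\<lambda>n. expectation (\<lambda>\<omega>. \<bar>Xn n \<omega> - (\<Sum>A\<in>\<A>. c A * W A \<omega>)\<bar>)) \<longlonglongrightarrow> 0"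
      by auto
    let ?A = "\<lambda>n. A \<inter> ?T n"
    have A: "A \<in> noise_sets" "A \<subseteq> {t<..} \<times> UNIV"
      using insert.prems by auto
    have An: "?A n \<in> noise_sets" for n
    proof -
      have "emeasure lborel (?A n) \<le> emeasure lborel A"
        using A by (intro emeasure_mono) (auto simp: noise_sets_def)
      then have "emeasure lborel (?A n) < \<infinity>"
        using A by (auto simp: noise_sets_def intro: le_less_trans)
      moreover have "?A n \<in> sets borel"
        using A by (intro sets.Int borel_Times) (auto simp: noise_sets_def)
      ultimately show ?thesis using A by (auto simp: noise_sets_def)
    qed
    define Y where "Y n \<omega> = c A * W (?A n) \<omega> + Xn n \<omega>" for n \<omega>
    have Y: "Y n \<in> noise_span (?T n)" for n
      unfolding Y_def[abs_def] using An Xn by (intro noise_span_add noise_span_scale_base) auto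
    have S: "(\<lambda>\<omega>. \<Sum>A\<in>\<A>. c A * W A \<omega>) \<in> noise_span UNIV"
      by (rule noise_spanI[of \<A> _ _ c]) (use insert.prems insert.hyps in auto)
    have i1: "integrable M (\<lambda>\<omega>. \<bar>W (?A n) \<omega> - W A \<omega>\<bar>)" for n
      using noise_span_moments(3)[OF noise_span_base[OF An]] noise_span_moments(3)[OF noise_span_base[OF A(1)]]
      by (intro integrable_abs Bochner_Integration.integrable_diff) auto
    have i2: "integrable M (\<lambda>\<omega>. \<bar>Xn n \<omega> - (\<Sum>A\<in>\<A>. c A * W A \<omega>)\<bar>)" for n
      by (intro integrable_abs Bochner_Integration.integrable_diff noise_span_moments(3)[OF Xn] noise_span_moments(3)[OF S])
    have bound: "expectation (\<lambda>\<omega>. \<bar>Y n \<omega> - (\<Sum>A\<in>insert A \<A>. c A * W A \<omega>)\<bar>)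
       \<le> \<bar>c A\<bar> * expectation (\<lambda>\<omega>. \<bar>W (?A n) \<omega> - W A \<omega>\<bar>) + expectation (\<lambda>\<omega>. \<bar>Xn n \<omega> - (\<Sum>A\<in>\<A>. c A * W A \<omega>)\<bar>)" for n
    proof -
      have "expectation (\<lambda>\<omega>. \<bar>Y n \<omega> - (\<Sum>A\<in>insert A \<A>. c A * W A \<omega>)\<bar>)
        \<le> expectation (\<lambda>\<omega>. \<bar>c A\<bar> * \<bar>W (?A n) \<omega> - W A \<omega>\<bar> + \<bar>Xn n \<omega> - (\<Sum>A\<in>\<A>. c A * W A \<omega>)\<bar>)"
      proof (rule integral_mono_AE')
        show "AE \<omega> in M. \<bar>Y n \<omega> - (\<Sum>A\<in>insert A \<A>. c A * W A \<omega>)\<bar>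
          \<le> \<bar>c A\<bar> * \<bar>W (?A n) \<omega> - W A \<omega>\<bar> + \<bar>Xn n \<omega> - (\<Sum>A\<in>\<A>. c A * W A \<omega>)\<bar>"
        proof (rule AE_I2)
          fix \<omega>
          have "Y n \<omega> - (\<Sum>A\<in>insert A \<A>. c A * W A \<omega>)
            = c A * (W (?A n) \<omega> - W A \<omega>) + (Xn n \<omega> - (\<Sum>A\<in>\<A>. c A * W A \<omega>))"
            using insert.hyps by (simp add: Y_def algebra_simps)
          then show "\<bar>Y n \<omega> - (\<Sum>A\<in>insert A \<A>. c A * W A \<omega>)\<bar>
            \<le> \<bar>c A\<bar> * \<bar>W (?A n) \<omega> - W A \<omega>\<bar> + \<bar>Xn n \<omega> - (\<Sum>A\<in>\<A>. c A * W A \<omega>)\<bar>"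
            using abs_triangle_ineq[of "c A * (W (?A n) \<omega> - W A \<omega>)" "Xn n \<omega> - (\<Sum>A\<in>\<A>. c A * W A \<omega>)"]
            by (simp only: abs_mult)
        qed
      qed (use i1 i2 in auto)
      then show ?thesis using i1 i2 by simp
    qed
    have "(\<lambda>n. expectation (\<lambda>\<omega>. \<bar>Y n \<omega> - (\<Sum>A\<in>insert A \<A>. c A * W A \<omega>)\<bar>)) \<longlonglongrightarrow> 0"
    proof (rule tendsto_sandwich[OF _ _ tendsto_const])
      show "(\<lambda>n. \<bar>c A\<bar> * expectation (\<lambda>\<omega>. \<bar>W (?A n) \<omega> - W A \<omega>\<bar>) + expectation (\<lambda>\<omega>. \<bar>Xn n \<omega> - (\<Sum>A\<in>\<A>. c A * W A \<omega>)\<bar>)) \<longlonglongrightarrow> 0"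
        using tendsto_add[OF tendsto_mult[OF tendsto_const W_truncate_tendsto[OF A], of "\<bar>c A\<bar>"] lim] by simp
    qed (use bound in \<open>auto intro!: integral_nonneg_AE\<close>)
    with Y show ?case by blast
  qed
  with that show thesis by (auto simp: X)
qed

text \<open>
  For an event \<open>F\<close> of the filtration, the Fourier transforms of \<open>X\<^sub>n\<close> weighted by
  \<open>D = indicator F - prob F\<close> vanish by independence after time \<open>t + 1 / Suc n\<close>, and they converge to
  that of \<open>X\<close> because \<open>iexp\<close> is Lipschitz continuous.
\<close>
lemma noise_filtration_indep_var:
  fixes Y :: "'w \<Rightarrow> real"
  assumes Y: "Y \<in> borel_measurable (noise_filtration M W t)" and X: "X \<in> noise_span ({t<..} \<times> UNIV)"
  shows "indep_var borel Y borel X"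
proof (rule indep_varI_sub_algebra[OF Y])
  let ?V = "{X -` S \<inter> space M |S. S \<in> sets borel}"
  note X_meas [measurable] = noise_span_moments(1)[OF X]
  have sub: "sets (noise_filtration M W t) \<subseteq> events"
    using noise_events_subset[of "t + 1"] by (auto simp: sets_noise_filtration)
  obtain Xn where "\<forall>n::nat. Xn n \<in> noise_span ({t + 1 / Suc n<..} \<times> UNIV)"
    and lim: "(\<lambda>n. expectation (\<lambda>\<omega>. \<bar>Xn n \<omega> - X \<omega>\<bar>)) \<longlonglongrightarrow> 0"
    by (rule noise_span_truncate[OF X])
  then have Xn: "\<And>n::nat. Xn n \<in> noise_span ({t + 1 / Suc n<..} \<times> UNIV)"
    by blast
  note [measurable] = noise_span_moments(1)[OF Xn]
  have "indep_set (sets (noise_filtration M W t)) ?V"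
  proof (rule indep_setI[OF sub])
    show "?V \<subseteq> events" by auto
    fix F E assume F: "F \<in> sets (noise_filtration M W t)" and "E \<in> ?V"
    then obtain S where E: "E = X -` S \<inter> space M" and [measurable]: "S \<in> sets borel"
      by auto
    have [measurable]: "F \<in> events" using F sub by blast
    define D where "D \<omega> = indicator F \<omega> - prob F" for \<omega>
    have [measurable]: "D \<in> borel_measurable M"
      unfolding D_def[abs_def] by measurable
    have D1: "\<bar>D \<omega>\<bar> \<le> 1" for \<omega>
      by (auto simp: D_def indicator_def)
    have intD: "integrable M D"
      by (rule integrable_const_bound[of _ 1]) (use D1 in auto)
    have "integrable M (indicator F :: _ \<Rightarrow> real)"
      by (rule integrable_const_bound[of _ 1]) auto
    then have ED: "expectation D = 0"
      unfolding D_def[abs_def] by (subst Bochner_Integration.integral_diff) (auto simp: prob_space)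
    have "(LINT \<omega>|M. D \<omega> * indicator S (X \<omega>)) = 0"
    proof (rule fourier_vanish_real[OF _ _ D1])
      fix \<theta>
      let ?e = "\<lambda>X. CLINT \<omega>|M. of_real (D \<omega>) * iexp (\<theta> * X \<omega>)"
      have 0: "?e (Xn n) = 0" for n
      proof -
        let ?N = "sigma (space M) (noise_gens ({0..t + 1 / Suc n} \<times> UNIV))"
        have gens: "noise_gens ({0..t + 1 / Suc n} \<times> UNIV) \<subseteq> Pow (space M)"
          using noise_gens_events sets.space_closed by blast
        have N: "space ?N = space M" "sets ?N = noise_events M W (t + 1 / Suc n)"
          using gens by (simp_all add: space_measure_of_conv noise_events_eq)
        have "F \<in> sets ?N"
          using F unfolding N sets_noise_filtration by auto
        then have "D \<in> borel_measurable ?N"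
          unfolding D_def[abs_def] by (intro borel_measurable_diff borel_measurable_indicator borel_measurable_const)
        then have "indep_var borel D borel (Xn n)"
        proof (rule indep_varI_sub_algebra[OF _ N(1)])
          show "sets ?N \<subseteq> events" unfolding N by (rule noise_events_subset)
          show "indep_set (sets ?N) (sigma_sets (space M) {Xn n -` S \<inter> space M |S. S \<in> sets borel})"
            unfolding N noise_events_eq by (rule indep_noise_gens[OF Xn]) auto
        qed auto
        then have "indep_var borel ((\<lambda>d. complex_of_real d) \<circ> D) borel ((\<lambda>x. iexp (\<theta> * x)) \<circ> Xn n)"
          by (rule indep_var_compose) auto
        from indep_var_lebesgue_integral[OF this]
        have "?e (Xn n) = (CLINT \<omega>|M. of_real (D \<omega>)) * (CLINT \<omega>|M. iexp (\<theta> * Xn n \<omega>))"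
          using intD by (simp add: comp_def integrable_const_bound[of _ 1])
        also have "(CLINT \<omega>|M. of_real (D \<omega>)) = 0"
          using ED by (subst integral_complex_of_real) simp
        finally show ?thesis by simp
      qed
      have ie: "integrable M (\<lambda>\<omega>. of_real (D \<omega>) * iexp (\<theta> * Z \<omega>))" if [measurable]: "Z \<in> borel_measurable M" for Z
        by (rule integrable_const_bound[of _ 1]) (use D1 in \<open>auto simp: norm_mult\<close>)
      have "cmod (?e X) \<le> \<bar>\<theta>\<bar> * expectation (\<lambda>\<omega>. \<bar>Xn n \<omega> - X \<omega>\<bar>)" for n
      proof -
        have iX: "integrable M (\<lambda>\<omega>. \<bar>Xn n \<omega> - X \<omega>\<bar>)"
          using noise_span_moments(3)[OF X] noise_span_moments(3)[OF Xn] by auto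
        have "cmod (?e X) = cmod (?e (Xn n) - ?e X)"
          unfolding 0 by (simp del: of_real_mult)
        also have "?e (Xn n) - ?e X = (CLINT \<omega>|M. of_real (D \<omega>) * iexp (\<theta> * Xn n \<omega>) - of_real (D \<omega>) * iexp (\<theta> * X \<omega>))"
          by (subst Bochner_Integration.integral_diff) (use ie in auto)
        also have "cmod \<dots> \<le> expectation (\<lambda>\<omega>. \<bar>\<theta>\<bar> * \<bar>Xn n \<omega> - X \<omega>\<bar>)"
        proof (rule order_trans[OF integral_norm_bound integral_mono])
          fix \<omega>
          have "cmod (of_real (D \<omega>) * iexp (\<theta> * Xn n \<omega>) - of_real (D \<omega>) * iexp (\<theta> * X \<omega>))
            = \<bar>D \<omega>\<bar> * cmod (iexp (\<theta> * Xn n \<omega>) - iexp (\<theta> * X \<omega>))"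
            unfolding right_diff_distrib[symmetric] by (simp add: norm_mult)
          also have "\<dots> \<le> 1 * \<bar>\<theta> * Xn n \<omega> - \<theta> * X \<omega>\<bar>"
            by (intro mult_mono D1 iexp_lipschitz) auto
          also have "\<dots> = \<bar>\<theta>\<bar> * \<bar>Xn n \<omega> - X \<omega>\<bar>"
            by (simp add: abs_mult flip: right_diff_distrib)
          finally show "cmod (of_real (D \<omega>) * iexp (\<theta> * Xn n \<omega>) - of_real (D \<omega>) * iexp (\<theta> * X \<omega>)) \<le> \<bar>\<theta>\<bar> * \<bar>Xn n \<omega> - X \<omega>\<bar>" .
        qed (use iX ie[of X] ie[of "Xn n"] in auto)
        finally show ?thesis by simp
      qed
      moreover have "(\<lambda>n. \<bar>\<theta>\<bar> * expectation (\<lambda>\<omega>. \<bar>Xn n \<omega> - X \<omega>\<bar>)) \<longlonglongrightarrow> 0"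
        using tendsto_mult[OF tendsto_const lim, of "\<bar>\<theta>\<bar>"] by simp
      ultimately have "cmod (?e X) \<le> 0"
        by (intro LIMSEQ_le_const) auto
      then show "?e X = 0" by simp
    qed auto
    also have "(LINT \<omega>|M. D \<omega> * indicator S (X \<omega>)) = (LINT \<omega>|M. indicator (F \<inter> E) \<omega> - prob F * indicator E \<omega>)"
      using E by (intro Bochner_Integration.integral_cong) (auto simp: indicator_def D_def)
    also have "\<dots> = prob (F \<inter> E) - prob F * prob E"
      using E by (subst Bochner_Integration.integral_diff) (auto simp: less_top[symmetric])
    finally show "prob (F \<inter> E) = prob F * prob E" by simp
  qed
  moreover have "Int_stable (sets (noise_filtration M W t))"
    by (rule sets.Int_stable)
  moreover have "Int_stable ?V"
  proof (rule Int_stableI, safe)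
    fix S S' :: "real set" assume "S \<in> sets borel" "S' \<in> sets borel"
    then show "\<exists>R. X -` S \<inter> space M \<inter> (X -` S' \<inter> space M) = X -` R \<inter> space M \<and> R \<in> sets borel"
      by (intro exI[of _ "S \<inter> S'"]) auto
  qed
  ultimately have "indep_set (sigma_sets (space M) (sets (noise_filtration M W t))) (sigma_sets (space M) ?V)"
    by (rule indep_set_sigma_sets)
  then show "indep_set (sets (noise_filtration M W t)) (sigma_sets (space M) ?V)"
    using sets.sigma_sets_eq[of "noise_filtration M W t"] by simp
  show "sets (noise_filtration M W t) \<subseteq> events" by fact
  show "X \<in> borel_measurable M" by fact
qed simp

lemma noise_increment_mean:
  assumes Y: "Y \<in> borel_measurable (noise_filtration M W t)" "integrable M Y"
    and X: "X \<in> noise_span ({t<..} \<times> UNIV)"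
  shows "integrable M (\<lambda>\<omega>. Y \<omega> * X \<omega>)" "expectation (\<lambda>\<omega>. Y \<omega> * X \<omega>) = 0"
  using indep_var_integrable[OF noise_filtration_indep_var[OF Y(1) X] Y(2)]
    indep_var_lebesgue_integral[OF noise_filtration_indep_var[OF Y(1) X] Y(2)] noise_span_moments[OF X]
  by auto

lemma noise_increment_square:
  assumes Y: "Y \<in> borel_measurable (noise_filtration M W t)" "integrable M Y"
    and X: "X \<in> noise_span ({t<..} \<times> UNIV)"
  shows "integrable M (\<lambda>\<omega>. Y \<omega> * (X \<omega>)\<^sup>2)"
    "expectation (\<lambda>\<omega>. Y \<omega> * (X \<omega>)\<^sup>2) = expectation Y * expectation (\<lambda>\<omega>. (X \<omega>)\<^sup>2)"
proof -
  have "indep_var borel ((\<lambda>y. y) \<circ> Y) borel ((\<lambda>x. x\<^sup>2) \<circ> X)"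
    by (rule indep_var_compose[OF noise_filtration_indep_var[OF Y(1) X]]) auto
  then have "indep_var borel Y borel (\<lambda>\<omega>. (X \<omega>)\<^sup>2)"
    by (simp add: comp_def)
  from indep_var_integrable[OF this Y(2)] indep_var_lebesgue_integral[OF this Y(2)] noise_span_moments(2)[OF X]
  show "integrable M (\<lambda>\<omega>. Y \<omega> * (X \<omega>)\<^sup>2)"
    "expectation (\<lambda>\<omega>. Y \<omega> * (X \<omega>)\<^sup>2) = expectation Y * expectation (\<lambda>\<omega>. (X \<omega>)\<^sup>2)"
    by auto
qed

text \<open>
  Independence of \<open>Y\<close> from the pair of \<open>X\<close> and \<open>X'\<close> is not at hand, but polarization reduces the
  product to squares of single elements of the span.
\<close>
lemma noise_increment_product:
  assumes Y: "Y \<in> borel_measurable (noise_filtration M W t)" "integrable M Y"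
    and X: "X \<in> noise_span ({t<..} \<times> UNIV)" and X': "X' \<in> noise_span ({t<..} \<times> UNIV)"
  shows "integrable M (\<lambda>\<omega>. Y \<omega> * (X \<omega> * X' \<omega>))"
    "expectation (\<lambda>\<omega>. Y \<omega> * (X \<omega> * X' \<omega>)) = expectation Y * expectation (\<lambda>\<omega>. X \<omega> * X' \<omega>)"
proof -
  have S: "(\<lambda>\<omega>. X \<omega> + X' \<omega>) \<in> noise_span ({t<..} \<times> UNIV)"
    by (rule noise_span_add[OF X X'])
  have *: "Y \<omega> * (X \<omega> * X' \<omega>) = (Y \<omega> * (X \<omega> + X' \<omega>)\<^sup>2 - Y \<omega> * (X \<omega>)\<^sup>2 - Y \<omega> * (X' \<omega>)\<^sup>2) / 2" for \<omega>
    by (simp add: power2_eq_square algebra_simps)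
  have **: "X \<omega> * X' \<omega> = ((X \<omega> + X' \<omega>)\<^sup>2 - (X \<omega>)\<^sup>2 - (X' \<omega>)\<^sup>2) / 2" for \<omega>
    by (simp add: power2_eq_square algebra_simps)
  note sq = noise_increment_square[OF Y S] noise_increment_square[OF Y X] noise_increment_square[OF Y X']
  note m = noise_span_moments(2)[OF S] noise_span_moments(2)[OF X] noise_span_moments(2)[OF X']
  show "integrable M (\<lambda>\<omega>. Y \<omega> * (X \<omega> * X' \<omega>))"
    unfolding * using sq by auto
  show "expectation (\<lambda>\<omega>. Y \<omega> * (X \<omega> * X' \<omega>)) = expectation Y * expectation (\<lambda>\<omega>. X \<omega> * X' \<omega>)"
    unfolding * ** using sq m by (simp add: algebra_simps)
qed

end

section \<open>Limits in the space of square integrable functions\<close>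
lemma L2_norm_sq_eq:
  assumes "integrable N (\<lambda>x. (f x)\<^sup>2)"
  shows "L2_norm_sq N f = ennreal (LINT x|N. (f x)\<^sup>2)"
  unfolding L2_norm_sq_def using assms by (intro nn_integral_eq_integral) auto

lemma Cauchy_Schwarz_integral_sq:
  fixes f g :: "'a \<Rightarrow> real"
  assumes [measurable]: "f \<in> borel_measurable N" "g \<in> borel_measurable N"
    and f: "integrable N (\<lambda>x. (f x)\<^sup>2)" and g: "integrable N (\<lambda>x. (g x)\<^sup>2)"
  shows "\<bar>LINT x|N. f x * g x\<bar> \<le> sqrt ((LINT x|N. (f x)\<^sup>2) * (LINT x|N. (g x)\<^sup>2))"
proof -
  have fg: "integrable N (\<lambda>x. f x * g x)"
    by (rule integrable_mult_sq[OF _ _ f g]) auto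
  have pos: "0 \<le> (LINT x|N. (f x)\<^sup>2)" "0 \<le> (LINT x|N. (g x)\<^sup>2)" "0 \<le> (LINT x|N. \<bar>f x * g x\<bar>)"
    by (auto intro!: integral_nonneg_AE)
  have "ennreal ((LINT x|N. \<bar>f x * g x\<bar>)\<^sup>2) = (\<integral>\<^sup>+x. ennreal \<bar>f x\<bar> * ennreal \<bar>g x\<bar> \<partial>N)\<^sup>2"
    using nn_integral_eq_integral[OF integrable_abs[OF fg]] pos
    by (simp add: abs_mult ennreal_mult' flip: ennreal_power)
  also have "\<dots> \<le> (\<integral>\<^sup>+x. (ennreal \<bar>f x\<bar>)\<^sup>2 \<partial>N) * (\<integral>\<^sup>+x. (ennreal \<bar>g x\<bar>)\<^sup>2 \<partial>N)"
    by (rule Cauchy_Schwarz_nn_integral) measurable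
  also have "\<dots> = ennreal (LINT x|N. (f x)\<^sup>2) * ennreal (LINT x|N. (g x)\<^sup>2)"
    using nn_integral_eq_integral[OF f] nn_integral_eq_integral[OF g] by (simp add: ennreal_power)
  also have "\<dots> = ennreal ((LINT x|N. (f x)\<^sup>2) * (LINT x|N. (g x)\<^sup>2))"
    using pos by (simp add: ennreal_mult)
  finally have "(LINT x|N. \<bar>f x * g x\<bar>)\<^sup>2 \<le> (LINT x|N. (f x)\<^sup>2) * (LINT x|N. (g x)\<^sup>2)"
    using pos by (subst (asm) ennreal_le_iff) auto
  then have "(LINT x|N. \<bar>f x * g x\<bar>) \<le> sqrt ((LINT x|N. (f x)\<^sup>2) * (LINT x|N. (g x)\<^sup>2))"
    by (rule real_le_rsqrt)
  then show ?thesis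
    using integral_abs_bound[of N "\<lambda>x. f x * g x"] by linarith
qed

lemma integrable_sq_add:
  fixes f g :: "'a \<Rightarrow> real"
  assumes [measurable]: "f \<in> borel_measurable N" "g \<in> borel_measurable N"
    and "integrable N (\<lambda>x. (f x)\<^sup>2)" "integrable N (\<lambda>x. (g x)\<^sup>2)"
  shows "integrable N (\<lambda>x. (f x + g x)\<^sup>2)" "integrable N (\<lambda>x. (f x - g x)\<^sup>2)"
  using assms integrable_mult_sq[OF assms] by (auto simp: power2_sum power2_diff mult.assoc)

lemma L2_limit_integrable_sq:
  fixes f :: "'a \<Rightarrow> real"
  assumes [measurable]: "\<And>n. fn n \<in> borel_measurable N" "f \<in> borel_measurable N"
    and fn: "\<And>n::nat. integrable N (\<lambda>x. (fn n x)\<^sup>2)"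
    and lim: "(\<lambda>n. L2_norm_sq N (\<lambda>x. fn n x - f x)) \<longlonglongrightarrow> 0"
  shows "integrable N (\<lambda>x. (f x)\<^sup>2)" "(\<lambda>n. LINT x|N. (fn n x - f x)\<^sup>2) \<longlonglongrightarrow> 0"
proof -
  have "\<forall>\<^sub>F n in sequentially. L2_norm_sq N (\<lambda>x. fn n x - f x) < 1"
    using lim by (rule order_tendstoD) simp
  then obtain n where n: "L2_norm_sq N (\<lambda>x. fn n x - f x) < 1"
    by (auto simp: eventually_sequentially)
  have "integrable N (\<lambda>x. (fn n x - f x)\<^sup>2)"
    using n unfolding L2_norm_sq_def by (intro integrableI_nonneg) (auto intro: less_trans)
  from integrable_sq_add(2)[OF _ _ fn[of n] this]
  show f: "integrable N (\<lambda>x. (f x)\<^sup>2)" by simp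
  have "integrable N (\<lambda>x. (fn n x - f x)\<^sup>2)" for n
    by (rule integrable_sq_add(2)[OF _ _ fn f]) auto
  with lim have "(\<lambda>n. ennreal (LINT x|N. (fn n x - f x)\<^sup>2)) \<longlonglongrightarrow> ennreal 0"
    by (simp add: L2_norm_sq_eq)
  then show "(\<lambda>n. LINT x|N. (fn n x - f x)\<^sup>2) \<longlonglongrightarrow> 0"
    by (rule tendsto_ennrealD) (auto intro!: integral_nonneg_AE)
qed

text \<open>
  With \<open>a = fn - f\<close> and \<open>b = gn - g\<close>, the difference of the inner products is that of \<open>a\<close> and \<open>b\<close>,
  of \<open>a\<close> and \<open>g\<close>, and of \<open>f\<close> and \<open>b\<close>; the Cauchy-Schwarz inequality bounds each of them.
\<close>
lemma L2_limit_inner: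
  fixes f g :: "'a \<Rightarrow> real"
  assumes [measurable]: "\<And>n. fn n \<in> borel_measurable N" "f \<in> borel_measurable N"
      "\<And>n. gn n \<in> borel_measurable N" "g \<in> borel_measurable N"
    and fn: "\<And>n::nat. integrable N (\<lambda>x. (fn n x)\<^sup>2)" and gn: "\<And>n::nat. integrable N (\<lambda>x. (gn n x)\<^sup>2)"
    and limf: "(\<lambda>n. L2_norm_sq N (\<lambda>x. fn n x - f x)) \<longlonglongrightarrow> 0"
    and limg: "(\<lambda>n. L2_norm_sq N (\<lambda>x. gn n x - g x)) \<longlonglongrightarrow> 0"
  shows "(\<lambda>n. LINT x|N. fn n x * gn n x) \<longlonglongrightarrow> (LINT x|N. f x * g x)"
proof -
  note F = L2_limit_integrable_sq[OF assms(1,2) fn limf]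
  note G = L2_limit_integrable_sq[OF assms(3,4) gn limg]
  define a b where "a n x = fn n x - f x" and "b n x = gn n x - g x" for n x
  have [measurable]: "a n \<in> borel_measurable N" "b n \<in> borel_measurable N" for n
    unfolding a_def[abs_def] b_def[abs_def] by measurable
  have a: "integrable N (\<lambda>x. (a n x)\<^sup>2)" and b: "integrable N (\<lambda>x. (b n x)\<^sup>2)" for n
    unfolding a_def b_def by (rule integrable_sq_add(2)[OF _ _ fn F(1)] integrable_sq_add(2)[OF _ _ gn G(1)]; simp)+
  have eq: "(LINT x|N. fn n x * gn n x) - (LINT x|N. f x * g x)
      = (LINT x|N. a n x * b n x) + (LINT x|N. a n x * g x) + (LINT x|N. f x * b n x)" for n
  proof -
    have i: "integrable N (\<lambda>x. a n x * b n x)" "integrable N (\<lambda>x. a n x * g x)"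
      "integrable N (\<lambda>x. f x * b n x)" "integrable N (\<lambda>x. f x * g x)"
      by (rule integrable_mult_sq; use a b F G in simp)+
    have "(LINT x|N. fn n x * gn n x) = (LINT x|N. a n x * b n x + a n x * g x + f x * b n x + f x * g x)"
      by (intro Bochner_Integration.integral_cong) (auto simp: a_def b_def algebra_simps)
    also have "\<dots> = (LINT x|N. a n x * b n x) + (LINT x|N. a n x * g x) + (LINT x|N. f x * b n x) + (LINT x|N. f x * g x)"
      using i by simp
    finally show ?thesis by simp
  qed
  let ?I = "\<lambda>h. LINT x|N. (h x)\<^sup>2"
  have bound: "\<bar>(LINT x|N. fn n x * gn n x) - (LINT x|N. f x * g x)\<bar>
      \<le> sqrt (?I (a n) * ?I (b n)) + sqrt (?I (a n) * ?I g) + sqrt (?I f * ?I (b n))" for n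
  proof -
    have "\<bar>LINT x|N. a n x * b n x\<bar> \<le> sqrt (?I (a n) * ?I (b n))"
      "\<bar>LINT x|N. a n x * g x\<bar> \<le> sqrt (?I (a n) * ?I g)"
      "\<bar>LINT x|N. f x * b n x\<bar> \<le> sqrt (?I f * ?I (b n))"
      by (rule Cauchy_Schwarz_integral_sq; use a b F G in simp)+
    then show ?thesis unfolding eq by linarith
  qed
  have "(\<lambda>n. sqrt (?I (a n) * ?I (b n)) + sqrt (?I (a n) * ?I g) + sqrt (?I f * ?I (b n)))
      \<longlonglongrightarrow> sqrt (0 * 0) + sqrt (0 * ?I g) + sqrt (?I f * 0)"
    unfolding a_def b_def using F(2) G(2) by (intro tendsto_intros)
  then have lim0: "(\<lambda>n. sqrt (?I (a n) * ?I (b n)) + sqrt (?I (a n) * ?I g) + sqrt (?I f * ?I (b n))) \<longlonglongrightarrow> 0"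
    by simp
  have "(\<lambda>n. (LINT x|N. fn n x * gn n x) - (LINT x|N. f x * g x)) \<longlonglongrightarrow> 0"
    by (rule Lim_null_comparison[OF _ lim0]) (use bound in auto)
  then show ?thesis by (rule LIM_zero_cancel)
qed

lemma (in pair_sigma_finite)
  fixes f :: "'a \<Rightarrow> real" and g :: "'b \<Rightarrow> real"
  assumes f: "integrable M1 f" and g: "integrable M2 g"
  shows integrable_pair_product: "integrable (M1 \<Otimes>\<^sub>M M2) (\<lambda>(x, y). f x * g y)"
    and integral_pair_product: "integral\<^sup>L (M1 \<Otimes>\<^sub>M M2) (\<lambda>(x, y). f x * g y) = (LINT x|M1. f x) * (LINT y|M2. g y)"
proof -
  note [measurable] = borel_measurable_integrable[OF f] borel_measurable_integrable[OF g]
  show int: "integrable (M1 \<Otimes>\<^sub>M M2) (\<lambda>(x, y). f x * g y)"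
  proof (rule Fubini_integrable)
    show "integrable M1 (\<lambda>x. LINT y|M2. norm ((\<lambda>(x, y). f x * g y) (x, y)))"
      using f by (simp add: abs_mult)
    show "AE x in M1. integrable M2 (\<lambda>y. (\<lambda>(x, y). f x * g y) (x, y))"
      using g by simp
  qed measurable
  show "integral\<^sup>L (M1 \<Otimes>\<^sub>M M2) (\<lambda>(x, y). f x * g y) = (LINT x|M1. f x) * (LINT y|M2. g y)"
    using integral_fst'[OF int] by simp
qed

context white_noise
begin

section \<open>The isometry of the Walsh integral\<close>
lemma rectangle_noise_set:
  assumes "0 \<le> a" "A \<in> sets borel" "emeasure lborel A < \<infinity>"
  shows "{a<..b} \<times> A \<in> noise_sets"
proof -
  have "emeasure lborel ({a<..b} \<times> A) = emeasure lborel {a<..b} * emeasure lborel A"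
    using assms(2) by (subst lborel_prod[symmetric], subst lborel.emeasure_pair_measure_Times) auto
  also have "\<dots> < \<infinity>"
    using assms(3) by (cases "a \<le> b") (auto simp: ennreal_mult_less_top)
  finally show ?thesis
    using assms by (auto simp: noise_sets_def intro!: borel_Times)
qed

text \<open>The covariances show that the difference of the two sides has second moment zero.\<close>
lemma W_union_disjoint:
  assumes A: "A \<in> noise_sets" and B: "B \<in> noise_sets" and AB: "A \<union> B \<in> noise_sets" "A \<inter> B = {}"
  shows "AE \<omega> in M. W (A \<union> B) \<omega> = W A \<omega> + W B \<omega>"
proof -
  let ?X = "\<lambda>\<omega>. W (A \<union> B) \<omega> + ((-1) * W A \<omega> + (-1) * W B \<omega>)"
  have X: "?X \<in> noise_span UNIV"
    by (intro noise_span_add noise_span_scale_base noise_span_base) (use assms in auto)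
  note i = noise_span_integrable_mult[OF noise_span_base[of _ UNIV] noise_span_base[of _ UNIV]]
  have "measure lborel (A \<union> B) = measure lborel A + measure lborel B"
    using assms by (intro measure_Union) (auto simp: noise_sets_def)
  moreover have "expectation (\<lambda>\<omega>. (?X \<omega>)\<^sup>2)
     = expectation (\<lambda>\<omega>. W (A \<union> B) \<omega> * W (A \<union> B) \<omega> + W A \<omega> * W A \<omega> + W B \<omega> * W B \<omega>
          - 2 * (W (A \<union> B) \<omega> * W A \<omega>) - 2 * (W (A \<union> B) \<omega> * W B \<omega>) + 2 * (W A \<omega> * W B \<omega>))"
    by (intro Bochner_Integration.integral_cong) (auto simp: power2_eq_square algebra_simps)
  moreover have "\<dots> = measure lborel (A \<union> B) + measure lborel A + measure lborel B
      - 2 * measure lborel ((A \<union> B) \<inter> A) - 2 * measure lborel ((A \<union> B) \<inter> B) + 2 * measure lborel (A \<inter> B)"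
    using assms i by (simp add: noise_cov)
  moreover have "(A \<union> B) \<inter> A = A" "(A \<union> B) \<inter> B = B" by auto
  ultimately have "expectation (\<lambda>\<omega>. (?X \<omega>)\<^sup>2) = 0"
    using assms by simp
  then have "AE \<omega> in M. (?X \<omega>)\<^sup>2 = 0"
    using noise_span_moments(2)[OF X] by (subst (asm) integral_nonneg_eq_0_iff_AE) auto
  then show ?thesis by eventually_elim auto
qed

definition elem_value :: "'w elementary \<Rightarrow> real \<times> real \<Rightarrow> 'w \<Rightarrow> real" where
  "elem_value = (\<lambda>(Y, a, b, A) p \<omega>. indicator ({a<..b} \<times> A) p * Y \<omega>)"

definition elem_integral :: "'w elementary \<Rightarrow> 'w \<Rightarrow> real" where
  "elem_integral = (\<lambda>(Y, a, b, A) \<omega>. Y \<omega> * W ({a<..b} \<times> A) \<omega>)"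

lemma simple_value_eq_sum: "simple_value es s y \<omega> = (\<Sum>i<length es. elem_value (es ! i) (s, y) \<omega>)"
proof -
  have *: "(\<lambda>(Y, a, b, A). Y \<omega> * indicator {a<..b} s * indicator A y) = (\<lambda>e. elem_value e (s, y) \<omega>)"
    by (auto simp: elem_value_def indicator_def fun_eq_iff)
  show ?thesis
    unfolding simple_value_def * by (simp add: sum_list_sum_nth atLeast0LessThan)
qed

lemma simple_integral_eq_sum: "simple_integral W es \<omega> = (\<Sum>i<length es. elem_integral (es ! i) \<omega>)"
proof -
  have *: "(\<lambda>(Y, a, b, A). Y \<omega> * W ({a<..b} \<times> A) \<omega>) = (\<lambda>e. elem_integral e \<omega>)"
    by (auto simp: elem_integral_def fun_eq_iff)
  show ?thesis
    unfolding simple_integral_def * by (simp add: sum_list_sum_nth atLeast0LessThan)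
qed

lemma elementaryE:
  assumes "elementary_process M W e"
  obtains Y a b A C where "e = (Y, a, b, A)" "0 \<le> a" "a < b" "A \<in> sets borel" "emeasure lborel A < \<infinity>"
    "Y \<in> borel_measurable (noise_filtration M W a)" "\<forall>\<omega>\<in>space M. \<bar>Y \<omega>\<bar> \<le> C"
  using assms unfolding elementary_process_def by (cases e) auto

lemma elem_integral_sq:
  assumes "elementary_process M W e"
  shows "elem_integral e \<in> borel_measurable M" "integrable M (\<lambda>\<omega>. (elem_integral e \<omega>)\<^sup>2)"
    "expectation (elem_integral e) = 0"
proof -
  obtain Y a b A C where e: "e = (Y, a, b, A)" "0 \<le> a" "a < b" "A \<in> sets borel" "emeasure lborel A < \<infinity>"
    and Y: "Y \<in> borel_measurable (noise_filtration M W a)" and C: "\<forall>\<omega>\<in>space M. \<bar>Y \<omega>\<bar> \<le> C"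
    using assms by (rule elementaryE)
  let ?B = "{a<..b} \<times> A"
  have B: "?B \<in> noise_sets" using e by (intro rectangle_noise_set) auto
  note [measurable] = noise_filtration_measurable[OF Y] measurable_W[OF B]
  have E: "elem_integral e = (\<lambda>\<omega>. Y \<omega> * W ?B \<omega>)" by (simp add: e elem_integral_def)
  show "elem_integral e \<in> borel_measurable M" unfolding E by measurable
  show "integrable M (\<lambda>\<omega>. (elem_integral e \<omega>)\<^sup>2)"
  proof (rule Bochner_Integration.integrable_bound)
    show "integrable M (\<lambda>\<omega>. C\<^sup>2 * (W ?B \<omega>)\<^sup>2)"
      using integrable_W_sq[OF B] by simp
    show "AE \<omega> in M. norm ((elem_integral e \<omega>)\<^sup>2) \<le> norm (C\<^sup>2 * (W ?B \<omega>)\<^sup>2)"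
    proof (rule AE_I2)
      fix \<omega> assume "\<omega> \<in> space M"
      then have "(Y \<omega>)\<^sup>2 \<le> C\<^sup>2" using C power_mono[of "\<bar>Y \<omega>\<bar>" C 2] by auto
      then show "norm ((elem_integral e \<omega>)\<^sup>2) \<le> norm (C\<^sup>2 * (W ?B \<omega>)\<^sup>2)"
        by (simp add: E power_mult_distrib mult_right_mono)
    qed
  qed (simp add: E)
  have iY: "integrable M Y"
    by (rule integrable_const_bound[of _ C]) (use C in auto)
  show "expectation (elem_integral e) = 0"
    unfolding E by (rule noise_increment_mean(2)[OF Y iY noise_span_base[OF B]]) auto
qed

text \<open>
  The earlier rectangle \<open>B\<close> is cut at \<open>a'\<close> into \<open>B1\<close> and \<open>B2\<close>.  The part with \<open>B1\<close> belongs to the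
  past of \<open>a'\<close>, like \<open>Y * Y'\<close>, and is multiplied by the future \<open>W B'\<close> of mean zero; the part with
  \<open>B2\<close> is a product of two increments after \<open>a'\<close>.
\<close>
lemma elem_isometry_ordered:
  assumes e: "elementary_process M W (Y, a, b, A)" and e': "elementary_process M W (Y', a', b', A')" and le: "a \<le> a'"
  shows "expectation (\<lambda>\<omega>. elem_integral (Y, a, b, A) \<omega> * elem_integral (Y', a', b', A') \<omega>)
    = expectation (\<lambda>\<omega>. Y \<omega> * Y' \<omega>) * measure lborel (({a<..b} \<times> A) \<inter> ({a'<..b'} \<times> A'))"
proof -
  obtain C where a: "0 \<le> a" "a < b" "A \<in> sets borel" "emeasure lborel A < \<infinity>"
    and Y: "Y \<in> borel_measurable (noise_filtration M W a)" and C: "\<forall>\<omega>\<in>space M. \<bar>Y \<omega>\<bar> \<le> C"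
    using e by (auto simp: elementary_process_def)
  obtain C' where a': "0 \<le> a'" "a' < b'" "A' \<in> sets borel" "emeasure lborel A' < \<infinity>"
    and Y': "Y' \<in> borel_measurable (noise_filtration M W a')" and C': "\<forall>\<omega>\<in>space M. \<bar>Y' \<omega>\<bar> \<le> C'"
    using e' by (auto simp: elementary_process_def)
  let ?F = "noise_filtration M W a'"
  define B B1 B2 B' where "B = {a<..b} \<times> A" and "B1 = {a<..min b a'} \<times> A" and "B2 = {a'<..b} \<times> A"
    and "B' = {a'<..b'} \<times> A'"
  have noise: "B \<in> noise_sets" "B1 \<in> noise_sets" "B2 \<in> noise_sets" "B' \<in> noise_sets"
    unfolding B_def B1_def B2_def B'_def using a a' by (auto intro!: rectangle_noise_set)
  have split: "B = B1 \<union> B2" "B1 \<inter> B2 = {}" "B \<inter> B' = B2 \<inter> B'"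
    unfolding B_def B1_def B2_def B'_def using le by auto
  have ae: "AE \<omega> in M. W B \<omega> = W B1 \<omega> + W B2 \<omega>"
    using W_union_disjoint[OF noise(2,3)] noise(1) split by simp
  have span: "W B2 \<in> noise_span ({a'<..} \<times> UNIV)" "W B' \<in> noise_span ({a'<..} \<times> UNIV)"
    using noise by (auto intro!: noise_span_base simp: B2_def B'_def)
  note [measurable] = measurable_W[OF noise(1)] measurable_W[OF noise(2)] measurable_W[OF noise(3)] measurable_W[OF noise(4)]
    noise_filtration_measurable[OF Y] noise_filtration_measurable[OF Y']
  have YF: "Y \<in> borel_measurable ?F"
    by (rule noise_filtration_mono[OF Y le])
  have W1: "W B1 \<in> borel_measurable ?F"
    using noise(2) a by (intro W_noise_filtration) (auto simp: B1_def)
  have YY: "integrable M (\<lambda>\<omega>. Y \<omega> * Y' \<omega>)"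
    by (rule integrable_const_bound[of _ "C * C'"])
       (use C C' in \<open>auto simp: abs_mult intro!: mult_mono intro: order_trans[OF abs_ge_zero]\<close>)
  have YYm: "(\<lambda>\<omega>. Y \<omega> * Y' \<omega>) \<in> borel_measurable ?F"
    using YF Y' by (rule borel_measurable_times)
  have YYW: "integrable M (\<lambda>\<omega>. Y \<omega> * Y' \<omega> * W B1 \<omega>)"
  proof (rule Bochner_Integration.integrable_bound)
    show "integrable M (\<lambda>\<omega>. C * C' * W B1 \<omega>)"
      using noise_span_moments(3)[OF noise_span_base[OF noise(2) order_refl]] by simp
    show "AE \<omega> in M. norm (Y \<omega> * Y' \<omega> * W B1 \<omega>) \<le> norm (C * C' * W B1 \<omega>)"
    proof (rule AE_I2)
      fix \<omega> assume \<omega>: "\<omega> \<in> space M"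
      have "\<bar>Y \<omega>\<bar> * \<bar>Y' \<omega>\<bar> * \<bar>W B1 \<omega>\<bar> \<le> \<bar>C\<bar> * \<bar>C'\<bar> * \<bar>W B1 \<omega>\<bar>"
        using C C' \<omega> by (intro mult_mono) (auto intro: order_trans[OF _ abs_ge_self])
      then show "norm (Y \<omega> * Y' \<omega> * W B1 \<omega>) \<le> norm (C * C' * W B1 \<omega>)"
        by (simp add: abs_mult)
    qed
  qed measurable
  have YYWm: "(\<lambda>\<omega>. Y \<omega> * Y' \<omega> * W B1 \<omega>) \<in> borel_measurable ?F"
    using YYm W1 by (rule borel_measurable_times)
  have "expectation (\<lambda>\<omega>. elem_integral (Y, a, b, A) \<omega> * elem_integral (Y', a', b', A') \<omega>)
     = expectation (\<lambda>\<omega>. Y \<omega> * Y' \<omega> * W B1 \<omega> * W B' \<omega> + Y \<omega> * Y' \<omega> * (W B2 \<omega> * W B' \<omega>))"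
  proof (rule integral_cong_AE)
    show "AE \<omega> in M. elem_integral (Y, a, b, A) \<omega> * elem_integral (Y', a', b', A') \<omega>
       = Y \<omega> * Y' \<omega> * W B1 \<omega> * W B' \<omega> + Y \<omega> * Y' \<omega> * (W B2 \<omega> * W B' \<omega>)"
      using ae by eventually_elim (simp add: elem_integral_def algebra_simps flip: B_def B'_def)
  qed (use elem_integral_sq(1)[OF e] elem_integral_sq(1)[OF e'] in measurable)
  also have "\<dots> = 0 + expectation (\<lambda>\<omega>. Y \<omega> * Y' \<omega>) * expectation (\<lambda>\<omega>. W B2 \<omega> * W B' \<omega>)"
    using noise_increment_mean[OF YYWm YYW span(2)] noise_increment_product[OF YYm YY span]
    by (subst Bochner_Integration.integral_add) auto
  also have "expectation (\<lambda>\<omega>. W B2 \<omega> * W B' \<omega>) = measure lborel (B \<inter> B')"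
    unfolding split(3) by (rule noise_cov) (use noise in auto)
  finally show ?thesis by (simp add: B_def B'_def)
qed

lemma pair_sigma_finite_process: "pair_sigma_finite (restrict_space lborel half_plane) M"
proof -
  have "half_plane \<in> sets (lborel :: (real \<times> real) measure)"
    by (auto simp: half_plane_def intro!: borel_Times)
  then show ?thesis
    unfolding pair_sigma_finite_def
    by (auto intro!: sigma_finite_measure_restrict_space lborel.sigma_finite_measure_axioms sigma_finite_measure_axioms)
qed

lemma elem_value_product:
  assumes e: "elementary_process M W (Y, a, b, A)" and e': "elementary_process M W (Y', a', b', A')"
  defines "v \<equiv> \<lambda>(p, \<omega>). elem_value (Y, a, b, A) p \<omega> * elem_value (Y', a', b', A') p \<omega>"
  shows "integrable (process_measure M) v"
    and "(LINT z|process_measure M. v z)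
      = measure lborel (({a<..b} \<times> A) \<inter> ({a'<..b'} \<times> A')) * expectation (\<lambda>\<omega>. Y \<omega> * Y' \<omega>)"
proof -
  interpret P: pair_sigma_finite "restrict_space lborel half_plane" M
    by (rule pair_sigma_finite_process)
  obtain C where a: "0 \<le> a" "a < b" "A \<in> sets borel" "emeasure lborel A < \<infinity>"
    and Y: "Y \<in> borel_measurable (noise_filtration M W a)" and C: "\<forall>\<omega>\<in>space M. \<bar>Y \<omega>\<bar> \<le> C"
    using e by (auto simp: elementary_process_def)
  obtain C' where a': "0 \<le> a'" "a' < b'" "A' \<in> sets borel" "emeasure lborel A' < \<infinity>"
    and Y': "Y' \<in> borel_measurable (noise_filtration M W a')" and C': "\<forall>\<omega>\<in>space M. \<bar>Y' \<omega>\<bar> \<le> C'"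
    using e' by (auto simp: elementary_process_def)
  note [measurable] = noise_filtration_measurable[OF Y] noise_filtration_measurable[OF Y']
  have YY: "integrable M (\<lambda>\<omega>. Y \<omega> * Y' \<omega>)"
    by (rule integrable_const_bound[of _ "C * C'"])
       (use C C' in \<open>auto simp: abs_mult intro!: mult_mono intro: order_trans[OF abs_ge_zero]\<close>)
  define B where "B = ({a<..b} \<times> A) \<inter> ({a'<..b'} \<times> A')"
  have half [measurable]: "half_plane \<in> sets borel"
    by (auto simp: half_plane_def intro!: borel_Times)
  have B: "B \<in> sets borel" "B \<subseteq> half_plane" "emeasure lborel B < \<infinity>"
  proof -
    have "{a<..b} \<times> A \<in> noise_sets" "{a'<..b'} \<times> A' \<in> noise_sets"
      using a a' by (auto intro!: rectangle_noise_set)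
    moreover have "emeasure lborel B \<le> emeasure lborel ({a<..b} \<times> A)"
      unfolding B_def using calculation by (intro emeasure_mono) (auto simp: noise_sets_def)
    ultimately show "B \<in> sets borel" "emeasure lborel B < \<infinity>"
      by (auto simp: B_def noise_sets_def intro: le_less_trans)
    show "B \<subseteq> half_plane" using a by (auto simp: B_def half_plane_def)
  qed
  have Bm: "integrable (restrict_space lborel half_plane) (indicator B :: _ \<Rightarrow> real)"
    "(LINT p|restrict_space lborel half_plane. indicator B p) = measure lborel B"
  proof -
    have *: "indicator half_plane p * indicator B p = (indicator B p :: real)" for p
      using B by (auto simp: indicator_def)
    show "integrable (restrict_space lborel half_plane) (indicator B :: _ \<Rightarrow> real)"
      using B by (subst integrable_restrict_space) (auto simp: * half)
    show "(LINT p|restrict_space lborel half_plane. indicator B p) = measure lborel B"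
      using B by (subst integral_restrict_space) (auto simp: * half)
  qed
  have v: "v = (\<lambda>(p, \<omega>). indicator B p * (Y \<omega> * Y' \<omega>))"
    by (auto simp: v_def B_def elem_value_def indicator_def fun_eq_iff)
  show "integrable (process_measure M) v"
    unfolding v process_measure_def by (rule P.integrable_pair_product[OF Bm(1) YY])
  show "(LINT z|process_measure M. v z)
      = measure lborel (({a<..b} \<times> A) \<inter> ({a'<..b'} \<times> A')) * expectation (\<lambda>\<omega>. Y \<omega> * Y' \<omega>)"
    unfolding v process_measure_def using P.integral_pair_product[OF Bm(1) YY] Bm(2) by (simp add: B_def)
qed

lemma elem_isometry:
  assumes "elementary_process M W e" "elementary_process M W e'"
  shows "expectation (\<lambda>\<omega>. elem_integral e \<omega> * elem_integral e' \<omega>)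
      = (LINT z|process_measure M. (\<lambda>(p, \<omega>). elem_value e p \<omega> * elem_value e' p \<omega>) z)"
proof -
  obtain Y a b A where e: "e = (Y, a, b, A)" by (cases e)
  obtain Y' a' b' A' where e': "e' = (Y', a', b', A')" by (cases e')
  note el = assms[unfolded e e']
  show ?thesis
  proof (cases "a \<le> a'")
    case True
    then show ?thesis
      unfolding e e' elem_isometry_ordered[OF el True] elem_value_product(2)[OF el] by simp
  next
    case False
    then have "a' \<le> a" by simp
    from elem_isometry_ordered[OF el(2,1) this] show ?thesis
      unfolding e e' elem_value_product(2)[OF el] by (simp add: mult.commute Int_commute)
  qed
qed

lemma simple_isometry:
  assumes "\<forall>e\<in>set es. elementary_process M W e" "\<forall>e\<in>set es'. elementary_process M W e"
  shows "expectation (\<lambda>\<omega>. simple_integral W es \<omega> * simple_integral W es' \<omega>)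
      = (LINT z|process_measure M. (\<lambda>((s, y), \<omega>). simple_value es s y \<omega> * simple_value es' s y \<omega>) z)"
    and "integrable (process_measure M) (\<lambda>((s, y), \<omega>). simple_value es s y \<omega> * simple_value es' s y \<omega>)"
    and "integrable M (\<lambda>\<omega>. simple_integral W es \<omega> * simple_integral W es' \<omega>)"
proof -
  have el: "elementary_process M W (es ! i)" if "i < length es" for i using assms that by auto
  have el': "elementary_process M W (es' ! j)" if "j < length es'" for j using assms that by auto
  let ?v = "\<lambda>i j z. (\<lambda>(p, \<omega>). elem_value (es ! i) p \<omega> * elem_value (es' ! j) p \<omega>) z"
  have v: "integrable (process_measure M) (?v i j)" if "i < length es" "j < length es'" for i j
    using elem_value_product(1) el[OF that(1)] el'[OF that(2)] by (cases "es ! i"; cases "es' ! j") auto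
  have w: "integrable M (\<lambda>\<omega>. elem_integral (es ! i) \<omega> * elem_integral (es' ! j) \<omega>)" if "i < length es" "j < length es'" for i j
    by (intro integrable_mult_sq elem_integral_sq el el' that)
  have V: "(\<lambda>((s, y), \<omega>). simple_value es s y \<omega> * simple_value es' s y \<omega>) = (\<lambda>z. \<Sum>i<length es. \<Sum>j<length es'. ?v i j z)"
    by (auto simp: simple_value_eq_sum sum_product fun_eq_iff)
  have I: "(\<lambda>\<omega>. simple_integral W es \<omega> * simple_integral W es' \<omega>)
     = (\<lambda>\<omega>. \<Sum>i<length es. \<Sum>j<length es'. elem_integral (es ! i) \<omega> * elem_integral (es' ! j) \<omega>)"
    by (auto simp: simple_integral_eq_sum sum_product fun_eq_iff)
  show "integrable (process_measure M) (\<lambda>((s, y), \<omega>). simple_value es s y \<omega> * simple_value es' s y \<omega>)"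
    unfolding V using v by (intro Bochner_Integration.integrable_sum) auto
  show "integrable M (\<lambda>\<omega>. simple_integral W es \<omega> * simple_integral W es' \<omega>)"
    unfolding I using w by (intro Bochner_Integration.integrable_sum) auto
  have "expectation (\<lambda>\<omega>. simple_integral W es \<omega> * simple_integral W es' \<omega>)
     = (\<Sum>i<length es. \<Sum>j<length es'. expectation (\<lambda>\<omega>. elem_integral (es ! i) \<omega> * elem_integral (es' ! j) \<omega>))"
    unfolding I using w
    by (subst Bochner_Integration.integral_sum)
       (auto intro!: sum.cong Bochner_Integration.integral_sum Bochner_Integration.integrable_sum)
  also have "\<dots> = (\<Sum>i<length es. \<Sum>j<length es'. (LINT z|process_measure M. ?v i j z))"
    using elem_isometry[OF el el'] by (intro sum.cong) auto
  also have "\<dots> = (LINT z|process_measure M. (\<Sum>i<length es. \<Sum>j<length es'. ?v i j z))"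
    using v
    by (subst Bochner_Integration.integral_sum)
       (auto intro!: sum.cong Bochner_Integration.integral_sum[symmetric] Bochner_Integration.integrable_sum)
  finally show "expectation (\<lambda>\<omega>. simple_integral W es \<omega> * simple_integral W es' \<omega>)
      = (LINT z|process_measure M. (\<lambda>((s, y), \<omega>). simple_value es s y \<omega> * simple_value es' s y \<omega>) z)"
    unfolding V .
qed

lemma measurable_simple_value:
  assumes "\<forall>e\<in>set es. elementary_process M W e"
  shows "(\<lambda>((s, y), \<omega>). simple_value es s y \<omega>) \<in> borel_measurable (process_measure M)"
proof -
  have elem: "(\<lambda>(p, \<omega>). elem_value e p \<omega>) \<in> borel_measurable (process_measure M)" if "e \<in> set es" for e
  proof -
    have "elementary_process M W e" using assms that by blast
    then obtain Y a b A C where e: "e = (Y, a, b, A)" "0 \<le> a" "A \<in> sets borel" "emeasure lborel A < \<infinity>"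
      and Y: "Y \<in> borel_measurable (noise_filtration M W a)"
      by (rule elementaryE)
    note [measurable] = noise_filtration_measurable[OF Y]
    have "{a<..b} \<times> A \<in> sets borel"
      using rectangle_noise_set[of a A b] e by (auto simp: noise_sets_def)
    then have [measurable]: "(indicator ({a<..b} \<times> A) :: _ \<Rightarrow> real) \<in> borel_measurable (restrict_space lborel half_plane)"
      by (intro measurable_restrict_space1) simp
    show ?thesis
      unfolding e elem_value_def process_measure_def prod.case by measurable
  qed
  have "(\<lambda>((s, y), \<omega>). simple_value es s y \<omega>) = (\<lambda>z. \<Sum>i<length es. (\<lambda>(p, \<omega>). elem_value (es ! i) p \<omega>) z)"
    by (auto simp: simple_value_eq_sum fun_eq_iff)
  then show ?thesis
    using elem by (simp only:) (intro borel_measurable_sum, simp)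
qed

lemma measurable_simple_integral:
  assumes "\<forall>e\<in>set es. elementary_process M W e"
  shows "simple_integral W es \<in> borel_measurable M"
proof -
  have "simple_integral W es = (\<lambda>\<omega>. \<Sum>i<length es. elem_integral (es ! i) \<omega>)"
    by (simp add: simple_integral_eq_sum fun_eq_iff)
  then show ?thesis
    using assms elem_integral_sq(1) by (simp only:) (intro borel_measurable_sum, simp)
qed

lemma expectation_simple_integral:
  assumes "\<forall>e\<in>set es. elementary_process M W e"
  shows "expectation (simple_integral W es) = 0"
proof -
  have el: "elementary_process M W (es ! i)" if "i < length es" for i using assms that by auto
  have "integrable M (elem_integral (es ! i))" if "i < length es" for i
    using square_integrable_imp_integrable[OF elem_integral_sq(1,2)[OF el[OF that]]] .
  then have "expectation (\<lambda>\<omega>. \<Sum>i<length es. elem_integral (es ! i) \<omega>) = 0"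
    using elem_integral_sq(3)[OF el] by (subst Bochner_Integration.integral_sum) auto
  then show ?thesis by (simp add: simple_integral_eq_sum[abs_def])
qed

text \<open>
  Both sides of \<open>simple_isometry\<close> are inner products, which pass to the limit in the respective
  \<open>L\<^sup>2\<close>-space.  The mean is the inner product with the constant 1.
\<close>
lemma walsh_isometry:
  assumes Z: "has_walsh_integral M W Z X" and Z': "has_walsh_integral M W Z' X'"
  shows "integrable M (\<lambda>\<omega>. (X \<omega>)\<^sup>2)" "expectation X = 0"
    "integrable (process_measure M) (\<lambda>((s, y), \<omega>). Z s y \<omega> * Z' s y \<omega>)"
    "expectation (\<lambda>\<omega>. X \<omega> * X' \<omega>) = (LINT z|process_measure M. (\<lambda>((s, y), \<omega>). Z s y \<omega> * Z' s y \<omega>) z)"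
proof -
  let ?P = "process_measure M"
  from Z obtain S where S: "\<And>n. \<forall>e\<in>set (S n). elementary_process M W e"
    "(\<lambda>n. L2_norm_sq ?P (\<lambda>((s, y), \<omega>). simple_value (S n) s y \<omega> - Z s y \<omega>)) \<longlonglongrightarrow> 0"
    "(\<lambda>n. L2_norm_sq M (\<lambda>\<omega>. simple_integral W (S n) \<omega> - X \<omega>)) \<longlonglongrightarrow> 0"
    and Zm: "(\<lambda>((s, y), \<omega>). Z s y \<omega>) \<in> borel_measurable ?P" and Xm: "X \<in> borel_measurable M"
    by (auto simp: has_walsh_integral_def)
  from Z' obtain S' where S': "\<And>n. \<forall>e\<in>set (S' n). elementary_process M W e"
    "(\<lambda>n. L2_norm_sq ?P (\<lambda>((s, y), \<omega>). simple_value (S' n) s y \<omega> - Z' s y \<omega>)) \<longlonglongrightarrow> 0"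
    "(\<lambda>n. L2_norm_sq M (\<lambda>\<omega>. simple_integral W (S' n) \<omega> - X' \<omega>)) \<longlonglongrightarrow> 0"
    and Zm': "(\<lambda>((s, y), \<omega>). Z' s y \<omega>) \<in> borel_measurable ?P" and Xm': "X' \<in> borel_measurable M"
    by (auto simp: has_walsh_integral_def)
  define v where "v n z = (\<lambda>((s, y), \<omega>). simple_value (S n) s y \<omega>) z" for n z
  define v' where "v' n z = (\<lambda>((s, y), \<omega>). simple_value (S' n) s y \<omega>) z" for n z
  define z z' where "z p = (\<lambda>((s, y), \<omega>). Z s y \<omega>) p" and "z' p = (\<lambda>((s, y), \<omega>). Z' s y \<omega>) p" for p
  have meas: "\<And>n. v n \<in> borel_measurable ?P" "\<And>n. v' n \<in> borel_measurable ?P" "z \<in> borel_measurable ?P" "z' \<in> borel_measurable ?P"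
    unfolding v_def v'_def z_def z'_def using measurable_simple_value[OF S(1)] measurable_simple_value[OF S'(1)] Zm Zm' by simp_all
  have lim: "(\<lambda>n. L2_norm_sq ?P (\<lambda>p. v n p - z p)) \<longlonglongrightarrow> 0" "(\<lambda>n. L2_norm_sq ?P (\<lambda>p. v' n p - z' p)) \<longlonglongrightarrow> 0"
    using S(2) S'(2) by (simp_all add: v_def v'_def z_def z'_def case_prod_unfold)
  have sq: "\<And>n. integrable ?P (\<lambda>p. (v n p)\<^sup>2)" "\<And>n. integrable ?P (\<lambda>p. (v' n p)\<^sup>2)"
    using simple_isometry(2)[OF S(1) S(1)] simple_isometry(2)[OF S'(1) S'(1)]
    by (simp_all add: v_def v'_def case_prod_unfold power2_eq_square)
  have isq: "\<And>n. integrable M (\<lambda>\<omega>. (simple_integral W (S n) \<omega>)\<^sup>2)" "\<And>n. integrable M (\<lambda>\<omega>. (simple_integral W (S' n) \<omega>)\<^sup>2)"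
    using simple_isometry(3)[OF S(1) S(1)] simple_isometry(3)[OF S'(1) S'(1)] by (simp_all add: power2_eq_square)
  note im = measurable_simple_integral[OF S(1)] measurable_simple_integral[OF S'(1)]
  show "integrable M (\<lambda>\<omega>. (X \<omega>)\<^sup>2)"
    by (rule L2_limit_integrable_sq(1)[OF im(1) Xm isq(1) S(3)])
  have "(\<lambda>n. expectation (\<lambda>\<omega>. simple_integral W (S n) \<omega> * 1)) \<longlonglongrightarrow> expectation (\<lambda>\<omega>. X \<omega> * 1)"
    by (rule L2_limit_inner[OF im(1) Xm _ _ isq(1) _ S(3), of "\<lambda>_ _. 1" "\<lambda>_. 1"]) (auto simp: L2_norm_sq_def)
  then have "(\<lambda>n. 0) \<longlonglongrightarrow> expectation X"
    using expectation_simple_integral[OF S(1)] by simp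
  then show "expectation X = 0"
    by (simp add: LIMSEQ_const_iff)
  have "integrable ?P (\<lambda>p. z p * z' p)"
    by (rule integrable_mult_sq[OF meas(3,4) L2_limit_integrable_sq(1)[OF meas(1,3) sq(1) lim(1)]
          L2_limit_integrable_sq(1)[OF meas(2,4) sq(2) lim(2)]])
  then show "integrable ?P (\<lambda>((s, y), \<omega>). Z s y \<omega> * Z' s y \<omega>)"
    by (simp add: z_def z'_def case_prod_unfold)
  have "(\<lambda>n. LINT p|?P. v n p * v' n p) \<longlonglongrightarrow> (LINT p|?P. z p * z' p)"
    by (rule L2_limit_inner[OF meas(1,3,2,4) sq lim])
  moreover have "(\<lambda>n. expectation (\<lambda>\<omega>. simple_integral W (S n) \<omega> * simple_integral W (S' n) \<omega>)) \<longlonglongrightarrow> expectation (\<lambda>\<omega>. X \<omega> * X' \<omega>)"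
    by (rule L2_limit_inner[OF im(1) Xm im(2) Xm' isq S(3) S'(3)])
  moreover have "expectation (\<lambda>\<omega>. simple_integral W (S n) \<omega> * simple_integral W (S' n) \<omega>) = (LINT p|?P. v n p * v' n p)" for n
    using simple_isometry(1)[OF S(1) S'(1)] by (simp add: v_def v'_def case_prod_unfold)
  ultimately have "expectation (\<lambda>\<omega>. X \<omega> * X' \<omega>) = (LINT p|?P. z p * z' p)"
    by (simp add: LIMSEQ_unique)
  then show "expectation (\<lambda>\<omega>. X \<omega> * X' \<omega>) = (LINT z|?P. (\<lambda>((s, y), \<omega>). Z s y \<omega> * Z' s y \<omega>) z)"
    by (simp add: z_def z'_def case_prod_unfold)
qed

end

section \<open>The two-point correlation of the solution\<close>
lemma J0_lborel:
  assumes "0 < \<nu>" "0 < t"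
  shows "J0 \<nu> lborel t x = 1"
proof -
  have "J0 \<nu> lborel t x = enn2real (\<integral>\<^sup>+y. ennreal (heat_kernel \<nu> t (x - y)) \<partial>lborel)"
    unfolding J0_def using assms by (intro integral_eq_nn_integral) (auto intro: heat_kernel_nonneg)
  then show ?thesis using nn_integral_heat_kernel[OF assms] by simp
qed

context white_noise
begin

text \<open>
  Joint measurability of \<open>u\<close> is available for positive times only; the indicator extends the second
  moment by 0 to the whole plane, where Tonelli's theorem for \<open>lborel\<close> can be used.
\<close>
lemma second_moment_measurable:
  assumes u: "(\<lambda>((t, x), \<omega>). u t x \<omega>) \<in> borel_measurable (restrict_space borel half_plane \<Otimes>\<^sub>M M)"
  shows "(\<lambda>(s, z). indicator {0<..} s * (\<integral>\<^sup>+\<omega>. ennreal (c + (u s z \<omega>)\<^sup>2) \<partial>M)) \<in> borel_measurable (lborel \<Otimes>\<^sub>M lborel)"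
proof -
  have half: "half_plane \<in> sets borel"
    by (auto simp: half_plane_def intro!: borel_Times)
  have [measurable]: "(\<lambda>w. u (fst (fst w)) (snd (fst w)) (snd w)) \<in> borel_measurable (restrict_space borel half_plane \<Otimes>\<^sub>M M)"
    using u by (simp add: case_prod_unfold)
  have "(\<lambda>w. ennreal (c + (u (fst (fst w)) (snd (fst w)) (snd w))\<^sup>2)) \<in> borel_measurable (restrict_space borel half_plane \<Otimes>\<^sub>M M)"
    by measurable
  then have "(\<lambda>p. \<integral>\<^sup>+\<omega>. ennreal (c + (u (fst p) (snd p) \<omega>)\<^sup>2) \<partial>M) \<in> borel_measurable (restrict_space borel half_plane)"
    using borel_measurable_nn_integral_fst[of "\<lambda>w. ennreal (c + (u (fst (fst w)) (snd (fst w)) (snd w))\<^sup>2)"] by simp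
  then have "(\<lambda>p. (\<integral>\<^sup>+\<omega>. ennreal (c + (u (fst p) (snd p) \<omega>)\<^sup>2) \<partial>M) * indicator half_plane p) \<in> borel_measurable borel"
    by (subst (asm) borel_measurable_restrict_space_iff_ennreal) (use half in auto)
  moreover have "(\<lambda>p. (\<integral>\<^sup>+\<omega>. ennreal (c + (u (fst p) (snd p) \<omega>)\<^sup>2) \<partial>M) * indicator half_plane p)
      = (\<lambda>(s, z). indicator {0<..} s * (\<integral>\<^sup>+\<omega>. ennreal (c + (u s z \<omega>)\<^sup>2) \<partial>M))"
    by (auto simp: fun_eq_iff half_plane_def indicator_def)
  ultimately show ?thesis
    by (simp add: lborel_prod)
qed

text \<open>
  The Walsh isometry for \<open>u = 1 + I\<close>.  Since \<open>\<rho>\<^sup>2\<close> is an affine function of the square, the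
  expectation of \<open>\<rho>(u)\<^sup>2\<close> is again expressed by the second moment of \<open>u\<close>: this closes the equation.
\<close>
lemma solution_product_moment:
  fixes u :: "real \<Rightarrow> real \<Rightarrow> 'w \<Rightarrow> real"
  assumes "\<nu> > 0" and rho: "\<And>x. (\<rho> x)\<^sup>2 = lam\<^sup>2 * (c + x\<^sup>2)" "0 \<le> c"
    and sol: "random_field_solution M W \<nu> \<rho> lborel u" and t: "0 < t"
  defines "v \<equiv> \<lambda>s z. indicator {0<..} s * (\<integral>\<^sup>+\<omega>. ennreal (c + (u s z \<omega>)\<^sup>2) \<partial>M)"
  shows "integrable M (\<lambda>\<omega>. (u t x \<omega>)\<^sup>2)"
    and "integrable M (\<lambda>\<omega>. u t x \<omega> * u t y \<omega>)"
    and "1 \<le> expectation (\<lambda>\<omega>. u t x \<omega> * u t y \<omega>)"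
    and "ennreal (expectation (\<lambda>\<omega>. u t x \<omega> * u t y \<omega>) - 1)
      = (\<integral>\<^sup>+s. (\<integral>\<^sup>+z. ennreal (heat_kernel \<nu> (t - s) (x - z) * heat_kernel \<nu> (t - s) (y - z)) * (ennreal (lam\<^sup>2) * v s z) \<partial>lborel) \<partial>lborel)"
proof -
  from sol have filt: "\<And>t x. 0 < t \<Longrightarrow> u t x \<in> borel_measurable (noise_filtration M W t)"
    and joint: "(\<lambda>((t, x), \<omega>). u t x \<omega>) \<in> borel_measurable (restrict_space borel half_plane \<Otimes>\<^sub>M M)"
    by (auto simp: random_field_solution_def)
  from sol obtain I where I: "\<And>t x. 0 < t \<Longrightarrow> has_walsh_integral M W
      (\<lambda>s y \<omega>. indicator {0..t} s * heat_kernel \<nu> (t - s) (x - y) * \<rho> (u s y \<omega>)) (I t x)"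
    and uI: "\<And>t x. 0 < t \<Longrightarrow> AE \<omega> in M. u t x \<omega> = J0 \<nu> lborel t x + I t x \<omega>"
    unfolding random_field_solution_def by blast
  have um [measurable]: "u t x \<in> borel_measurable M" if "0 < t" for t x
    using filt[OF that] by (rule noise_filtration_measurable)
  have Im [measurable]: "I t x \<in> borel_measurable M" for x
    using I[OF t] by (auto simp: has_walsh_integral_def)
  have ae: "AE \<omega> in M. u t x \<omega> = 1 + I t x \<omega>" for x
    using uI[OF t, of x] J0_lborel[OF \<open>\<nu> > 0\<close> t, of x] by simp
  have Isq: "integrable M (\<lambda>\<omega>. (I t x \<omega>)\<^sup>2)" and I0: "expectation (I t x) = 0" for x
    using walsh_isometry(1,2)[OF I[OF t] I[OF t]] by auto
  have I1: "integrable M (I t x)" for x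
    by (rule square_integrable_imp_integrable[OF Im Isq])
  have usq: "integrable M (\<lambda>\<omega>. (u t x \<omega>)\<^sup>2)" for x
  proof (subst integrable_cong_AE[where g="\<lambda>\<omega>. (1 + I t x \<omega>)\<^sup>2"])
    show "AE \<omega> in M. (u t x \<omega>)\<^sup>2 = (1 + I t x \<omega>)\<^sup>2"
      using ae[of x] by eventually_elim simp
    show "integrable M (\<lambda>\<omega>. (1 + I t x \<omega>)\<^sup>2)"
      by (rule integrable_sq_add(1)) (use Isq in auto)
  qed (use t in measurable)
  show "integrable M (\<lambda>\<omega>. (u t x \<omega>)\<^sup>2)" by (rule usq)
  show "integrable M (\<lambda>\<omega>. u t x \<omega> * u t y \<omega>)"
    by (rule integrable_mult_sq[OF um[OF t] um[OF t] usq usq])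
  have II: "integrable M (\<lambda>\<omega>. I t x \<omega> * I t y \<omega>)"
    by (rule integrable_mult_sq[OF Im Im Isq Isq])
  have "expectation (\<lambda>\<omega>. u t x \<omega> * u t y \<omega>) = expectation (\<lambda>\<omega>. 1 + I t x \<omega> + I t y \<omega> + I t x \<omega> * I t y \<omega>)"
  proof (rule integral_cong_AE)
    show "AE \<omega> in M. u t x \<omega> * u t y \<omega> = 1 + I t x \<omega> + I t y \<omega> + I t x \<omega> * I t y \<omega>"
      using ae[of x] ae[of y] by eventually_elim (simp add: algebra_simps)
  qed (use t in measurable)
  also have "\<dots> = 1 + expectation (\<lambda>\<omega>. I t x \<omega> * I t y \<omega>)"
    using I1 II by (simp add: I0 prob_space)
  finally have E: "expectation (\<lambda>\<omega>. u t x \<omega> * u t y \<omega>) - 1 = expectation (\<lambda>\<omega>. I t x \<omega> * I t y \<omega>)"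
    by simp
  let ?P = "process_measure M"
  define Q where "Q = (\<lambda>((s, z), \<omega>). indicator {0..t} s * heat_kernel \<nu> (t - s) (x - z) * \<rho> (u s z \<omega>)
      * (indicator {0..t} s * heat_kernel \<nu> (t - s) (y - z) * \<rho> (u s z \<omega>)))"
  have Q_eq: "Q ((s, z), \<omega>) = indicator {0..t} s * (heat_kernel \<nu> (t - s) (x - z) * heat_kernel \<nu> (t - s) (y - z)) * (lam\<^sup>2 * (c + (u s z \<omega>)\<^sup>2))" for s z \<omega>
  proof -
    have "Q ((s, z), \<omega>) = indicator {0..t} s * (heat_kernel \<nu> (t - s) (x - z) * heat_kernel \<nu> (t - s) (y - z)) * (\<rho> (u s z \<omega>))\<^sup>2"
      by (simp add: Q_def power2_eq_square indicator_def)
    then show ?thesis by (simp only: rho(1))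
  qed
  have Q0: "0 \<le> Q w" for w
    using \<open>\<nu> > 0\<close> \<open>0 \<le> c\<close> by (cases w; cases "fst w") (auto simp: Q_eq intro!: mult_nonneg_nonneg heat_kernel_nonneg)
  have Qint: "integrable ?P Q" and EQ: "expectation (\<lambda>\<omega>. I t x \<omega> * I t y \<omega>) = (LINT w|?P. Q w)"
    unfolding Q_def using walsh_isometry(3,4)[OF I[OF t, of x] I[OF t, of y]] by simp_all
  have "0 \<le> (LINT w|?P. Q w)"
    by (rule integral_nonneg_AE) (simp add: Q0)
  then show "1 \<le> expectation (\<lambda>\<omega>. u t x \<omega> * u t y \<omega>)"
    using E EQ by simp
  note [measurable] = second_moment_measurable[OF joint, of c, folded v_def]
  have half: "half_plane \<in> sets borel"
    by (auto simp: half_plane_def intro!: borel_Times)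
  have "ennreal (LINT w|?P. Q w) = (\<integral>\<^sup>+w. ennreal (Q w) \<partial>?P)"
    using nn_integral_eq_integral[OF Qint] Q0 by simp
  also have "\<dots> = (\<integral>\<^sup>+p. (\<integral>\<^sup>+\<omega>. ennreal (Q (p, \<omega>)) \<partial>M) \<partial>restrict_space lborel half_plane)"
    unfolding process_measure_def
    using borel_measurable_integrable[OF Qint] by (subst nn_integral_fst) (auto simp: process_measure_def)
  also have "\<dots> = (\<integral>\<^sup>+p. (\<integral>\<^sup>+\<omega>. ennreal (Q (p, \<omega>)) \<partial>M) * indicator half_plane p \<partial>lborel)"
    using half by (subst nn_integral_restrict_space) auto
  also have "\<dots> = (\<integral>\<^sup>+p. (\<lambda>(s, z). ennreal (heat_kernel \<nu> (t - s) (x - z) * heat_kernel \<nu> (t - s) (y - z)) * (ennreal (lam\<^sup>2) * v s z)) p \<partial>lborel)"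
  proof (intro nn_integral_cong)
    fix p :: "real \<times> real"
    obtain s z where p: "p = (s, z)" by (cases p)
    show "(\<integral>\<^sup>+\<omega>. ennreal (Q (p, \<omega>)) \<partial>M) * indicator half_plane p
       = (\<lambda>(s, z). ennreal (heat_kernel \<nu> (t - s) (x - z) * heat_kernel \<nu> (t - s) (y - z)) * (ennreal (lam\<^sup>2) * v s z)) p"
    proof (cases "0 < s \<and> s < t")
      case True
      then have [measurable]: "u s z \<in> borel_measurable M" by (intro um) auto
      have "(\<integral>\<^sup>+\<omega>. ennreal (Q (p, \<omega>)) \<partial>M)
         = (\<integral>\<^sup>+\<omega>. ennreal (heat_kernel \<nu> (t - s) (x - z) * heat_kernel \<nu> (t - s) (y - z)) * (ennreal (lam\<^sup>2) * ennreal (c + (u s z \<omega>)\<^sup>2)) \<partial>M)"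
        using True \<open>\<nu> > 0\<close> \<open>0 \<le> c\<close>
        by (intro nn_integral_cong) (simp add: p Q_eq heat_kernel_nonneg del: ennreal_plus flip: ennreal_mult' ennreal_mult)
      then show ?thesis
        using True by (simp add: p v_def half_plane_def nn_integral_cmult)
    next
      case False
      then consider "s \<le> 0" | "t \<le> s" by linarith
      then show ?thesis
        by cases (auto simp: p v_def half_plane_def Q_eq heat_kernel_def)
    qed
  qed
  also have "\<dots> = (\<integral>\<^sup>+s. (\<integral>\<^sup>+z. ennreal (heat_kernel \<nu> (t - s) (x - z) * heat_kernel \<nu> (t - s) (y - z)) * (ennreal (lam\<^sup>2) * v s z) \<partial>lborel) \<partial>lborel)"
    by (subst lborel_prod[symmetric], subst lborel.nn_integral_fst[symmetric]) auto
  finally show "ennreal (expectation (\<lambda>\<omega>. u t x \<omega> * u t y \<omega>) - 1)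
      = (\<integral>\<^sup>+s. (\<integral>\<^sup>+z. ennreal (heat_kernel \<nu> (t - s) (x - z) * heat_kernel \<nu> (t - s) (y - z)) * (ennreal (lam\<^sup>2) * v s z) \<partial>lborel) \<partial>lborel)"
    by (simp only: E EQ)
qed

text \<open>
  On the diagonal the moment equation is the Volterra equation whose solution is known; off the
  diagonal it then evaluates the correlation.
\<close>
lemma solution_correlation:
  fixes u :: "real \<Rightarrow> real \<Rightarrow> 'w \<Rightarrow> real"
  assumes "\<nu> > 0" and rho: "\<And>x. (\<rho> x)\<^sup>2 = lam\<^sup>2 * (c + x\<^sup>2)" "0 \<le> c"
    and sol: "random_field_solution M W \<nu> \<rho> lborel u" and t: "0 < t"
  shows "expectation (\<lambda>\<omega>. u t x \<omega> * u t y \<omega>)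
    = 1 + (1 + c) * corr_excess (lam\<^sup>2 / (2 * sqrt \<nu>)) (\<bar>x - y\<bar> / (2 * sqrt \<nu>)) t"
proof -
  define v where "v s z = indicator {0<..} s * (\<integral>\<^sup>+\<omega>. ennreal (c + (u s z \<omega>)\<^sup>2) \<partial>M)" for s z
  let ?b = "lam\<^sup>2 / (2 * sqrt \<nu>)" and ?d = "\<bar>x - y\<bar> / (2 * sqrt \<nu>)"
  note moment = solution_product_moment[OF \<open>\<nu> > 0\<close> rho sol, folded v_def]
  have joint: "(\<lambda>((t, x), \<omega>). u t x \<omega>) \<in> borel_measurable (restrict_space borel half_plane \<Otimes>\<^sub>M M)"
    using sol by (auto simp: random_field_solution_def)
  have vm [measurable]: "(\<lambda>(s, z). v s z) \<in> borel_measurable (lborel \<Otimes>\<^sub>M lborel)"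
    using second_moment_measurable[OF joint, of c] by (simp add: v_def[abs_def])
  have v: "v s z = ennreal (c + expectation (\<lambda>\<omega>. u s z \<omega> * u s z \<omega>))" if "0 < s" for s z
  proof -
    have "(\<integral>\<^sup>+\<omega>. ennreal (c + (u s z \<omega>)\<^sup>2) \<partial>M) = ennreal (expectation (\<lambda>\<omega>. c + (u s z \<omega>)\<^sup>2))"
      using moment(1)[OF that, of z] rho(2) by (intro nn_integral_eq_integral) auto
    also have "expectation (\<lambda>\<omega>. c + (u s z \<omega>)\<^sup>2) = c + expectation (\<lambda>\<omega>. u s z \<omega> * u s z \<omega>)"
      using moment(1)[OF that, of z] by (simp add: prob_space power2_eq_square)
    finally show ?thesis using that by (simp add: v_def)
  qed
  have v_sol: "v s z = (if 0 < s then ennreal ((1 + c) * growth ?b s) else 0)" for s z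
  proof (rule volterra_solution_unique[OF vm, where \<kappa> = "\<nu> / 2"])
    fix s z :: real assume s: "0 < s"
    show "v s z < top" using v[OF s] by simp
    have "ennreal (expectation (\<lambda>\<omega>. u s z \<omega> * u s z \<omega>) - 1)
      = (\<integral>\<^sup>+r. (\<integral>\<^sup>+w. ennreal (lam\<^sup>2) * ennreal ((heat_kernel \<nu> (s - r) (z - w))\<^sup>2) * v r w \<partial>lborel) \<partial>lborel)"
      unfolding moment(4)[OF s] by (simp add: power2_eq_square mult_ac)
    also have "\<dots> = (\<integral>\<^sup>+r. (\<integral>\<^sup>+w. ennreal (heat_kernel (\<nu> / 2) (s - r) (z - w)) * v r w * sing_kernel ?b 0 (s - r) \<partial>lborel) \<partial>lborel)"
      unfolding heat_kernel_square[OF \<open>\<nu> > 0\<close>] by (simp add: mult_ac)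
    also have "\<dots> = heat_volterra (\<nu> / 2) ?b v s z"
      unfolding heat_volterra_def by (intro nn_integral_cong nn_integral_multc) measurable
    finally have "heat_volterra (\<nu> / 2) ?b v s z = ennreal (expectation (\<lambda>\<omega>. u s z \<omega> * u s z \<omega>) - 1)" ..
    then show "v s z = ennreal (1 + c) + heat_volterra (\<nu> / 2) ?b v s z"
      using v[OF s, of z] moment(3)[OF s, of z z] rho(2) by (simp flip: ennreal_plus)
  qed (use \<open>\<nu> > 0\<close> rho(2) in \<open>auto simp: v_def\<close>)
  let ?g = "\<lambda>s. if 0 < s then ennreal (growth ?b s) else 0"
  have vg: "v s z = ennreal (1 + c) * ?g s" for s z
    using v_sol rho(2) by (simp add: ennreal_mult')
  have gm [measurable]: "?g \<in> borel_measurable borel"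
    unfolding growth_def by measurable
  have "ennreal (expectation (\<lambda>\<omega>. u t x \<omega> * u t y \<omega>) - 1)
    = (\<integral>\<^sup>+s. (\<integral>\<^sup>+z. ennreal (heat_kernel \<nu> (t - s) (x - z) * heat_kernel \<nu> (t - s) (y - z)) * (ennreal (lam\<^sup>2) * (ennreal (1 + c) * ?g s)) \<partial>lborel) \<partial>lborel)"
    unfolding moment(4)[OF t] vg ..
  also have "\<dots> = (\<integral>\<^sup>+s. (ennreal (lam\<^sup>2) * (\<integral>\<^sup>+z. ennreal (heat_kernel \<nu> (t - s) (x - z) * heat_kernel \<nu> (t - s) (y - z)) \<partial>lborel)) * (ennreal (1 + c) * ?g s) \<partial>lborel)"
    by (intro nn_integral_cong, subst nn_integral_multc) (auto simp: mult_ac)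
  also have "\<dots> = ((\<lambda>s. ennreal (1 + c) * ?g s) \<star> sing_kernel ?b ?d) t"
    unfolding heat_kernel_product[OF \<open>\<nu> > 0\<close>] time_conv_def by (simp only: mult.commute)
  also have "\<dots> = ennreal (1 + c) * (sing_kernel ?b ?d \<star> ?g) t"
    by (subst time_conv_cmult_left, measurable) (simp add: time_conv_commute[of ?g])
  also have "\<dots> = ennreal ((1 + c) * corr_excess ?b ?d t)"
    using \<open>\<nu> > 0\<close> t rho(2) by (simp add: sing_kernel_conv_growth ennreal_mult')
  finally have "expectation (\<lambda>\<omega>. u t x \<omega> * u t y \<omega>) - 1 = (1 + c) * corr_excess ?b ?d t"
    using moment(3)[OF t, of x y] corr_excess_eq(2)[of ?b ?d t] t rho(2) \<open>\<nu> > 0\<close>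
    by (subst (asm) ennreal_inj) auto
  then show ?thesis by simp
qed

end

lemma corr_excess_eq_closed_form:
  assumes "\<nu> > 0" "t > 0"
  shows "corr_excess (lam\<^sup>2 / (2 * sqrt \<nu>)) (d / (2 * sqrt \<nu>)) t
    = exp ((lam ^ 4 * t - 2 * lam\<^sup>2 * d) / (4 * \<nu>)) * erfc ((d - lam\<^sup>2 * t) / (2 * sqrt (\<nu> * t)))
      - erfc (d / (2 * sqrt (\<nu> * t)))"
proof -
  let ?b = "lam\<^sup>2 / (2 * sqrt \<nu>)" and ?\<delta> = "d / (2 * sqrt \<nu>)"
  have 1: "?b\<^sup>2 * t - 2 * ?b * ?\<delta> = (lam ^ 4 * t - 2 * lam\<^sup>2 * d) / (4 * \<nu>)"
    using assms by (simp add: power_divide power_mult_distrib field_simps)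
  have "?b * sqrt t = (lam\<^sup>2 * (sqrt t * sqrt t)) / (2 * (sqrt \<nu> * sqrt t))"
    using assms by (simp del: real_sqrt_mult_self)
  then have 2: "?b * sqrt t = lam\<^sup>2 * t / (2 * sqrt (\<nu> * t))"
    using assms by (simp add: real_sqrt_mult)
  have 3: "?\<delta> / sqrt t = d / (2 * sqrt (\<nu> * t))"
    using assms by (simp add: real_sqrt_mult)
  show ?thesis
    unfolding corr_excess_def 1 2 3 by (simp add: diff_divide_distrib)
qed

lemma H_fun_eq_corr_excess:
  assumes "\<nu> > 0" "t > 0"
  shows "H_fun \<nu> lam t = corr_excess (lam\<^sup>2 / (2 * sqrt \<nu>)) 0 t"
proof -
  have "lam\<^sup>2 * sqrt (t / (2 * \<nu>)) / sqrt 2 = lam\<^sup>2 / (2 * sqrt \<nu>) * sqrt t"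
    using assms by (simp add: real_sqrt_divide real_sqrt_mult)
  moreover have "(lam\<^sup>2 / (2 * sqrt \<nu>))\<^sup>2 * t = lam ^ 4 * t / (4 * \<nu>)"
    using assms by (simp add: power_divide power_mult_distrib)
  ultimately show ?thesis
    by (simp add: H_fun_def corr_excess_def Phi_eq_erfc)
qed

theorem corollary2p3:
  fixes M :: "'w measure" and W :: "(real \<times> real) set \<Rightarrow> 'w \<Rightarrow> real"
    and \<nu> lam vs :: real and \<rho> :: "real \<Rightarrow> real"
    and u :: "real \<Rightarrow> real \<Rightarrow> 'w \<Rightarrow> real"
  assumes "prob_space M"
    and "space_time_white_noise M W"
    and "\<nu> > 0"
    and "vs \<ge> 0"
    and "\<exists>L. L-lipschitz_on UNIV \<rho>"
    and "\<And>x. \<bar>\<rho> x\<bar>\<^sup>2 = lam\<^sup>2 * (vs\<^sup>2 + x\<^sup>2)"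
    and "random_field_solution M W \<nu> \<rho> lborel u"
  shows "(\<forall>t>0. \<forall>x y.
            integrable M (\<lambda>\<omega>. u t x \<omega> * u t y \<omega>) \<and>
            prob_space.expectation M (\<lambda>\<omega>. u t x \<omega> * u t y \<omega>) =
              1 + (1 + vs\<^sup>2) *
                (exp ((lam ^ 4 * t - 2 * lam\<^sup>2 * \<bar>x - y\<bar>) / (4 * \<nu>))
                   * erfc ((\<bar>x - y\<bar> - lam\<^sup>2 * t) / (2 * sqrt (\<nu> * t)))
                 - erfc (\<bar>x - y\<bar> / (2 * sqrt (\<nu> * t))))) \<and>
         (\<forall>t>0. \<forall>x.
            prob_space.expectation M (\<lambda>\<omega>. \<bar>u t x \<omega>\<bar>\<^sup>2) = 1 + (1 + vs\<^sup>2) * H_fun \<nu> lam t)"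
proof -
  interpret prob_space M by fact
  interpret white_noise M W by standard fact
  have rho: "\<And>x. (\<rho> x)\<^sup>2 = lam\<^sup>2 * (vs\<^sup>2 + x\<^sup>2)"
    using assms(6) by simp
  note corr = solution_correlation[OF assms(3) rho zero_le_power2 assms(7)]
  note int = solution_product_moment(2)[OF assms(3) rho zero_le_power2 assms(7)]
  show ?thesis
  proof (intro conjI allI impI)
    fix t x y :: real assume t: "0 < t"
    show "integrable M (\<lambda>\<omega>. u t x \<omega> * u t y \<omega>)"
      by (rule int[OF t])
    show "expectation (\<lambda>\<omega>. u t x \<omega> * u t y \<omega>) =
              1 + (1 + vs\<^sup>2) *
                (exp ((lam ^ 4 * t - 2 * lam\<^sup>2 * \<bar>x - y\<bar>) / (4 * \<nu>))
                   * erfc ((\<bar>x - y\<bar> - lam\<^sup>2 * t) / (2 * sqrt (\<nu> * t)))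
                 - erfc (\<bar>x - y\<bar> / (2 * sqrt (\<nu> * t))))"
      unfolding corr[OF t] corr_excess_eq_closed_form[OF assms(3) t] ..
    show "expectation (\<lambda>\<omega>. \<bar>u t x \<omega>\<bar>\<^sup>2) = 1 + (1 + vs\<^sup>2) * H_fun \<nu> lam t"
      using corr[OF t, of x x] by (simp add: H_fun_eq_corr_excess[OF assms(3) t] power2_eq_square)
  qed
qed

end
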